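(* For a precompact abelian group $(G,\tau)$ the following are equivalent: (i) $(G,\tau)$ is $ss$-characterized. (ii) $(G,\tau)$ has a countable $B$-embedded subgroup $H$ which (with the topology $\tau|_H$) is $ss$-characterized.
   Context: All topological groups are Hausdorff and abelian. $\mathbb{T}=\mathbb{R}/\mathbb{Z}$. "Countable" means finite or countably infinite. A group topology on $G$ is precompact if it is Hausdorff and for every neighborhood $U$ of $0$ there is a finite $F\subseteq G$ with $F+U=G$. A sequence $\mathbf{u}=(u_n)$ in an abelian group $G$ is a $TB$-sequence if there is a precompact group topology on $G$ in which $u_n\to0$; then $\tau_{\mathbf{u}}$ denotes the finest precompact group topology on $G$ in which $u_n\to 0$. A precompact group $(G,\tau)$ is $ss$-characterized if there is a $TB$-sequence $\mathbf{u}$ in $G$ with $\tau=\tau_{\mathbf{u}}$. A subgroup $H$ of a topological abelian group $G$ is $B$-embedded if every (algebraic) character $\chi:G/H\to\mathbb{T}$ is continuous in the quotient topology of $G/H$. *)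

theory Defs
  imports "HOL-Algebra.Algebra" "HOL-Analysis.Analysis"
begin

text \<open>Abelian groups are written multiplicatively, as in \<open>HOL-Algebra\<close>: the neutral element is
  \<open>\<one>\<close>, and the sum \<open>F + U\<close> of two subsets is \<open>F <#> U\<close>. Topologies on a group are separate from the
  group record, since several topologies on the same group are compared.\<close>

definition top_ab_group :: "('a, 'b) monoid_scheme \<Rightarrow> 'a topology \<Rightarrow> bool" where
  "top_ab_group G T \<longleftrightarrow>
     comm_group G \<and> topspace T = carrier G \<and>
     continuous_map (prod_topology T T) T (\<lambda>(x, y). x \<otimes>\<^bsub>G\<^esub> y) \<and>
     continuous_map T T (\<lambda>x. inv\<^bsub>G\<^esub> x) \<and>
     Hausdorff_space T"

definition nbhd_of :: "'a topology \<Rightarrow> 'a \<Rightarrow> 'a set \<Rightarrow> bool" where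
  "nbhd_of T x U \<longleftrightarrow> U \<subseteq> topspace T \<and> (\<exists>V. openin T V \<and> x \<in> V \<and> V \<subseteq> U)"

definition precompact_group :: "('a, 'b) monoid_scheme \<Rightarrow> 'a topology \<Rightarrow> bool" where
  "precompact_group G T \<longleftrightarrow>
     top_ab_group G T \<and>
     (\<forall>U. nbhd_of T \<one>\<^bsub>G\<^esub> U \<longrightarrow>
        (\<exists>F. finite F \<and> F \<subseteq> carrier G \<and> F <#>\<^bsub>G\<^esub> U = carrier G))"

definition TB_sequence :: "('a, 'b) monoid_scheme \<Rightarrow> (nat \<Rightarrow> 'a) \<Rightarrow> bool" where
  "TB_sequence G u \<longleftrightarrow>
     range u \<subseteq> carrier G \<and>
     (\<exists>T. precompact_group G T \<and> limitin T u \<one>\<^bsub>G\<^esub> sequentially)"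

text \<open>\<open>is_tau G u T\<close> says that \<open>T\<close> is the topology \<open>\<tau>\<^sub>u\<close>; the finest topology of the stated kind
  is unique by antisymmetry of the refinement order.\<close>

definition is_tau :: "('a, 'b) monoid_scheme \<Rightarrow> (nat \<Rightarrow> 'a) \<Rightarrow> 'a topology \<Rightarrow> bool" where
  "is_tau G u T \<longleftrightarrow>
     precompact_group G T \<and> limitin T u \<one>\<^bsub>G\<^esub> sequentially \<and>
     (\<forall>T'. precompact_group G T' \<and> limitin T' u \<one>\<^bsub>G\<^esub> sequentially \<longrightarrow>
        (\<forall>W. openin T' W \<longrightarrow> openin T W))"

definition ss_characterized :: "('a, 'b) monoid_scheme \<Rightarrow> 'a topology \<Rightarrow> bool" where
  "ss_characterized G T \<longleftrightarrow>
     precompact_group G T \<and> (\<exists>u. TB_sequence G u \<and> is_tau G u T)"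

text \<open>A set \<open>W\<close> of cosets is open iff its preimage under the coset map is open.\<close>

definition quotient_topology ::
  "('a, 'b) monoid_scheme \<Rightarrow> 'a topology \<Rightarrow> 'a set \<Rightarrow> 'a set topology" where
  "quotient_topology G T H =
     topology (\<lambda>W. W \<subseteq> carrier (G Mod H) \<and>
       openin T {x \<in> topspace T. H #>\<^bsub>G\<^esub> x \<in> W})"

lemma openin_quotient_topology:
  "openin (quotient_topology G T H) W \<longleftrightarrow>
     W \<subseteq> carrier (G Mod H) \<and> openin T {x \<in> topspace T. H #>\<^bsub>G\<^esub> x \<in> W}"
proof -
  let ?P = "\<lambda>W. W \<subseteq> carrier (G Mod H) \<and> openin T {x \<in> topspace T. H #>\<^bsub>G\<^esub> x \<in> W}"
  have "istopology ?P"
    unfolding istopology_def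
  proof (intro conjI allI impI)
    fix S S' assume "?P S" "?P S'"
    moreover have "{x \<in> topspace T. H #>\<^bsub>G\<^esub> x \<in> S \<inter> S'} =
        {x \<in> topspace T. H #>\<^bsub>G\<^esub> x \<in> S} \<inter> {x \<in> topspace T. H #>\<^bsub>G\<^esub> x \<in> S'}"
      by blast
    ultimately show "S \<inter> S' \<subseteq> carrier (G Mod H)"
      "openin T {x \<in> topspace T. H #>\<^bsub>G\<^esub> x \<in> S \<inter> S'}"
      by auto
  next
    fix \<K> assume K: "\<forall>S\<in>\<K>. ?P S"
    have "{x \<in> topspace T. H #>\<^bsub>G\<^esub> x \<in> \<Union>\<K>} =
        (\<Union>S\<in>\<K>. {x \<in> topspace T. H #>\<^bsub>G\<^esub> x \<in> S})"
      by blast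
    with K show "openin T {x \<in> topspace T. H #>\<^bsub>G\<^esub> x \<in> \<Union>\<K>}"
      by auto
    from K show "\<Union>\<K> \<subseteq> carrier (G Mod H)"
      by blast
  qed
  then show ?thesis
    by (simp add: quotient_topology_def topology_inverse')
qed

lemma topspace_quotient_topology:
  assumes "topspace T = carrier G"
  shows "topspace (quotient_topology G T H) = carrier (G Mod H)"
proof -
  have "{x \<in> topspace T. H #>\<^bsub>G\<^esub> x \<in> carrier (G Mod H)} = topspace T"
    using assms by (auto simp: carrier_FactGroup)
  then have "openin (quotient_topology G T H) (carrier (G Mod H))"
    by (simp add: openin_quotient_topology)
  then show ?thesis
    by (meson openin_quotient_topology openin_subset openin_topspace subset_antisym)
qed

definition real_add_group :: "real monoid" where
  "real_add_group = \<lparr>carrier = UNIV, monoid.mult = (+), one = 0\<rparr>"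

definition circle_group :: "real set monoid" where
  "circle_group = real_add_group Mod \<int>"

definition circle_topology :: "real set topology" where
  "circle_topology = quotient_topology real_add_group euclideanreal \<int>"

definition B_embedded :: "('a, 'b) monoid_scheme \<Rightarrow> 'a topology \<Rightarrow> 'a set \<Rightarrow> bool" where
  "B_embedded G T H \<longleftrightarrow>
     subgroup H G \<and>
     (\<forall>\<phi> \<in> hom (G Mod H) circle_group.
        continuous_map (quotient_topology G T H) circle_topology \<phi>)"

end

theory Submission
  imports Defs
begin

text \<open>
  Write \<open>\<theta>\<close> for a character of \<open>G\<close> with values in the complex unit circle. The equivalence rests on the fact
  that a precompact abelian topology is determined by its continuous characters, in the following
  strong form: given a subgroup \<open>H\<close> and a neighbourhood \<open>U\<close> of the identity, there are finitely many continuous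
  characters, trivial on \<open>H\<close>, such that every point at which they are all close to \<open>1\<close> lies in \<open>U H\<close>
  (\<open>characters_trivial_on_subgroup\<close>). For trivial \<open>H\<close> this says that the continuous characters generate the
  topology (\<open>finer_by_characters\<close>).

  Let the topology \<open>\<tau>\<close> of \<open>G\<close> be the finest precompact one in which \<open>u\<close> converges to the identity, and let \<open>\<theta>\<close>
  be a character with \<open>\<theta> (u\<^sub>n) \<longlonglongrightarrow> 1\<close>. Adjoining \<open>\<theta>\<close> to \<open>\<tau>\<close> preserves precompactness and the convergence of
  \<open>u\<close>, so \<open>\<theta>\<close> is \<open>\<tau>\<close>-continuous. Let \<open>H\<close> be the subgroup generated by the terms of \<open>u\<close>. Characters trivial on \<open>H\<close>
  are of this kind, so \<open>H\<close> is \<open>B\<close>-embedded. If \<open>u\<close> converges to the identity in some precompact topology on \<open>H\<close>,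
  extend the continuous characters of that topology to \<open>G\<close>; the extensions are again of this kind, hence
  \<open>\<tau>\<close>-continuous, and therefore the topology is coarser than the restriction of \<open>\<tau>\<close>.

  Conversely, let \<open>H\<close> be \<open>B\<close>-embedded and characterized by \<open>u\<close>. The same sequence characterizes \<open>G\<close>: let \<open>\<theta>\<close>
  be continuous for some precompact topology on \<open>G\<close> in which \<open>u\<close> converges to the identity, and let \<open>\<tau>'\<close> arise
  from \<open>\<tau>\<close> by adjoining \<open>\<theta>\<close>. On \<open>H\<close> the topologies \<open>\<tau>\<close> and \<open>\<tau>'\<close> agree by the choice of \<open>u\<close>. They also agree
  on the quotient, whose \<open>\<tau>'\<close>-topology is generated by characters of \<open>G\<close> trivial on \<open>H\<close>, and these are
  \<open>\<tau>\<close>-continuous. Hence \<open>\<tau> = \<tau>'\<close> (\<open>character_continuous_extension\<close>), and \<open>\<theta>\<close> is \<open>\<tau>\<close>-continuous.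

  It remains to produce continuous characters. Neighbourhoods are described by totally bounded norms,
  and an invariant mean on the bounded functions of the group, a limit of averages over large boxes,
  makes it possible to speak of convolutions and Fourier coefficients without completing the group. The
  key statement is that a uniformly continuous function that does not vanish at the identity has a
  nonzero Fourier coefficient at some uniformly continuous character (\<open>ex_correlated_character\<close>). This
  character is obtained as the solution of an extremal problem: it is the limit of normalized positive
  definite functions whose convolution with the given function is as large as possible in the
  mean-square norm. If characters did not control the norm, a bump function and a limit of its translates
  would have the same Fourier coefficients without being equal (\<open>norm_dominated_by_characters\<close>).
\<close>

section \<open>Compactness of pointwise convergence\<close>

text \<open>Tychonoff's theorem, in the form in which limits are taken below. Limits along nets indexed by
  finite sets are needed, so subsequences do not suffice; refining the filter itself means that
  afterwards all coordinates converge along one and the same filter, and the usual limit laws apply.\<close>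
lemma pointwise_convergent_subfilter:
  fixes A :: "'i \<Rightarrow> 'x \<Rightarrow> complex"
  assumes "F \<noteq> bot" and bd: "\<And>i x. norm (A i x) \<le> B x"
  obtains F' l where "F' \<noteq> bot" "F' \<le> F" "\<And>x. tendsto (\<lambda>i. A i x) (l x) F'"
proof -
  define K where "K = Pi\<^sub>E (UNIV :: 'x set) (\<lambda>x. cball (0::complex) (B x))"
  have "compactin (product_topology (\<lambda>_. euclidean) UNIV) K"
    unfolding K_def compactin_PiE by simp
  then have "compact K"
    by (simp add: euclidean_product_topology)
  moreover have "filtermap A F \<noteq> bot"
    using assms(1) by (simp add: filtermap_bot_iff)
  moreover have "eventually (\<lambda>y. y \<in> K) (filtermap A F)"
    using bd by (simp add: eventually_filtermap K_def PiE_def Pi_def)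
  ultimately obtain l where l: "inf (nhds l) (filtermap A F) \<noteq> bot"
    unfolding compact_filter by blast
  define F' where "F' = inf F (filtercomap A (nhds l))"
  have "F' \<noteq> bot"
  proof
    assume "F' = bot"
    then have "eventually (\<lambda>_. False) F'" by simp
    then obtain P Q where P: "eventually P F" and Q: "eventually Q (filtercomap A (nhds l))"
      and PQ: "\<And>i. P i \<Longrightarrow> Q i \<Longrightarrow> False"
      unfolding F'_def eventually_inf by auto
    obtain R where R: "eventually R (nhds l)" and RQ: "\<And>i. R (A i) \<Longrightarrow> Q i"
      using Q unfolding eventually_filtercomap by auto
    have "eventually (\<lambda>y. \<not> R y) (filtermap A F)"
      unfolding eventually_filtermap using P by eventually_elim (use RQ PQ in blast)
    with R have "eventually (\<lambda>_. False) (inf (nhds l) (filtermap A F))"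
      unfolding eventually_inf by blast
    with l show False by (simp add: trivial_limit_def)
  qed
  moreover have "F' \<le> F" by (simp add: F'_def)
  moreover have "tendsto (\<lambda>i. A i x) (l x) F'" for x
  proof -
    have "continuous_on UNIV (\<lambda>y. y x :: complex)"
      by (rule continuous_on_product_coordinates)
    then have "tendsto (\<lambda>y. y x) (l x) (nhds l)"
      unfolding continuous_on_def by (intro tendsto_at_iff_tendsto_nhds[THEN iffD1]) blast
    moreover have "filterlim A (nhds l) F'"
      unfolding F'_def by (meson filterlim_filtercomap filterlim_mono inf_le2 order_refl)
    ultimately show ?thesis
      by (rule filterlim_compose)
  qed
  ultimately show ?thesis using that by blast
qed

section \<open>Invariant means on abelian groups\<close>

definition bounded_fun :: "('a, 'b) monoid_scheme \<Rightarrow> ('a \<Rightarrow> complex) \<Rightarrow> bool" where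
  "bounded_fun G f \<longleftrightarrow> (\<exists>B. \<forall>x\<in>carrier G. norm (f x) \<le> B)"

locale invariant_mean = comm_group G for G (structure) +
  fixes M :: "('a \<Rightarrow> complex) \<Rightarrow> complex"
  assumes M_add: "bounded_fun G f \<Longrightarrow> bounded_fun G g \<Longrightarrow> M (\<lambda>x. f x + g x) = M f + M g"
    and M_scale: "bounded_fun G f \<Longrightarrow> M (\<lambda>x. c * f x) = c * M f"
    and M_cnj: "bounded_fun G f \<Longrightarrow> M (\<lambda>x. cnj (f x)) = cnj (M f)"
    and M_le: "(\<And>x. x \<in> carrier G \<Longrightarrow> norm (f x) \<le> B) \<Longrightarrow> norm (M f) \<le> B"
    and M_one: "M (\<lambda>_. 1) = 1"
    and M_shift: "bounded_fun G f \<Longrightarrow> a \<in> carrier G \<Longrightarrow> M (\<lambda>x. f (x \<otimes> a)) = M f"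

text \<open>The average of \<open>f\<close> over all products of powers of the listed elements with exponents below \<open>N\<close>,
  counted with multiplicity. Averaging in one direction at a time avoids any description of this box as
  a set.\<close>
fun box_mean :: "('a, 'b) monoid_scheme \<Rightarrow> nat \<Rightarrow> 'a list \<Rightarrow> ('a \<Rightarrow> complex) \<Rightarrow> complex" where
  "box_mean G N [] f = f \<one>\<^bsub>G\<^esub>"
| "box_mean G N (g # L) f =
     box_mean G N L (\<lambda>x. (\<Sum>j<N. f (x \<otimes>\<^bsub>G\<^esub> g [^]\<^bsub>G\<^esub> j)) / of_nat N)"

lemma box_mean_add: "box_mean G N L (\<lambda>x. f x + g x) = box_mean G N L f + box_mean G N L g"
  by (induction L arbitrary: f g) (simp_all add: sum.distrib add_divide_distrib)

lemma box_mean_scale: "box_mean G N L (\<lambda>x. c * f x) = c * box_mean G N L f"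
proof (induction L arbitrary: f)
  case (Cons a L)
  have "(\<lambda>x. (\<Sum>j<N. c * f (x \<otimes>\<^bsub>G\<^esub> a [^]\<^bsub>G\<^esub> j)) / of_nat N) =
        (\<lambda>x. c * ((\<Sum>j<N. f (x \<otimes>\<^bsub>G\<^esub> a [^]\<^bsub>G\<^esub> j)) / of_nat N))"
    by (simp add: sum_distrib_left)
  then show ?case by (simp only: box_mean.simps Cons.IH)
qed simp

lemma box_mean_cnj: "box_mean G N L (\<lambda>x. cnj (f x)) = cnj (box_mean G N L f)"
proof (induction L arbitrary: f)
  case (Cons a L)
  have "(\<lambda>x. (\<Sum>j<N. cnj (f (x \<otimes>\<^bsub>G\<^esub> a [^]\<^bsub>G\<^esub> j))) / of_nat N) =
        (\<lambda>x. cnj ((\<Sum>j<N. f (x \<otimes>\<^bsub>G\<^esub> a [^]\<^bsub>G\<^esub> j)) / of_nat N))"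
    by simp
  then show ?case by (simp only: box_mean.simps Cons.IH)
qed simp

lemma box_mean_one: "N > 0 \<Longrightarrow> box_mean G N L (\<lambda>_. 1) = 1"
  by (induction L) simp_all

context comm_group
begin

lemma box_mean_le:
  assumes "N > 0" "set L \<subseteq> carrier G" "\<And>x. x \<in> carrier G \<Longrightarrow> norm (f x) \<le> B"
  shows "norm (box_mean G N L f) \<le> B"
  using assms(2,3)
proof (induction L arbitrary: f)
  case (Cons g L)
  have "norm ((\<Sum>j<N. f (x \<otimes> g [^] j)) / of_nat N) \<le> B" if "x \<in> carrier G" for x
  proof -
    have "norm (\<Sum>j<N. f (x \<otimes> g [^] j)) \<le> (\<Sum>j<N. B)"
      using Cons.prems that by (intro order.trans[OF norm_sum] sum_mono) auto
    then show ?thesis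
      using \<open>N > 0\<close> by (simp add: norm_divide divide_simps mult.commute)
  qed
  with Cons show ?case by simp
qed simp

lemma box_mean_cong:
  assumes "N > 0" "set L \<subseteq> carrier G" "\<And>x. x \<in> carrier G \<Longrightarrow> f x = g x"
  shows "box_mean G N L f = box_mean G N L g"
proof -
  have "norm (box_mean G N L (\<lambda>x. f x + (-1) * g x)) \<le> 0"
    using assms by (intro box_mean_le) auto
  then show ?thesis
    unfolding box_mean_add box_mean_scale by simp
qed

text \<open>Long boxes are almost invariant: in the direction of one of its generators a translated box
  differs from the original one in two opposite faces only, and these carry weight \<open>2 / N\<close>.\<close>
lemma box_mean_shift:
  assumes "N > 0" "set L \<subseteq> carrier G" "g \<in> set L"
    and "\<And>x. x \<in> carrier G \<Longrightarrow> norm (f x) \<le> B"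
  shows "norm (box_mean G N L (\<lambda>x. f (x \<otimes> g)) - box_mean G N L f) \<le> 2 * B / N"
  using assms(2,3,4)
proof (induction L arbitrary: f)
  case (Cons a L)
  define h where "h x = (\<Sum>j<N. f (x \<otimes> a [^] j)) / of_nat N" for x
  have a: "a \<in> carrier G" and g: "g \<in> carrier G" using Cons.prems by auto
  show ?case
  proof (cases "g = a")
    case True
    have tele: "(\<Sum>j<N. f (x \<otimes> a [^] j \<otimes> a)) / of_nat N + (-1) * h x
          = (f (x \<otimes> a [^] N) - f x) / of_nat N" if "x \<in> carrier G" for x
    proof -
      have "x \<otimes> a [^] j \<otimes> a = x \<otimes> a [^] Suc j" for j
        using a that by (simp add: m_assoc)
      then have "(\<Sum>j<N. f (x \<otimes> a [^] j \<otimes> a)) - (\<Sum>j<N. f (x \<otimes> a [^] j)) =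
           f (x \<otimes> a [^] N) - f (x \<otimes> a [^] (0::nat))"
        by (simp only: sum_subtractf[symmetric]) (rule sum_lessThan_telescope)
      then show ?thesis using that by (simp add: h_def diff_divide_distrib[symmetric])
    qed
    have "norm (box_mean G N L (\<lambda>x. (\<Sum>j<N. f (x \<otimes> a [^] j \<otimes> a)) / of_nat N + (-1) * h x)) \<le> 2 * B / N"
    proof (rule box_mean_le)
      fix x assume x: "x \<in> carrier G"
      have "norm (f (x \<otimes> a [^] N) - f x) \<le> B + B"
        using Cons.prems x a by (intro order.trans[OF norm_triangle_ineq4] add_mono) auto
      then show "norm ((\<Sum>j<N. f (x \<otimes> a [^] j \<otimes> a)) / of_nat N + (-1) * h x) \<le> 2 * B / N"
        unfolding tele[OF x] using \<open>N > 0\<close> by (simp add: norm_divide divide_simps)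
    qed (use assms Cons.prems in auto)
    then show ?thesis
      unfolding True box_mean.simps box_mean_add box_mean_scale h_def by simp
  next
    case False
    have "norm (h x) \<le> B" if "x \<in> carrier G" for x
      using box_mean_le[of N "[a]" "\<lambda>y. f (x \<otimes> y)" B] Cons.prems that \<open>N > 0\<close>
      by (simp add: h_def)
    then have "norm (box_mean G N L (\<lambda>x. h (x \<otimes> g)) - box_mean G N L h) \<le> 2 * B / N"
      using Cons False by auto
    moreover have "box_mean G N (a # L) (\<lambda>x. f (x \<otimes> g)) = box_mean G N L (\<lambda>x. h (x \<otimes> g))"
      unfolding box_mean.simps
    proof (rule box_mean_cong)
      fix x assume "x \<in> carrier G"
      then have "x \<otimes> a [^] j \<otimes> g = x \<otimes> g \<otimes> a [^] j" for j :: nat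
        using a g by (simp add: m_ac)
      then show "(\<Sum>j<N. f (x \<otimes> a [^] j \<otimes> g)) / of_nat N = h (x \<otimes> g)"
        by (simp add: h_def)
    qed (use assms Cons.prems in auto)
    ultimately show ?thesis by (simp add: h_def[abs_def])
  qed
qed simp

text \<open>The box averages form a net, indexed by a finite set of generators and a side length. A
  pointwise limit along a refinement of this net is exactly invariant under every group element,
  because every group element is eventually one of the generators.\<close>
theorem ex_invariant_mean: "\<exists>M. invariant_mean G M"
proof -
  define I where "I = finite_subsets_at_top (carrier G) \<times>\<^sub>F sequentially"
  \<comment> \<open>Unbounded functions are sent to \<open>0\<close>: the compactness argument needs a bound in every coordinate.\<close>
  define A where "A i f = (if bounded_fun G f \<and> finite (fst i) \<and> fst i \<subseteq> carrier G
     then box_mean G (Suc (snd i)) (SOME L. set L = fst i) f else 0)" for i f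
  have L: "set (SOME L. set L = S) = S" if "finite S" for S :: "'a set"
    using finite_list[OF that] by (rule someI_ex)
  define B where "B f = (if bounded_fun G f then max 0 (SOME B. \<forall>x\<in>carrier G. norm (f x) \<le> B) else 0)" for f
  have B: "\<forall>x\<in>carrier G. norm (f x) \<le> B f" if "bounded_fun G f" for f
  proof -
    have "\<forall>x\<in>carrier G. norm (f x) \<le> (SOME B. \<forall>x\<in>carrier G. norm (f x) \<le> B)"
      using that unfolding bounded_fun_def by (rule someI_ex)
    then show ?thesis using that by (fastforce simp: B_def)
  qed
  have "B f \<ge> 0" for f by (simp add: B_def)
  then have "norm (A i f) \<le> B f" for i f
    using B[of f] box_mean_le[of "Suc (snd i)" "SOME L. set L = fst i" f "B f"] L[of "fst i"]
    by (simp add: A_def)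
  moreover have "I \<noteq> bot"
    by (simp add: I_def prod_filter_eq_bot finite_subsets_at_top_neq_bot)
  ultimately obtain F M where F: "F \<noteq> bot" "F \<le> I" and AM: "\<And>f. tendsto (\<lambda>i. A i f) (M f) F"
    using pointwise_convergent_subfilter[of I A B] by blast
  have ev: "eventually P F" if "eventually P I" for P
    using F(2) that by (rule filter_leD)
  define good where "good i \<longleftrightarrow> finite (fst i) \<and> fst i \<subseteq> carrier G" for i :: "'a set \<times> nat"
  have evg: "eventually (\<lambda>i. g \<in> fst i \<and> n \<le> snd i) F" if "g \<in> carrier G" for g n
  proof (rule ev)
    have "eventually (\<lambda>S. g \<in> S) (finite_subsets_at_top (carrier G))"
      unfolding eventually_finite_subsets_at_top using that
      by (intro exI[of _ "{g}"]) auto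
    moreover have "eventually (\<lambda>k. n \<le> k) sequentially" by (rule eventually_ge_at_top)
    ultimately show "eventually (\<lambda>i. g \<in> fst i \<and> n \<le> snd i) I"
      unfolding I_def eventually_prod_filter by fastforce
  qed
  have evgood: "eventually good F"
  proof (rule ev)
    have "eventually (\<lambda>S. finite S \<and> S \<subseteq> carrier G) (finite_subsets_at_top (carrier G))"
      by (rule eventually_finite_subsets_at_top_weakI) auto
    then show "eventually good I"
      unfolding I_def good_def eventually_prod_filter
      by (intro exI[of _ "\<lambda>S. finite S \<and> S \<subseteq> carrier G"] exI[of _ "\<lambda>_. True"]) auto
  qed
  have lim_eq: "a = b" if "tendsto (\<lambda>i. A i f) a F" "eventually (\<lambda>i. A i f = h i) F" "tendsto h b F" for a b f h
    using that tendsto_unique[OF F(1)] tendsto_cong[of "\<lambda>i. A i f" h F] by blast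
  have "invariant_mean G M"
  proof (unfold_locales)
    fix f g :: "'a \<Rightarrow> complex" and c
    assume f: "bounded_fun G f"
    then obtain Bf where Bf: "\<forall>x\<in>carrier G. norm (f x) \<le> Bf" by (auto simp: bounded_fun_def)
    { assume "bounded_fun G g"
      then obtain Bg where "\<forall>x\<in>carrier G. norm (g x) \<le> Bg" by (auto simp: bounded_fun_def)
      with Bf have "bounded_fun G (\<lambda>x. f x + g x)"
        unfolding bounded_fun_def by (intro exI[of _ "Bf + Bg"]) (auto intro: norm_triangle_mono)
      then have "A i (\<lambda>x. f x + g x) = A i f + A i g" for i
        using f \<open>bounded_fun G g\<close> by (simp add: A_def box_mean_add)
      then show "M (\<lambda>x. f x + g x) = M f + M g"
        by (intro lim_eq[OF AM _ tendsto_add[OF AM AM]]) simp }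
    have "bounded_fun G (\<lambda>x. c * f x)"
      unfolding bounded_fun_def using Bf
      by (intro exI[of _ "norm c * Bf"]) (auto simp: norm_mult intro: mult_left_mono)
    then have "A i (\<lambda>x. c * f x) = c * A i f" for i
      using f by (simp add: A_def box_mean_scale)
    then show "M (\<lambda>x. c * f x) = c * M f"
      by (intro lim_eq[OF AM _ tendsto_mult[OF tendsto_const AM]]) simp
    have "bounded_fun G (\<lambda>x. cnj (f x))"
      using Bf by (auto simp: bounded_fun_def)
    then have "A i (\<lambda>x. cnj (f x)) = cnj (A i f)" for i
      using f by (simp add: A_def box_mean_cnj)
    then show "M (\<lambda>x. cnj (f x)) = cnj (M f)"
      by (intro lim_eq[OF AM _ tendsto_cnj[OF AM]]) simp
    fix g :: 'a assume g: "g \<in> carrier G"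
    have bs: "bounded_fun G (\<lambda>x. f (x \<otimes> g))"
      using Bf g by (auto simp: bounded_fun_def)
    have "tendsto (\<lambda>i. A i (\<lambda>x. f (x \<otimes> g)) - A i f) 0 F"
    proof (rule tendstoI)
      fix e :: real assume "e > 0"
      obtain n :: nat where n: "2 * Bf / e < n" using reals_Archimedean2 by blast
      show "eventually (\<lambda>i. dist (A i (\<lambda>x. f (x \<otimes> g)) - A i f) 0 < e) F"
        using evg[OF g, of n] evgood
      proof eventually_elim
        case (elim i)
        have "norm (A i (\<lambda>x. f (x \<otimes> g)) - A i f) \<le> 2 * Bf / Suc (snd i)"
          using elim L[of "fst i"] box_mean_shift[of "Suc (snd i)" "SOME L. set L = fst i" g f Bf] Bf f bs
          by (auto simp: A_def good_def)
        also have "\<dots> < e"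
        proof -
          have "2 * Bf < n * e" using n \<open>e > 0\<close> by (simp add: divide_simps)
          also have "\<dots> \<le> Suc (snd i) * e"
            using elim \<open>e > 0\<close> by (intro mult_right_mono) auto
          finally show ?thesis by (simp add: divide_simps mult.commute)
        qed
        finally show ?case by simp
      qed
    qed
    moreover have "tendsto (\<lambda>i. A i (\<lambda>x. f (x \<otimes> g)) - A i f) (M (\<lambda>x. f (x \<otimes> g)) - M f) F"
      by (intro tendsto_diff AM)
    ultimately have "M (\<lambda>x. f (x \<otimes> g)) - M f = 0"
      using tendsto_unique[OF F(1)] by blast
    then show "M (\<lambda>x. f (x \<otimes> g)) = M f" by simp
  next
    fix f :: "'a \<Rightarrow> complex" and C
    assume C: "\<And>x. x \<in> carrier G \<Longrightarrow> norm (f x) \<le> C"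
    then have "0 \<le> C" using norm_ge_zero order_trans one_closed by blast
    then have "norm (A i f) \<le> C" for i
      using C L[of "fst i"] by (auto simp: A_def intro!: box_mean_le)
    then show "norm (M f) \<le> C"
      using F(1) tendsto_norm[OF AM] by (intro tendsto_upperbound[of "\<lambda>i. norm (A i f)"]) auto
  next
    have one: "bounded_fun G (\<lambda>_. 1)" by (auto simp: bounded_fun_def)
    have "eventually (\<lambda>i. A i (\<lambda>_. 1) = 1) F"
      using evgood by eventually_elim (simp add: A_def good_def box_mean_one one)
    then show "M (\<lambda>_. 1) = 1" by (rule lim_eq[OF AM _ tendsto_const])
  qed
  then show ?thesis by blast
qed

end


lemma bounded_funE:
  assumes "bounded_fun G f"
  obtains B where "B \<ge> 0" "\<And>x. x \<in> carrier G \<Longrightarrow> norm (f x) \<le> B"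
proof -
  obtain B where "\<forall>x\<in>carrier G. norm (f x) \<le> B" using assms by (auto simp: bounded_fun_def)
  then show ?thesis by (intro that[of "max 0 B"]) (auto simp: le_max_iff_disj)
qed

subsection \<open>The inner product given by a mean\<close>

lemma bounded_fun_intros:
  "bounded_fun G (\<lambda>_. c)"
  "bounded_fun G f \<Longrightarrow> bounded_fun G g \<Longrightarrow> bounded_fun G (\<lambda>x. f x + g x)"
  "bounded_fun G f \<Longrightarrow> bounded_fun G g \<Longrightarrow> bounded_fun G (\<lambda>x. f x - g x)"
  "bounded_fun G f \<Longrightarrow> bounded_fun G g \<Longrightarrow> bounded_fun G (\<lambda>x. f x * g x)"
  "bounded_fun G f \<Longrightarrow> bounded_fun G (\<lambda>x. cnj (f x))"
proof -
  show "bounded_fun G (\<lambda>_. c)" by (auto simp: bounded_fun_def)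
  show "bounded_fun G (\<lambda>x. cnj (f x))" if "bounded_fun G f"
    using that by (auto simp: bounded_fun_def)
  assume "bounded_fun G f" "bounded_fun G g"
  then obtain a b where ab: "\<And>x. x \<in> carrier G \<Longrightarrow> norm (f x) \<le> a" "\<And>x. x \<in> carrier G \<Longrightarrow> norm (g x) \<le> b"
    by (auto simp: bounded_fun_def)
  show "bounded_fun G (\<lambda>x. f x + g x)" "bounded_fun G (\<lambda>x. f x - g x)"
    unfolding bounded_fun_def using ab
    by (auto intro!: exI[of _ "a + b"] norm_triangle_mono norm_triangle_le_diff add_mono)
  show "bounded_fun G (\<lambda>x. f x * g x)"
    unfolding bounded_fun_def norm_mult
    using ab by (intro exI[of _ "a * b"] ballI mult_mono) (auto intro: order_trans[OF norm_ge_zero])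
qed

lemma bounded_fun_sum:
  "(\<And>a. a \<in> A \<Longrightarrow> bounded_fun G (f a)) \<Longrightarrow> bounded_fun G (\<lambda>x. \<Sum>a\<in>A. f a x)"
  by (induction A rule: infinite_finite_induct) (auto intro: bounded_fun_intros)

context invariant_mean
begin

lemma bounded_shift: "bounded_fun G f \<Longrightarrow> a \<in> carrier G \<Longrightarrow> bounded_fun G (\<lambda>x. f (x \<otimes> a))"
  by (auto simp: bounded_fun_def)

lemma bounded_shift': "bounded_fun G f \<Longrightarrow> a \<in> carrier G \<Longrightarrow> bounded_fun G (\<lambda>x. f (a \<otimes> x))"
  by (auto simp: bounded_fun_def)

lemmas bounded_rules = bounded_fun_intros bounded_shift bounded_shift' bounded_fun_sum

lemma M_diff: "bounded_fun G f \<Longrightarrow> bounded_fun G g \<Longrightarrow> M (\<lambda>x. f x - g x) = M f - M g"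
  using M_add[of f "\<lambda>x. (-1) * g x"] M_scale[of g "-1"] bounded_fun_intros(4)[OF bounded_fun_intros(1)[of G "-1"], of g]
  by simp

lemma M_dist_le:
  assumes "bounded_fun G f" "bounded_fun G g" "\<And>x. x \<in> carrier G \<Longrightarrow> norm (f x - g x) \<le> e"
  shows "norm (M f - M g) \<le> e"
  using M_le[of "\<lambda>x. f x - g x", OF assms(3)] M_diff[OF assms(1,2)] by simp

lemma M_cong:
  assumes "bounded_fun G g" "\<And>x. x \<in> carrier G \<Longrightarrow> f x = g x"
  shows "M f = M g"
proof -
  have "bounded_fun G f" using assms by (simp add: bounded_fun_def)
  then show ?thesis using M_dist_le[of f g 0] assms by simp
qed

lemma M_sum:
  assumes "\<And>a. a \<in> A \<Longrightarrow> bounded_fun G (f a)"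
  shows "M (\<lambda>x. \<Sum>a\<in>A. f a x) = (\<Sum>a\<in>A. M (f a))"
  using assms
proof (induction A rule: infinite_finite_induct)
  case (insert a A)
  then show ?case using M_add[of "f a" "\<lambda>x. \<Sum>a\<in>A. f a x"] bounded_fun_sum[of A G f] by simp
qed (use M_scale[OF bounded_fun_intros(1), of 0] in auto)

lemma M_const: "M (\<lambda>_. c) = c"
  using M_scale[OF bounded_fun_intros(1), of c 1] M_one by simp

text \<open>A function with values in \<open>[0, B]\<close> is within \<open>B / 2\<close> of the constant \<open>B / 2\<close>, hence so is its mean.\<close>
lemma M_nonneg:
  assumes "bounded_fun G f" "\<And>x. x \<in> carrier G \<Longrightarrow> Im (f x) = 0 \<and> Re (f x) \<ge> 0"
  shows "Re (M f) \<ge> 0"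
proof -
  obtain B where B: "\<And>x. x \<in> carrier G \<Longrightarrow> norm (f x) \<le> B"
    using assms(1) by (auto simp: bounded_fun_def)
  have "norm (M f - M (\<lambda>_. of_real (B / 2))) \<le> B / 2"
  proof (rule M_dist_le)
    fix x assume x: "x \<in> carrier G"
    then have "f x = of_real (Re (f x))" using assms(2) by (simp add: complex_eq_iff)
    then obtain t where t: "f x = of_real t" by blast
    show "norm (f x - of_real (B / 2)) \<le> B / 2"
      using B[OF x] assms(2)[OF x] unfolding t of_real_diff[symmetric] norm_of_real
      by (auto simp: abs_if)
  qed (use assms in \<open>auto intro: bounded_fun_intros\<close>)
  then have "\<bar>Re (M f - of_real (B / 2))\<bar> \<le> B / 2"
    using abs_Re_le_cmod order_trans unfolding M_const by blast
  moreover have "Re (M f - of_real (B / 2)) = Re (M f) - B / 2" by simp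
  ultimately show ?thesis by linarith
qed

definition ip :: "('a \<Rightarrow> complex) \<Rightarrow> ('a \<Rightarrow> complex) \<Rightarrow> complex" where
  "ip f g = M (\<lambda>x. f x * cnj (g x))"

definition sqnorm :: "('a \<Rightarrow> complex) \<Rightarrow> real" where
  "sqnorm f = Re (ip f f)"

lemma ip_add_left: "bounded_fun G f \<Longrightarrow> bounded_fun G g \<Longrightarrow> bounded_fun G h \<Longrightarrow>
    ip (\<lambda>x. f x + g x) h = ip f h + ip g h"
  unfolding ip_def distrib_right by (intro M_add bounded_rules)

lemma ip_diff_left: "bounded_fun G f \<Longrightarrow> bounded_fun G g \<Longrightarrow> bounded_fun G h \<Longrightarrow>
    ip (\<lambda>x. f x - g x) h = ip f h - ip g h"
  unfolding ip_def left_diff_distrib by (intro M_diff bounded_rules)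

lemma ip_scale_left: "bounded_fun G f \<Longrightarrow> bounded_fun G h \<Longrightarrow> ip (\<lambda>x. c * f x) h = c * ip f h"
  unfolding ip_def mult.assoc by (intro M_scale bounded_rules)

lemma ip_cnj: "bounded_fun G f \<Longrightarrow> bounded_fun G g \<Longrightarrow> ip g f = cnj (ip f g)"
  unfolding ip_def by (subst M_cnj[symmetric]) (auto intro!: bounded_rules simp: mult.commute)

lemma ip_add_right: "bounded_fun G f \<Longrightarrow> bounded_fun G g \<Longrightarrow> bounded_fun G h \<Longrightarrow>
    ip h (\<lambda>x. f x + g x) = ip h f + ip h g"
  unfolding ip_def complex_cnj_add distrib_left by (intro M_add bounded_rules)

lemma ip_diff_right: "bounded_fun G f \<Longrightarrow> bounded_fun G g \<Longrightarrow> bounded_fun G h \<Longrightarrow>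
    ip h (\<lambda>x. f x - g x) = ip h f - ip h g"
  unfolding ip_def complex_cnj_diff right_diff_distrib by (intro M_diff bounded_rules)

lemma ip_scale_right: "bounded_fun G f \<Longrightarrow> bounded_fun G h \<Longrightarrow> ip h (\<lambda>x. c * f x) = cnj c * ip h f"
  unfolding ip_def complex_cnj_mult mult.left_commute[of _ "cnj c"] by (intro M_scale bounded_rules)

lemma ip_self: "bounded_fun G f \<Longrightarrow> ip f f = of_real (sqnorm f)"
  using ip_cnj[of f f] by (simp add: sqnorm_def complex_eq_iff)

lemma sqnorm_nonneg: "bounded_fun G f \<Longrightarrow> sqnorm f \<ge> 0"
  unfolding sqnorm_def ip_def
  by (rule M_nonneg, intro bounded_rules) (simp_all add: complex_mult_cnj)

lemma sqnorm_add: "bounded_fun G f \<Longrightarrow> bounded_fun G g \<Longrightarrow>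
    sqnorm (\<lambda>x. f x + g x) = sqnorm f + 2 * Re (ip f g) + sqnorm g"
  unfolding sqnorm_def
  by (simp add: ip_add_left ip_add_right bounded_rules ip_cnj[of f g])

lemma sqnorm_diff: "bounded_fun G f \<Longrightarrow> bounded_fun G g \<Longrightarrow>
    sqnorm (\<lambda>x. f x - g x) = sqnorm f - 2 * Re (ip f g) + sqnorm g"
  unfolding sqnorm_def
  by (simp add: ip_diff_left ip_diff_right bounded_rules ip_cnj[of f g])

lemma sqnorm_scale: "bounded_fun G f \<Longrightarrow> sqnorm (\<lambda>x. c * f x) = (norm c)\<^sup>2 * sqnorm f"
proof -
  assume f: "bounded_fun G f"
  then have "ip (\<lambda>x. c * f x) (\<lambda>x. c * f x) = (c * cnj c) * ip f f"
    by (simp add: ip_scale_left ip_scale_right bounded_rules)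
  also have "\<dots> = of_real ((norm c)\<^sup>2 * sqnorm f)"
    using f unfolding complex_norm_square[symmetric] by (simp add: ip_self)
  finally show ?thesis by (simp add: sqnorm_def)
qed

lemma sqnorm_shift: "bounded_fun G f \<Longrightarrow> a \<in> carrier G \<Longrightarrow> sqnorm (\<lambda>x. f (x \<otimes> a)) = sqnorm f"
  unfolding sqnorm_def ip_def
  using M_shift[of "\<lambda>x. f x * cnj (f x)" a] by (simp add: bounded_rules)

lemma Cauchy_Schwarz:
  assumes f: "bounded_fun G f" and g: "bounded_fun G g"
  shows "(norm (ip f g))\<^sup>2 \<le> sqnorm f * sqnorm g"
proof -
  define z where "z = ip f g"
  have key: "0 \<le> sqnorm f - 2 * t * (norm z)\<^sup>2 + t\<^sup>2 * (norm z)\<^sup>2 * sqnorm g" for t :: real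
  proof -
    have b: "bounded_fun G (\<lambda>x. (of_real t * z) * g x)" using g by (intro bounded_rules)
    have "ip f (\<lambda>x. (of_real t * z) * g x) = of_real t * (z * cnj z)"
      using ip_scale_right[OF g f, of "of_real t * z"] by (simp add: z_def mult_ac)
    then have "Re (ip f (\<lambda>x. (of_real t * z) * g x)) = t * (norm z)\<^sup>2"
      by (simp only: complex_norm_square[symmetric] of_real_mult[symmetric] Re_complex_of_real)
    moreover have "sqnorm (\<lambda>x. (of_real t * z) * g x) = t\<^sup>2 * (norm z)\<^sup>2 * sqnorm g"
      using sqnorm_scale[OF g, of "of_real t * z"] by (simp add: norm_mult power_mult_distrib)
    ultimately show ?thesis
      using sqnorm_nonneg[OF bounded_fun_intros(3)[OF f b]] unfolding sqnorm_diff[OF f b] by simp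
  qed
  show ?thesis
  proof (cases "norm z = 0")
    case True then show ?thesis using sqnorm_nonneg[OF f] sqnorm_nonneg[OF g] by (simp add: z_def)
  next
    case False
    then have p: "(norm z)\<^sup>2 > 0" by simp
    show ?thesis
    proof (cases "sqnorm g = 0")
      case True
      have "2 * ((sqnorm f + 1) / (norm z)\<^sup>2) * (norm z)\<^sup>2 \<le> sqnorm f"
        using key[of "(sqnorm f + 1) / (norm z)\<^sup>2"] unfolding True by simp
      then have "2 * (sqnorm f + 1) \<le> sqnorm f" using p by simp
      then show ?thesis using sqnorm_nonneg[OF f] by simp
    next
      case False
      then have g0: "sqnorm g > 0" using sqnorm_nonneg[OF g] by simp
      have "2 * (1 / sqnorm g) * (norm z)\<^sup>2 - (1 / sqnorm g)\<^sup>2 * (norm z)\<^sup>2 * sqnorm g \<le> sqnorm f"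
        using key[of "1 / sqnorm g"] by simp
      also have "2 * (1 / sqnorm g) * (norm z)\<^sup>2 - (1 / sqnorm g)\<^sup>2 * (norm z)\<^sup>2 * sqnorm g = (norm z)\<^sup>2 / sqnorm g"
        using g0 by (simp add: field_simps power2_eq_square)
      finally show ?thesis using g0 by (simp add: z_def field_simps)
    qed
  qed
qed

end


section \<open>Uniformly continuous functions for a totally bounded norm\<close>

text \<open>The analytic core of the proof takes place on a group with an invariant mean \<open>M\<close> and a totally
  bounded, possibly degenerate, norm \<open>q\<close>. Degenerate norms are essential: norms that vanish on a
  subgroup \<open>H\<close> describe the quotient by \<open>H\<close> without forming it.\<close>
locale totally_bounded_norm = invariant_mean +
  fixes q :: "'a \<Rightarrow> real"
  assumes q_nonneg: "x \<in> carrier G \<Longrightarrow> 0 \<le> q x"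
    and q_one: "q \<one> = 0"
    and q_mult: "x \<in> carrier G \<Longrightarrow> y \<in> carrier G \<Longrightarrow> q (x \<otimes> y) \<le> q x + q y"
    and q_inv: "x \<in> carrier G \<Longrightarrow> q (inv x) = q x"
    and q_cover: "e > 0 \<Longrightarrow> \<exists>F. finite F \<and> F \<subseteq> carrier G \<and> (\<forall>x\<in>carrier G. \<exists>a\<in>F. q (x \<otimes> inv a) < e)"
begin

abbreviation varies_within :: "('a \<Rightarrow> complex) \<Rightarrow> real \<Rightarrow> real \<Rightarrow> bool" where
  "varies_within f d e \<equiv> \<forall>x\<in>carrier G. \<forall>u\<in>carrier G. q u < d \<longrightarrow> norm (f (x \<otimes> u) - f x) \<le> e"

definition uc :: "('a \<Rightarrow> complex) \<Rightarrow> bool" where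
  "uc f \<longleftrightarrow> (\<forall>e>0. \<exists>d>0. varies_within f d e)"

lemma ucD:
  assumes "uc f" "e > 0"
  obtains d where "d > 0" "varies_within f d e"
  using assms unfolding uc_def by meson

lemma ucI:
  assumes "\<And>e. e > 0 \<Longrightarrow> \<exists>d>0. varies_within f d e"
  shows "uc f"
  using assms unfolding uc_def by blast

lemma divide_out: "x \<in> carrier G \<Longrightarrow> a \<in> carrier G \<Longrightarrow> a \<otimes> (x \<otimes> inv a) = x"
  by (metis inv_closed m_closed m_comm m_lcomm r_inv r_one)

lemma norm_diff_le: "x \<in> carrier G \<Longrightarrow> u \<in> carrier G \<Longrightarrow> \<bar>q (x \<otimes> u) - q x\<bar> \<le> q u"
  using q_mult[of x u] q_mult[of "x \<otimes> u" "inv u"] q_inv[of u] by (simp add: m_assoc)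

lemma cover:
  assumes "e > 0"
  obtains F j where "finite F" "F \<subseteq> carrier G" "\<And>x. x \<in> carrier G \<Longrightarrow> j x \<in> F"
    "\<And>x. x \<in> carrier G \<Longrightarrow> q (x \<otimes> inv (j x)) < e"
proof -
  obtain F where F: "finite F" "F \<subseteq> carrier G" "\<forall>x\<in>carrier G. \<exists>a\<in>F. q (x \<otimes> inv a) < e"
    using q_cover[OF assms] by blast
  then obtain j where "\<forall>x\<in>carrier G. j x \<in> F \<and> q (x \<otimes> inv (j x)) < e" by metis
  with F that show ?thesis by blast
qed

lemma uc_bounded:
  assumes "uc f" shows "bounded_fun G f"
proof -
  obtain d where d: "d > 0" "varies_within f d 1"
    using ucD[OF assms, of 1] by auto
  obtain F j where F: "finite F" "F \<subseteq> carrier G" "\<And>x. x \<in> carrier G \<Longrightarrow> j x \<in> F"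
    "\<And>x. x \<in> carrier G \<Longrightarrow> q (x \<otimes> inv (j x)) < d"
    using cover[OF d(1)] by blast
  have "norm (f x) \<le> (\<Sum>a\<in>F. norm (f a)) + 1" if x: "x \<in> carrier G" for x
  proof -
    have j: "j x \<in> carrier G" using F x by auto
    have "norm (f (j x \<otimes> (x \<otimes> inv (j x))) - f (j x)) \<le> 1"
      using x j F(4) by (intro d(2)[rule_format]) auto
    then have "norm (f x) \<le> norm (f (j x)) + 1"
      unfolding divide_out[OF x j] using norm_triangle_ineq2[of "f x" "f (j x)"] by linarith
    moreover have "norm (f (j x)) \<le> (\<Sum>a\<in>F. norm (f a))"
      using F(1) F(3)[OF x] by (intro member_le_sum) auto
    ultimately show ?thesis by simp
  qed
  then show ?thesis by (auto simp: bounded_fun_def)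
qed

lemma uc_add:
  assumes "uc f" "uc g" shows "uc (\<lambda>x. f x + g x)"
proof (rule ucI)
  fix e :: real assume e: "e > 0"
  obtain d where d: "d > 0" "varies_within f d (e/2)"
    using ucD[OF assms(1), of "e/2"] e by auto
  obtain d' where d': "d' > 0" "varies_within g d' (e/2)"
    using ucD[OF assms(2), of "e/2"] e by auto
  show "\<exists>d>0. varies_within (\<lambda>x. f x + g x) d e"
  proof (intro exI[of _ "min d d'"] conjI ballI impI)
    fix x u assume "x \<in> carrier G" "u \<in> carrier G" "q u < min d d'"
    then have "norm (f (x \<otimes> u) - f x) \<le> e/2" "norm (g (x \<otimes> u) - g x) \<le> e/2"
      using d d' by auto
    then show "norm (f (x \<otimes> u) + g (x \<otimes> u) - (f x + g x)) \<le> e"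
      unfolding add_diff_add using norm_triangle_mono by fastforce
  qed (use d d' in auto)
qed

lemma uc_lipschitz:
  assumes "c > 0" "\<And>x u. x \<in> carrier G \<Longrightarrow> u \<in> carrier G \<Longrightarrow> norm (f (x \<otimes> u) - f x) \<le> c * q u"
  shows "uc f"
proof (rule ucI)
  fix e :: real assume "e > 0"
  then show "\<exists>d>0. varies_within f d e"
    using assms by (intro exI[of _ "e / c"] conjI ballI impI order.trans[OF assms(2)])
      (auto simp: field_simps)
qed

lemma uc_mult:
  assumes "uc f" "uc g" shows "uc (\<lambda>x. f x * g x)"
proof (rule ucI)
  fix e :: real assume e: "e > 0"
  obtain A where A0: "A \<ge> 0" and A: "\<And>x. x \<in> carrier G \<Longrightarrow> norm (f x) \<le> A"
    using bounded_funE[OF uc_bounded[OF assms(1)]] by metis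
  obtain B where B0: "B \<ge> 0" and B: "\<And>x. x \<in> carrier G \<Longrightarrow> norm (g x) \<le> B"
    using bounded_funE[OF uc_bounded[OF assms(2)]] by metis
  note AB = A0 B0
  define e' where "e' = e / (A + B + 1)"
  have e': "e' > 0" using e AB by (simp add: e'_def)
  obtain d where d: "d > 0" "varies_within f d e'"
    using ucD[OF assms(1) e'] by auto
  obtain d' where d': "d' > 0" "varies_within g d' e'"
    using ucD[OF assms(2) e'] by auto
  show "\<exists>d>0. varies_within (\<lambda>x. f x * g x) d e"
  proof (intro exI[of _ "min d d'"] conjI ballI impI)
    fix x u assume xu: "x \<in> carrier G" "u \<in> carrier G" "q u < min d d'"
    have "f (x \<otimes> u) * g (x \<otimes> u) - f x * g x = f (x \<otimes> u) * (g (x \<otimes> u) - g x) + (f (x \<otimes> u) - f x) * g x"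
      by (simp add: algebra_simps)
    also have "norm \<dots> \<le> A * e' + e' * B"
      using xu A B d d' AB e'
      by (intro order.trans[OF norm_triangle_ineq] add_mono) (auto simp: norm_mult intro!: mult_mono)
    also have "\<dots> = e' * (A + B)" by (simp add: algebra_simps)
    also have "\<dots> \<le> e" using e AB by (simp add: e'_def field_simps)
    finally show "norm (f (x \<otimes> u) * g (x \<otimes> u) - f x * g x) \<le> e" .
  qed (use d d' in auto)
qed

lemma uc_const: "uc (\<lambda>_. c)"
  by (rule ucI) (auto intro: exI[of _ 1])

lemma uc_cnj: "uc f \<Longrightarrow> uc (\<lambda>x. cnj (f x))"
  unfolding uc_def complex_cnj_diff[symmetric] complex_mod_cnj .

lemma uc_scale: "uc f \<Longrightarrow> uc (\<lambda>x. c * f x)"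
  by (rule uc_mult[OF uc_const])

lemma uc_diff: "uc f \<Longrightarrow> uc g \<Longrightarrow> uc (\<lambda>x. f x - g x)"
  using uc_add[of f "\<lambda>x. (-1) * g x"] uc_scale[of g "-1"] by simp

lemma uc_shift:
  assumes "uc f" "a \<in> carrier G" shows "uc (\<lambda>x. f (x \<otimes> a))"
proof (rule ucI)
  fix e :: real assume "e > 0"
  then obtain d where d: "d > 0" "varies_within f d e"
    using ucD[OF assms(1)] by blast
  have "norm (f (x \<otimes> u \<otimes> a) - f (x \<otimes> a)) \<le> e" if "x \<in> carrier G" "u \<in> carrier G" "q u < d" for x u
    using d(2)[rule_format, of "x \<otimes> a" u] that assms(2) by (simp add: m_ac)
  with d(1) show "\<exists>d>0. varies_within (\<lambda>x. f (x \<otimes> a)) d e"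
    by blast
qed

text \<open>Total boundedness makes the mean strictly positive: finitely many translates of the region where \<open>f\<close> is
  large cover the group, so that a finite sum of translates of \<open>f\<close> is bounded away from \<open>0\<close>, and all
  these translates have the mean of \<open>f\<close>.\<close>
lemma M_pos:
  assumes f: "uc f" and nn: "\<And>x. x \<in> carrier G \<Longrightarrow> Im (f x) = 0 \<and> Re (f x) \<ge> 0"
    and x0: "x0 \<in> carrier G" "Re (f x0) > 0"
  shows "Re (M f) > 0"
proof -
  define c where "c = Re (f x0) / 2"
  have c: "c > 0" using x0 by (simp add: c_def)
  obtain d where d: "d > 0" "varies_within f d c"
    using ucD[OF f c] by auto
  obtain F j where F: "finite F" "F \<subseteq> carrier G" "\<And>x. x \<in> carrier G \<Longrightarrow> j x \<in> F"
    "\<And>x. x \<in> carrier G \<Longrightarrow> q (x \<otimes> inv (j x)) < d"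
    using cover[OF d(1)] by blast
  have bf: "bounded_fun G f" by (rule uc_bounded[OF f])
  define h where "h x = (\<Sum>a\<in>F. f (x \<otimes> (x0 \<otimes> inv a)))" for x
  have bh: "bounded_fun G h"
    unfolding h_def using F(2) x0 bf by (intro bounded_rules) auto
  have "M h = (\<Sum>a\<in>F. M (\<lambda>x. f (x \<otimes> (x0 \<otimes> inv a))))"
    unfolding h_def using F(2) x0 bf by (intro M_sum bounded_rules) auto
  also have "\<dots> = (\<Sum>a\<in>F. M f)"
    using F(2) x0 bf by (intro sum.cong M_shift) auto
  finally have Mh: "M h = of_nat (card F) * M f" by simp
  have "Re (M (\<lambda>x. h x - of_real c)) \<ge> 0"
  proof (rule M_nonneg)
    fix x assume x: "x \<in> carrier G"
    have mem: "x \<otimes> (x0 \<otimes> inv a) \<in> carrier G" if "a \<in> F" for a using F(2) that x x0 by auto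
    have j: "j x \<in> carrier G" using F(2,3) x by auto
    have "norm (f (x0 \<otimes> (x \<otimes> inv (j x))) - f x0) \<le> c"
      using d(2)[rule_format, of x0 "x \<otimes> inv (j x)"] x0 x j F(4) by auto
    then have "\<bar>Re (f (x0 \<otimes> (x \<otimes> inv (j x))) - f x0)\<bar> \<le> c"
      using abs_Re_le_cmod order_trans by blast
    then have "c \<le> Re (f (x0 \<otimes> (x \<otimes> inv (j x))))"
      unfolding c_def minus_complex.sel by linarith
    also have "x0 \<otimes> (x \<otimes> inv (j x)) = x \<otimes> (x0 \<otimes> inv (j x))"
      using x x0 j by (simp add: m_lcomm)
    also have "Re (f \<dots>) \<le> (\<Sum>a\<in>F. Re (f (x \<otimes> (x0 \<otimes> inv a))))"
      using F(1) F(3)[OF x] nn mem by (intro member_le_sum) auto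
    finally show "Im (h x - of_real c) = 0 \<and> 0 \<le> Re (h x - of_real c)"
      using nn mem by (simp add: h_def)
  qed (intro bounded_rules bh)
  also have "M (\<lambda>x. h x - of_real c) = of_nat (card F) * M f - of_real c"
    using M_diff[OF bh bounded_fun_intros(1)] by (simp add: M_const Mh)
  finally have "c \<le> real (card F) * Re (M f)" by simp
  with c have "real (card F) * Re (M f) > 0" by simp
  then show ?thesis by (simp add: zero_less_mult_iff)
qed

lemma sqnorm_zero:
  assumes "uc f" "sqnorm f \<le> 0" "x \<in> carrier G" shows "f x = 0"
proof (rule ccontr)
  assume "f x \<noteq> 0"
  have "Re (M (\<lambda>x. f x * cnj (f x))) > 0"
    by (rule M_pos[of _ x], intro uc_mult uc_cnj assms)
      (use assms \<open>f x \<noteq> 0\<close> in \<open>auto simp: complex_mult_cnj complex_eq_iff sum_power2_gt_zero_iff\<close>)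
  with assms(2) show False by (simp add: sqnorm_def ip_def)
qed

text \<open>The Arzela--Ascoli principle: for an equicontinuous family pointwise convergence is uniform,
  as it is controlled by the convergence on a finite net.\<close>
lemma uc_limit:
  assumes F: "F \<noteq> bot"
    and equi: "\<And>e. e > 0 \<Longrightarrow> \<exists>d>0. \<forall>i. varies_within (f i) d e"
    and lim: "\<And>x. x \<in> carrier G \<Longrightarrow> tendsto (\<lambda>i. f i x) (l x) F"
  shows "uc l" and "uniform_limit (carrier G) f l F"
proof -
  show uc: "uc l"
  proof (rule ucI)
    fix e :: real assume "e > 0"
    then obtain d where d: "d > 0" "\<And>i. varies_within (f i) d e"
      using equi by meson
    have "norm (l (x \<otimes> u) - l x) \<le> e" if "x \<in> carrier G" "u \<in> carrier G" "q u < d" for x u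
      using that d F lim
      by (intro tendsto_upperbound[of "\<lambda>i. norm (f i (x \<otimes> u) - f i x)"] tendsto_norm tendsto_diff) auto
    with d(1) show "\<exists>d>0. varies_within l d e"
      by blast
  qed
  show "uniform_limit (carrier G) f l F"
  proof (rule uniform_limitI)
    fix e :: real assume e: "e > 0"
    obtain d where d: "d > 0" "\<And>i. varies_within (f i) d (e/4)"
      using equi[of "e/4"] e by auto
    obtain d' where d': "d' > 0" "varies_within l d' (e/4)"
      using ucD[OF uc, of "e/4"] e by auto
    obtain E j where E: "finite E" "E \<subseteq> carrier G" "\<And>x. x \<in> carrier G \<Longrightarrow> j x \<in> E"
      "\<And>x. x \<in> carrier G \<Longrightarrow> q (x \<otimes> inv (j x)) < min d d'"
      using cover[of "min d d'"] d(1) d'(1) by (metis min_less_iff_conj)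
    have "eventually (\<lambda>i. dist (f i a) (l a) < e/4) F" if "a \<in> E" for a
      using lim[of a] E(2) that e by (intro tendstoD) auto
    then have "eventually (\<lambda>i. \<forall>a\<in>E. dist (f i a) (l a) < e/4) F"
      using E(1) by (simp add: eventually_ball_finite)
    then show "eventually (\<lambda>i. \<forall>x\<in>carrier G. dist (f i x) (l x) < e) F"
    proof eventually_elim
      case (elim i)
      show ?case
      proof
        fix x assume x: "x \<in> carrier G"
        have j: "j x \<in> carrier G" and jE: "j x \<in> E" using E x by auto
        have qq: "q (x \<otimes> inv (j x)) < d" "q (x \<otimes> inv (j x)) < d'" using E(4)[OF x] by auto
        have "norm (f i (j x \<otimes> (x \<otimes> inv (j x))) - f i (j x)) \<le> e/4"
          using x j qq by (intro d(2)[rule_format]) auto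
        moreover have "norm (l (j x \<otimes> (x \<otimes> inv (j x))) - l (j x)) \<le> e/4"
          using x j qq by (intro d'(2)[rule_format]) auto
        moreover have "dist (f i (j x)) (l (j x)) < e/4" using elim jE by auto
        moreover have "dist (f i x) (l x) \<le> dist (f i x) (f i (j x)) + dist (f i (j x)) (l (j x)) + dist (l x) (l (j x))"
          by (metis add.commute add_left_mono dist_commute dist_triangle dist_triangle_le order_refl)
        ultimately show "dist (f i x) (l x) < e"
          using e unfolding divide_out[OF x j] dist_norm by simp
      qed
    qed
  qed
qed

lemma M_tendsto:
  assumes "uniform_limit (carrier G) f l F" "\<And>i. bounded_fun G (f i)" "bounded_fun G l"
  shows "tendsto (\<lambda>i. M (f i)) (M l) F"
proof (rule tendstoI)
  fix e :: real assume e: "e > 0"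
  have "eventually (\<lambda>i. \<forall>x\<in>carrier G. dist (f i x) (l x) < e/2) F"
    using e by (intro uniform_limitD[OF assms(1)]) auto
  then show "eventually (\<lambda>i. dist (M (f i)) (M l) < e) F"
  proof eventually_elim
    case (elim i)
    have "norm (M (f i) - M l) \<le> e/2"
      using elim by (intro M_dist_le assms) (auto simp: dist_norm less_imp_le)
    then show ?case using e by (simp add: dist_norm)
  qed
qed

lemma bounded_image: "bounded_fun G f \<Longrightarrow> bounded (f ` carrier G)"
  by (auto simp: bounded_fun_def bounded_iff)

lemma sqnorm_tendsto:
  assumes "uniform_limit (carrier G) f l F" "\<And>i. bounded_fun G (f i)" "bounded_fun G l"
  shows "tendsto (\<lambda>i. sqnorm (f i)) (sqnorm l) F"
proof -
  have "uniform_limit (carrier G) (\<lambda>i x. cnj (f i x)) (\<lambda>x. cnj (l x)) F"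
    using assms(1) by (rule bounded_linear.uniform_limit[OF bounded_linear_cnj])
  then have "uniform_limit (carrier G) (\<lambda>i x. f i x * cnj (f i x)) (\<lambda>x. l x * cnj (l x)) F"
    using assms by (intro uniform_lim_mult bounded_image bounded_rules)
  then show ?thesis
    unfolding sqnorm_def ip_def using assms by (intro tendsto_Re M_tendsto bounded_rules)
qed

text \<open>Fubini's theorem fails for invariant means in general, but holds in the presence of uniform
  continuity. The reason is that, up to a small error, the functional \<open>s \<mapsto> M (p s)\<close> is a finite combination of
  point evaluations, simultaneously for all functions \<open>s\<close> with a given modulus of continuity: split the
  group into finitely many small cells and evaluate \<open>s\<close> at one point of each. Point evaluations commute
  with any other mean (\<open>M_swap\<close>).\<close>
lemma mean_quadrature:
  assumes p: "bounded_fun G p" and C: "\<And>x. x \<in> carrier G \<Longrightarrow> norm (p x) \<le> C" and d: "d > 0"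
  obtains F w where "finite F" "F \<subseteq> carrier G"
    "\<And>s e. bounded_fun G s \<Longrightarrow> varies_within s d e \<Longrightarrow>
       norm (M (\<lambda>x. p x * s x) - (\<Sum>a\<in>F. w a * s a)) \<le> C * e"
proof -
  obtain F j where F: "finite F" "F \<subseteq> carrier G" "\<And>x. x \<in> carrier G \<Longrightarrow> j x \<in> F"
    "\<And>x. x \<in> carrier G \<Longrightarrow> q (x \<otimes> inv (j x)) < d"
    using cover[OF d] by blast
  define c where "c a x = (if j x = a then p x else 0)" for a x
  have bc: "bounded_fun G (c a)" for a
    using p unfolding c_def by (elim bounded_funE) (auto simp: bounded_fun_def)
  have quad: "norm (M (\<lambda>x. p x * s x) - (\<Sum>a\<in>F. M (c a) * s a)) \<le> C * e"
    if s: "bounded_fun G s" "varies_within s d e" for s e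
  proof -
    have bcs: "bounded_fun G (\<lambda>x. c a x * s a)" for a by (intro bounded_fun_intros bc)
    have "(\<Sum>a\<in>F. M (c a) * s a) = M (\<lambda>x. \<Sum>a\<in>F. c a x * s a)"
      unfolding M_sum[OF bcs] using M_scale[OF bc] by (simp add: mult.commute)
    moreover have "norm (M (\<lambda>x. p x * s x) - M (\<lambda>x. \<Sum>a\<in>F. c a x * s a)) \<le> C * e"
    proof (rule M_dist_le)
      fix x assume x: "x \<in> carrier G"
      have j: "j x \<in> carrier G" using F x by auto
      have "(\<Sum>a\<in>F. c a x * s a) = (\<Sum>a\<in>F. if j x = a then p x * s a else 0)"
        by (intro sum.cong) (auto simp: c_def)
      also have "\<dots> = p x * s (j x)" using F(1) F(3)[OF x] by simp
      finally have eq: "(\<Sum>a\<in>F. c a x * s a) = p x * s (j x)" .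
      have "norm (s (j x \<otimes> (x \<otimes> inv (j x))) - s (j x)) \<le> e"
        using s(2) F(4)[OF x] x j by simp
      then have "norm (p x) * norm (s x - s (j x)) \<le> C * e"
        unfolding divide_out[OF x j] using C[OF x] order_trans[OF norm_ge_zero C[OF x]] by (intro mult_mono) auto
      then show "norm (p x * s x - (\<Sum>a\<in>F. c a x * s a)) \<le> C * e"
        by (simp add: eq right_diff_distrib[symmetric] norm_mult)
    qed (intro bounded_fun_intros bounded_fun_sum p s bcs)+
    ultimately show ?thesis by simp
  qed
  show ?thesis by (rule that[OF F(1,2) quad])
qed

lemma M_swap:
  assumes r: "uc r" and k: "bounded_fun G k" and p: "bounded_fun G p"
  shows "M (\<lambda>x. p x * M (\<lambda>z. r (x \<otimes> z) * k z)) = M (\<lambda>z. k z * M (\<lambda>x. p x * r (x \<otimes> z)))"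
    (is "?L = ?R")
proof -
  have br: "bounded_fun G r" by (rule uc_bounded[OF r])
  obtain A where A: "A \<ge> 0" "\<And>x. x \<in> carrier G \<Longrightarrow> norm (r x) \<le> A" using bounded_funE[OF br] by metis
  obtain B where B: "B \<ge> 0" "\<And>x. x \<in> carrier G \<Longrightarrow> norm (k x) \<le> B" using bounded_funE[OF k] by metis
  obtain C where C: "C \<ge> 0" "\<And>x. x \<in> carrier G \<Longrightarrow> norm (p x) \<le> C" using bounded_funE[OF p] by metis
  have brk: "bounded_fun G (\<lambda>z. r (x \<otimes> z) * k z)" if "x \<in> carrier G" for x
    using that by (intro bounded_fun_intros bounded_shift' br k)
  have "norm (M (\<lambda>z. r (x \<otimes> z) * k z)) \<le> A * B" if "x \<in> carrier G" for x
    using that A B by (intro M_le) (auto simp: norm_mult intro!: mult_mono)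
  then have b1: "bounded_fun G (\<lambda>x. M (\<lambda>z. r (x \<otimes> z) * k z))" unfolding bounded_fun_def by blast
  have "norm (M (\<lambda>x. p x * r (x \<otimes> z))) \<le> C * A" if "z \<in> carrier G" for z
    using that A C by (intro M_le) (auto simp: norm_mult intro!: mult_mono)
  then have b2: "bounded_fun G (\<lambda>z. M (\<lambda>x. p x * r (x \<otimes> z)))" unfolding bounded_fun_def by blast
  have est: "norm (?L - ?R) \<le> 2 * (B * C) * e" if e: "e > 0" for e
  proof -
    obtain d where d: "d > 0" "varies_within r d e" using ucD[OF r e] by auto
    obtain F w where F: "finite F" "F \<subseteq> carrier G" "\<And>s e. bounded_fun G s \<Longrightarrow> varies_within s d e \<Longrightarrow>
       norm (M (\<lambda>x. p x * s x) - (\<Sum>a\<in>F. w a * s a)) \<le> C * e"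
      by (rule mean_quadrature[OF p _ d(1)]) (rule C(2), assumption, rule that)
    have vz: "varies_within (\<lambda>x. r (x \<otimes> z)) d e" if "z \<in> carrier G" for z
    proof (intro ballI impI)
      fix x u assume "x \<in> carrier G" "u \<in> carrier G" "q u < d"
      then show "norm (r (x \<otimes> u \<otimes> z) - r (x \<otimes> z)) \<le> e"
        using d(2)[rule_format, of "x \<otimes> z" u] that by (simp add: m_ac)
    qed
    have vM: "varies_within (\<lambda>x. M (\<lambda>z. r (x \<otimes> z) * k z)) d (e * B)"
    proof (intro ballI impI M_dist_le brk m_closed)
      fix x u z assume h: "x \<in> carrier G" "u \<in> carrier G" "q u < d" "z \<in> carrier G"
      then show "norm (r (x \<otimes> u \<otimes> z) * k z - r (x \<otimes> z) * k z) \<le> e * B"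
        using vz[OF h(4), rule_format, OF h(1-3)] B e
        by (auto simp: left_diff_distrib[symmetric] norm_mult intro!: mult_mono)
    qed
    define S where "S = M (\<lambda>z. k z * (\<Sum>a\<in>F. w a * r (a \<otimes> z)))"
    have bw: "bounded_fun G (\<lambda>z. w a * (r (a \<otimes> z) * k z))" if "a \<in> F" for a
      using F(2) that by (intro bounded_fun_intros brk) auto
    have "(\<Sum>a\<in>F. w a * M (\<lambda>z. r (a \<otimes> z) * k z)) = (\<Sum>a\<in>F. M (\<lambda>z. w a * (r (a \<otimes> z) * k z)))"
      using F(2) by (intro sum.cong M_scale[symmetric] brk) auto
    also have "\<dots> = M (\<lambda>z. \<Sum>a\<in>F. w a * (r (a \<otimes> z) * k z))" by (rule M_sum[OF bw, symmetric])
    also have "\<dots> = S" unfolding S_def sum_distrib_left by (simp add: mult_ac)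
    finally have 1: "norm (?L - S) \<le> C * (e * B)" using F(3)[OF b1 vM] by simp
    have 2: "norm (S - ?R) \<le> B * (C * e)" unfolding S_def
    proof (rule M_dist_le)
      fix z assume z: "z \<in> carrier G"
      have "norm (k z) * norm (M (\<lambda>x. p x * r (x \<otimes> z)) - (\<Sum>a\<in>F. w a * r (a \<otimes> z))) \<le> B * (C * e)"
        using F(3)[OF bounded_shift[OF br z] vz[OF z]] B z by (intro mult_mono) auto
      then show "norm (k z * (\<Sum>a\<in>F. w a * r (a \<otimes> z)) - k z * M (\<lambda>x. p x * r (x \<otimes> z))) \<le> B * (C * e)"
        by (simp add: right_diff_distrib[symmetric] norm_mult norm_minus_commute)
    next
      show "bounded_fun G (\<lambda>z. k z * (\<Sum>a\<in>F. w a * r (a \<otimes> z)))"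
        by (intro bounded_fun_intros bounded_fun_sum bounded_shift' br k) (use F(2) in blast)
    qed (intro bounded_fun_intros k b2)
    show ?thesis using norm_triangle_mono[OF 1 2] by (simp add: algebra_simps)
  qed
  have "norm (?L - ?R) \<le> e" if "e > 0" for e
  proof -
    have BC: "B * C \<ge> 0" using B C by simp
    have "2 * (B * C) * (e / (2 * (B * C) + 1)) \<le> e" using that BC by (simp add: divide_simps)
    then show ?thesis using est[of "e / (2 * (B * C) + 1)"] that BC by (simp add: add_nonneg_pos)
  qed
  then have "norm (?L - ?R) \<le> 0" by (rule field_le_epsilon[of _ 0, simplified])
  then show ?thesis by simp
qed

end


section \<open>Characters correlated with a uniformly continuous function\<close>

definition unit_character :: "('a, 'b) monoid_scheme \<Rightarrow> ('a \<Rightarrow> complex) \<Rightarrow> bool" where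
  "unit_character G \<theta> \<longleftrightarrow> (\<forall>x\<in>carrier G. norm (\<theta> x) = 1) \<and>
     (\<forall>x\<in>carrier G. \<forall>y\<in>carrier G. \<theta> (x \<otimes>\<^bsub>G\<^esub> y) = \<theta> x * \<theta> y)"

context totally_bounded_norm
begin

text \<open>\<open>corr F\<close> is the autocorrelation of \<open>F\<close>, a positive definite function with value
  \<open>sqnorm F\<close> at \<open>\<one>\<close>, and \<open>smooth r F\<close> is its convolution with \<open>r\<close>. In terms of Fourier coefficients
  the latter has coefficient \<open>r\<^sub>\<theta> |F\<^sub>\<theta>|\<^sup>2\<close> at a character \<open>\<theta>\<close>. Among all \<open>F\<close> of norm \<open>1\<close> its norm is
  therefore largest when \<open>F\<close> is concentrated on a single character, the one at which \<open>r\<close> has its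
  largest coefficient. The lemmas below turn this remark into a way of finding that character.\<close>
definition corr :: "('a \<Rightarrow> complex) \<Rightarrow> 'a \<Rightarrow> complex" where
  "corr F x = M (\<lambda>y. F (y \<otimes> x) * cnj (F y))"

definition smooth :: "('a \<Rightarrow> complex) \<Rightarrow> ('a \<Rightarrow> complex) \<Rightarrow> 'a \<Rightarrow> complex" where
  "smooth r F x = M (\<lambda>z. r (x \<otimes> z) * cnj (corr F z))"

lemma corr_integrand_bounded:
  "bounded_fun G F \<Longrightarrow> x \<in> carrier G \<Longrightarrow> bounded_fun G (\<lambda>y. F (y \<otimes> x) * cnj (F y))"
  by (intro bounded_fun_intros bounded_shift)

lemma cancel_inv:
  assumes "x \<in> carrier G" "z \<in> carrier G" "g \<in> carrier G"
  shows "x \<otimes> g \<otimes> (z \<otimes> inv g) = x \<otimes> z" "x \<otimes> inv g \<otimes> (z \<otimes> g) = x \<otimes> z"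
  using assms divide_out[of z g] divide_out[of z "inv g"] by (simp_all add: m_assoc)

lemma corr_le:
  assumes F: "bounded_fun G F" and x: "x \<in> carrier G"
  shows "norm (corr F x) \<le> sqnorm F"
proof -
  have b: "bounded_fun G (\<lambda>y. F (y \<otimes> x))" using assms by (rule bounded_shift)
  have "(norm (corr F x))\<^sup>2 \<le> sqnorm F * sqnorm F"
    using Cauchy_Schwarz[OF b F] sqnorm_shift[OF F x] by (simp add: corr_def ip_def)
  then show ?thesis
    using sqnorm_nonneg[OF F] by (simp add: power2_eq_square[symmetric] power2_le_iff_abs_le)
qed

lemma corr_bounded: "bounded_fun G F \<Longrightarrow> bounded_fun G (corr F)"
  using corr_le unfolding bounded_fun_def[of G "corr F"] by blast

lemma corr_one: "bounded_fun G F \<Longrightarrow> corr F \<one> = of_real (sqnorm F)"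
  unfolding ip_self[symmetric] corr_def ip_def by (rule M_cong, intro bounded_rules) auto

lemma corr_inv:
  assumes F: "bounded_fun G F" and x: "x \<in> carrier G"
  shows "corr F (inv x) = cnj (corr F x)"
proof -
  have b: "bounded_fun G (\<lambda>y. F (y \<otimes> inv x) * cnj (F y))" using assms by (intro bounded_rules) auto
  have b': "bounded_fun G (\<lambda>y. F (y \<otimes> x) * cnj (F y))" using assms by (intro bounded_rules)
  have "corr F (inv x) = M (\<lambda>y. F (y \<otimes> x \<otimes> inv x) * cnj (F (y \<otimes> x)))"
    unfolding corr_def by (rule M_shift[OF b x, symmetric])
  also have "\<dots> = M (\<lambda>y. cnj (F (y \<otimes> x) * cnj (F y)))"
  proof (rule M_cong)
    show "bounded_fun G (\<lambda>y. cnj (F (y \<otimes> x) * cnj (F y)))" by (rule bounded_fun_intros(5)[OF b'])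
  qed (use x in \<open>simp add: m_assoc mult.commute\<close>)
  also have "\<dots> = cnj (corr F x)" unfolding corr_def by (rule M_cnj[OF b'])
  finally show ?thesis .
qed

text \<open>Replacing \<open>F\<close> by \<open>F + c F(\<cdot> g)\<close> multiplies the Fourier coefficients of the autocorrelation by
  \<open>|1 + c \<theta>(g)|\<^sup>2 = 2 + c \<theta>(g) + cnj (c \<theta>(g))\<close>. These are the variations that are used to exploit
  maximality.\<close>
lemma corr_mix:
  assumes F: "bounded_fun G F" and x: "x \<in> carrier G" and g: "g \<in> carrier G" and c: "norm c = 1"
  shows "corr (\<lambda>y. F y + c * F (y \<otimes> g)) x =
    2 * corr F x + (c * corr F (x \<otimes> g) + cnj c * corr F (x \<otimes> inv g))"
proof -
  have cc: "c * cnj c = 1" using c by (simp add: complex_norm_square[symmetric])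
  define f1 where "f1 y = F (y \<otimes> x) * cnj (F y)" for y
  define f2 where "f2 y = F (y \<otimes> (x \<otimes> g)) * cnj (F y)" for y
  define f3 where "f3 y = F (y \<otimes> (x \<otimes> inv g)) * cnj (F y)" for y
  have b: "bounded_fun G f1" "bounded_fun G f2" "bounded_fun G f3"
    unfolding f1_def f2_def f3_def using x g
    by (auto intro!: corr_integrand_bounded F)
  have bs: "bounded_fun G (\<lambda>y. f1 (y \<otimes> g))" "bounded_fun G (\<lambda>y. f3 (y \<otimes> g))"
    using b g by (auto intro: bounded_shift)
  have b4: "bounded_fun G (\<lambda>y. f1 y + f1 (y \<otimes> g))"  "bounded_fun G (\<lambda>y. c * f2 y)"
     "bounded_fun G (\<lambda>y. cnj c * f3 (y \<otimes> g))"
    by (intro bounded_fun_intros b bs)+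
  have "corr (\<lambda>y. F y + c * F (y \<otimes> g)) x =
      M (\<lambda>y. (f1 y + f1 (y \<otimes> g)) + (c * f2 y + cnj c * f3 (y \<otimes> g)))"
    unfolding corr_def
  proof (rule M_cong)
    show "bounded_fun G (\<lambda>y. (f1 y + f1 (y \<otimes> g)) + (c * f2 y + cnj c * f3 (y \<otimes> g)))"
      by (intro bounded_fun_intros(2) b4)
    fix y assume y: "y \<in> carrier G"
    have e: "y \<otimes> g \<otimes> x = y \<otimes> x \<otimes> g" "y \<otimes> (x \<otimes> g) = y \<otimes> x \<otimes> g" "y \<otimes> g \<otimes> (x \<otimes> inv g) = y \<otimes> x"
      using x y g by (simp add: m_ac, simp add: m_ac, simp add: cancel_inv)
    have "(F (y \<otimes> x) + c * F (y \<otimes> x \<otimes> g)) * cnj (F y + c * F (y \<otimes> g)) =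
      F (y \<otimes> x) * cnj (F y) + (c * cnj c) * (F (y \<otimes> x \<otimes> g) * cnj (F (y \<otimes> g))) +
       (c * (F (y \<otimes> x \<otimes> g) * cnj (F y)) + cnj c * (F (y \<otimes> x) * cnj (F (y \<otimes> g))))"
      by (simp add: algebra_simps)
    then show "(F (y \<otimes> x) + c * F (y \<otimes> x \<otimes> g)) * cnj (F y + c * F (y \<otimes> g)) =
      (f1 y + f1 (y \<otimes> g)) + (c * f2 y + cnj c * f3 (y \<otimes> g))"
      unfolding f1_def f2_def f3_def e cc by simp
  qed
  also have "\<dots> = (M f1 + M (\<lambda>y. f1 (y \<otimes> g))) + (c * M f2 + cnj c * M (\<lambda>y. f3 (y \<otimes> g)))"
    using b bs b4 by (simp add: M_add M_scale bounded_fun_intros(2))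
  also have "\<dots> = 2 * M f1 + (c * M f2 + cnj c * M f3)"
    using M_shift[OF b(1) g] M_shift[OF b(3) g] by simp
  finally show ?thesis unfolding corr_def f1_def f2_def f3_def .
qed

lemma corr_uc:
  assumes F: "uc F" shows "uc (corr F)"
proof (rule ucI)
  fix e :: real assume e: "e > 0"
  have bF: "bounded_fun G F" by (rule uc_bounded[OF F])
  then obtain B where B0: "B \<ge> 0" and B: "\<And>x. x \<in> carrier G \<Longrightarrow> norm (F x) \<le> B"
    using bounded_funE by metis
  obtain d where d: "d > 0" "varies_within F d (e / (B + 1))"
    using ucD[OF F, of "e / (B + 1)"] e B0 by auto
  have "norm (corr F (x \<otimes> u) - corr F x) \<le> e" if x: "x \<in> carrier G" and u: "u \<in> carrier G" "q u < d" for x u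
    unfolding corr_def
  proof (rule M_dist_le)
    show "bounded_fun G (\<lambda>y. F (y \<otimes> (x \<otimes> u)) * cnj (F y))" "bounded_fun G (\<lambda>y. F (y \<otimes> x) * cnj (F y))"
      using x u by (auto intro!: corr_integrand_bounded bF)
    fix y assume y: "y \<in> carrier G"
    have "norm (F (y \<otimes> (x \<otimes> u)) - F (y \<otimes> x)) * norm (F y) \<le> e / (B + 1) * B"
      using d(2)[rule_format, of "y \<otimes> x" u] x y u B e B0 by (intro mult_mono) (auto simp: m_assoc)
    also have "\<dots> \<le> e" using e B0 by (simp add: field_simps)
    finally show "norm (F (y \<otimes> (x \<otimes> u)) * cnj (F y) - F (y \<otimes> x) * cnj (F y)) \<le> e"
      by (simp add: left_diff_distrib[symmetric] norm_mult)
  qed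
  with d(1) show "\<exists>d>0. varies_within (corr F) d e"
    by blast
qed

context
  fixes r assumes r: "uc r"
begin

lemma r_bounded: "bounded_fun G r" by (rule uc_bounded[OF r])

lemma smooth_integrand_bounded:
  "bounded_fun G F \<Longrightarrow> x \<in> carrier G \<Longrightarrow> bounded_fun G (\<lambda>z. r (x \<otimes> z) * cnj (corr F z))"
  by (intro bounded_fun_intros bounded_shift' r_bounded corr_bounded)

lemma smooth_le:
  assumes R: "\<And>x. x \<in> carrier G \<Longrightarrow> norm (r x) \<le> R" and F: "bounded_fun G F" and x: "x \<in> carrier G"
  shows "norm (smooth r F x) \<le> R * sqnorm F"
proof -
  have "norm (r \<one>) \<le> R" using R by auto
  then have "R \<ge> 0" using norm_ge_zero order_trans by blast
  then show ?thesis
    unfolding smooth_def using R corr_le[OF F] x by (intro M_le) (auto simp: norm_mult intro!: mult_mono)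
qed

lemma smooth_bounded: "bounded_fun G F \<Longrightarrow> bounded_fun G (smooth r F)"
  using r_bounded smooth_le unfolding bounded_fun_def[of G r] bounded_fun_def[of G "smooth r F"] by blast

lemma smooth_diff_le:
  assumes e: "\<And>x. x \<in> carrier G \<Longrightarrow> norm (r (x \<otimes> u) - r x) \<le> e"
    and F: "bounded_fun G F" and x: "x \<in> carrier G" and u: "u \<in> carrier G"
  shows "norm (smooth r F (x \<otimes> u) - smooth r F x) \<le> e * sqnorm F"
  unfolding smooth_def
proof (rule M_dist_le)
  fix z assume z: "z \<in> carrier G"
  have "x \<otimes> u \<otimes> z = x \<otimes> z \<otimes> u" using x u z by (simp add: m_ac)
  moreover have "norm (r (x \<otimes> z \<otimes> u) - r (x \<otimes> z)) * norm (corr F z) \<le> e * sqnorm F"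
    using e[of "x \<otimes> z"] corr_le[OF F z] x z order_trans[OF norm_ge_zero e[of "x \<otimes> z"]]
    by (intro mult_mono) auto
  ultimately show "norm (r (x \<otimes> u \<otimes> z) * cnj (corr F z) - r (x \<otimes> z) * cnj (corr F z)) \<le> e * sqnorm F"
    by (simp add: left_diff_distrib[symmetric] norm_mult)
qed (use assms in \<open>auto intro: smooth_integrand_bounded\<close>)

lemma smooth_uc:
  assumes F: "bounded_fun G F" shows "uc (smooth r F)"
proof (rule ucI)
  fix e :: real assume e: "e > 0"
  define e' where "e' = e / (sqnorm F + 1)"
  have e': "e' > 0" "e' * sqnorm F \<le> e" using e sqnorm_nonneg[OF F] by (auto simp: e'_def field_simps)
  obtain d where "d > 0" "varies_within r d e'"
    using ucD[OF r e'(1)] by auto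
  then show "\<exists>d>0. varies_within (smooth r F) d e"
    using e'(2) by (intro exI[of _ d]) (auto intro!: order.trans[OF smooth_diff_le] F)
qed

lemma smooth_scale:
  assumes F: "bounded_fun G F" and x: "x \<in> carrier G"
  shows "smooth r (\<lambda>y. c * F y) x = of_real ((norm c)\<^sup>2) * smooth r F x"
proof -
  have "corr (\<lambda>y. c * F y) z = of_real ((norm c)\<^sup>2) * corr F z" if "z \<in> carrier G" for z
  proof -
    have "corr (\<lambda>y. c * F y) z = M (\<lambda>y. (c * cnj c) * (F (y \<otimes> z) * cnj (F y)))"
      unfolding corr_def by (rule arg_cong[of _ _ M]) (simp add: fun_eq_iff mult_ac)
    also have "\<dots> = (c * cnj c) * corr F z"
      unfolding corr_def using F that by (intro M_scale bounded_fun_intros bounded_shift)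
    finally show ?thesis by (simp only: complex_norm_square)
  qed
  then have "smooth r (\<lambda>y. c * F y) x = M (\<lambda>z. of_real ((norm c)\<^sup>2) * (r (x \<otimes> z) * cnj (corr F z)))"
    unfolding smooth_def
    by (intro M_cong bounded_fun_intros(4)[OF bounded_fun_intros(1)] smooth_integrand_bounded F x) simp
  also have "\<dots> = of_real ((norm c)\<^sup>2) * smooth r F x"
    unfolding smooth_def by (intro M_scale smooth_integrand_bounded F x)
  finally show ?thesis .
qed

lemma sqnorm_smooth_scale:
  assumes F: "bounded_fun G F"
  shows "sqnorm (smooth r (\<lambda>y. c * F y)) = (norm c)^4 * sqnorm (smooth r F)"
proof -
  have b: "bounded_fun G (smooth r F)" by (rule smooth_bounded[OF F])
  have "sqnorm (smooth r (\<lambda>y. c * F y)) = sqnorm (\<lambda>x. of_real ((norm c)\<^sup>2) * smooth r F x)"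
    unfolding sqnorm_def ip_def
    by (rule arg_cong[of _ _ Re], rule M_cong) (intro bounded_fun_intros b, simp add: smooth_scale[OF F])
  also have "\<dots> = (norm (complex_of_real ((norm c)\<^sup>2)))\<^sup>2 * sqnorm (smooth r F)" by (rule sqnorm_scale[OF b])
  finally show ?thesis unfolding norm_of_real by simp
qed

lemma smooth_mix:
  assumes F: "bounded_fun G F" and x: "x \<in> carrier G" and g: "g \<in> carrier G" and c: "norm c = 1"
  shows "smooth r (\<lambda>y. F y + c * F (y \<otimes> g)) x =
    2 * smooth r F x + (c * smooth r F (x \<otimes> g) + cnj c * smooth r F (x \<otimes> inv g))"
proof -
  define f1 where "f1 z = r (x \<otimes> z) * cnj (corr F z)" for z
  define f2 where "f2 z = r (x \<otimes> g \<otimes> z) * cnj (corr F z)" for z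
  define f3 where "f3 z = r (x \<otimes> inv g \<otimes> z) * cnj (corr F z)" for z
  have b: "bounded_fun G f1" "bounded_fun G f2" "bounded_fun G f3"
    unfolding f1_def f2_def f3_def using x g by (auto intro!: smooth_integrand_bounded F)
  have g': "inv g \<in> carrier G" using g by simp
  have bs: "bounded_fun G (\<lambda>z. f2 (z \<otimes> inv g))" "bounded_fun G (\<lambda>z. f3 (z \<otimes> g))"
    using b g g' by (auto intro: bounded_shift)
  have b4: "bounded_fun G (\<lambda>z. 2 * f1 z)" "bounded_fun G (\<lambda>z. cnj c * f3 (z \<otimes> g))"
    "bounded_fun G (\<lambda>z. c * f2 (z \<otimes> inv g))"
    by (intro bounded_fun_intros b bs)+
  have "smooth r (\<lambda>y. F y + c * F (y \<otimes> g)) x =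
      M (\<lambda>z. 2 * f1 z + (c * f2 (z \<otimes> inv g) + cnj c * f3 (z \<otimes> g)))"
    unfolding smooth_def
  proof (rule M_cong)
    show "bounded_fun G (\<lambda>z. 2 * f1 z + (c * f2 (z \<otimes> inv g) + cnj c * f3 (z \<otimes> g)))"
      by (intro bounded_fun_intros(2) b4)
    fix z assume z: "z \<in> carrier G"
    have e: "x \<otimes> inv g \<otimes> (z \<otimes> g) = x \<otimes> z" "x \<otimes> g \<otimes> (z \<otimes> inv g) = x \<otimes> z"
      using x g z by (simp_all add: cancel_inv)
    show "r (x \<otimes> z) * cnj (corr (\<lambda>y. F y + c * F (y \<otimes> g)) z) =
        2 * f1 z + (c * f2 (z \<otimes> inv g) + cnj c * f3 (z \<otimes> g))"
      unfolding corr_mix[OF F z g c] f1_def f2_def f3_def e by (simp add: algebra_simps)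
  qed
  also have "\<dots> = 2 * M f1 + (c * M (\<lambda>z. f2 (z \<otimes> inv g)) + cnj c * M (\<lambda>z. f3 (z \<otimes> g)))"
    using b bs b4 by (simp add: M_add M_scale bounded_fun_intros(2))
  also have "\<dots> = 2 * M f1 + (c * M f2 + cnj c * M f3)"
    using M_shift[OF b(2) g'] M_shift[OF b(3) g] by simp
  finally show ?thesis unfolding smooth_def f1_def f2_def f3_def .
qed

end

lemma M_norm_le:
  assumes h: "bounded_fun G h" and g: "bounded_fun G g"
    and hg: "\<And>x. x \<in> carrier G \<Longrightarrow> norm (h x) \<le> Re (g x) \<and> Im (g x) = 0"
  shows "norm (M h) \<le> Re (M g)"
proof -
  define c where "c = (if M h = 0 then 1 else cnj (M h) / norm (M h))"
  have c: "norm c = 1" by (simp add: c_def norm_divide)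
  have cM: "c * M h = of_real (norm (M h))"
    by (simp add: c_def mult.commute complex_norm_square[symmetric] power2_eq_square)
  have bk: "bounded_fun G (\<lambda>x. c * h x)" by (intro bounded_fun_intros h)
  have bk2: "bounded_fun G (\<lambda>x. c * h x + cnj (c * h x))" by (intro bounded_fun_intros(2,5) bk)
  have b2g: "bounded_fun G (\<lambda>x. 2 * g x)" by (intro bounded_fun_intros g)
  have "Re (M (\<lambda>x. 2 * g x - (c * h x + cnj (c * h x)))) \<ge> 0"
  proof (rule M_nonneg)
    fix x assume x: "x \<in> carrier G"
    have "Re (c * h x) \<le> norm (h x)"
      using complex_Re_le_cmod[of "c * h x"] c by (simp add: norm_mult)
    then show "Im (2 * g x - (c * h x + cnj (c * h x))) = 0 \<and> Re (2 * g x - (c * h x + cnj (c * h x))) \<ge> 0"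
      using hg[OF x] by simp
  qed (intro bounded_fun_intros(3) bk2 b2g)
  also have "M (\<lambda>x. 2 * g x - (c * h x + cnj (c * h x))) = 2 * M g - (c * M h + cnj (c * M h))"
    using M_diff[OF b2g bk2] M_scale[OF g, of 2] M_add[OF bk bounded_fun_intros(5)[OF bk]]
      M_cnj[OF bk] M_scale[OF h, of c] by simp
  finally show ?thesis unfolding cM by simp
qed

text \<open>The maximum to be considered is positive: if \<open>F\<close> is a bump concentrated near \<open>\<one>\<close>, so is its
  autocorrelation, which is moreover nonnegative; convolving \<open>r\<close> with it yields at \<open>\<one>\<close> a value close to a
  positive multiple of \<open>r \<one> \<noteq> 0\<close>.\<close>
lemma ex_smooth_nonzero:
  assumes r: "uc r" and r1: "r \<one> \<noteq> 0"
  obtains F where "bounded_fun G F" "sqnorm F = 1" "sqnorm (smooth r F) > 0"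
proof -
  define c where "c = norm (r \<one>)"
  have c: "c > 0" using r1 by (simp add: c_def)
  obtain d where d: "d > 0" "varies_within r d (c/2)"
    using ucD[OF r, of "c/2"] c by auto
  \<comment> \<open>A bump of radius \<open>d/2\<close> has an autocorrelation that vanishes where \<open>q \<ge> d\<close>.\<close>
  define b where "b x = complex_of_real (max 0 (d/2 - q x))" for x
  have ub: "uc b"
  proof (rule uc_lipschitz[of 1])
    fix x u assume xu: "x \<in> carrier G" "u \<in> carrier G"
    have "\<bar>max 0 (d/2 - q (x \<otimes> u)) - max 0 (d/2 - q x)\<bar> \<le> q u"
      using norm_diff_le[OF xu] by linarith
    then show "norm (b (x \<otimes> u) - b x) \<le> 1 * q u"
      unfolding b_def of_real_diff[symmetric] norm_of_real by simp
  qed simp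
  have bb: "bounded_fun G b" by (rule uc_bounded[OF ub])
  have ibb: "bounded_fun G (\<lambda>y. b (y \<otimes> x) * cnj (b y))" if "x \<in> carrier G" for x
    using that by (intro bounded_fun_intros bounded_shift bb)
  have s1: "sqnorm b > 0"
    using sqnorm_zero[OF ub _ one_closed] d(1) by (force simp: b_def q_one)
  have creal: "Im (corr b x) = 0 \<and> Re (corr b x) \<ge> 0" if x: "x \<in> carrier G" for x
  proof
    have "cnj (corr b x) = M (\<lambda>y. cnj (b (y \<otimes> x) * cnj (b y)))"
      unfolding corr_def by (rule M_cnj[OF ibb[OF x], symmetric])
    also have "\<dots> = corr b x" unfolding corr_def by (simp add: b_def)
    finally show "Im (corr b x) = 0" by (simp add: complex_eq_iff)
    show "Re (corr b x) \<ge> 0" unfolding corr_def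
      by (rule M_nonneg[OF ibb[OF x]]) (simp add: b_def)
  qed
  have czero: "corr b x = 0" if x: "x \<in> carrier G" and qx: "q x \<ge> d" for x
  proof -
    have "norm (corr b x) \<le> 0" unfolding corr_def
    proof (rule M_le)
      fix y assume y: "y \<in> carrier G"
      have "q x \<le> q (y \<otimes> x) + q (inv y)"
        using q_mult[of "y \<otimes> x" "inv y"] x y by (simp add: m_comm[of y x] m_assoc)
      then have "q y \<ge> d/2 \<or> q (y \<otimes> x) \<ge> d/2" using qx q_inv[OF y] by linarith
      then show "norm (b (y \<otimes> x) * cnj (b y)) \<le> 0" by (auto simp: b_def)
    qed
    then show ?thesis by simp
  qed
  have mc: "Re (M (corr b)) > 0"
    by (rule M_pos[OF corr_uc[OF ub] creal one_closed]) (simp_all add: corr_one[OF bb] s1)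
  have bc: "bounded_fun G (corr b)" by (rule corr_bounded[OF bb])
  have "norm (smooth r b \<one> - r \<one> * M (corr b)) \<le> Re (M (\<lambda>z. of_real (c/2) * corr b z))"
  proof -
    have b1: "bounded_fun G (\<lambda>z. r (\<one> \<otimes> z) * cnj (corr b z))" "bounded_fun G (\<lambda>z. r \<one> * corr b z)"
      by (intro smooth_integrand_bounded r bb one_closed bounded_fun_intros bc)+
    have "smooth r b \<one> - r \<one> * M (corr b) = M (\<lambda>z. r (\<one> \<otimes> z) * cnj (corr b z) - r \<one> * corr b z)"
      unfolding smooth_def using M_diff[OF b1] M_scale[OF bc] by simp
    also have "norm \<dots> \<le> Re (M (\<lambda>z. of_real (c/2) * corr b z))"
    proof (rule M_norm_le)
      fix z assume z: "z \<in> carrier G"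
      have eq: "cnj (corr b z) = corr b z" using creal[OF z] by (simp add: complex_eq_iff)
      have "norm (corr b z) = Re (corr b z)"
        using creal[OF z] by (simp add: cmod_eq_Re)
      moreover have "norm (r z - r \<one>) * norm (corr b z) \<le> c/2 * norm (corr b z)"
      proof (cases "q z < d")
        case True
        then show ?thesis using d(2)[rule_format, of \<one> z] z by (intro mult_right_mono) auto
      qed (use czero[OF z] in simp)
      ultimately show "norm (r (\<one> \<otimes> z) * cnj (corr b z) - r \<one> * corr b z) \<le> Re (of_real (c/2) * corr b z)
          \<and> Im (of_real (c/2) * corr b z) = 0"
        using z creal[OF z] unfolding eq by (simp add: left_diff_distrib[symmetric] norm_mult)
    qed (intro bounded_fun_intros b1 bc)+
    finally show ?thesis .
  qed
  also have "\<dots> = c/2 * Re (M (corr b))" unfolding M_scale[OF bc] by simp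
  also have "\<dots> < c * Re (M (corr b))" using c mc by simp
  also have "\<dots> \<le> norm (r \<one> * M (corr b))"
    unfolding c_def norm_mult using complex_Re_le_cmod by (intro mult_left_mono) auto
  finally have "smooth r b \<one> \<noteq> 0" by (auto simp: norm_minus_commute)
  then have s2: "sqnorm (smooth r b) > 0"
    using sqnorm_zero[OF smooth_uc[OF r bb] _ one_closed] by force
  define k where "k = complex_of_real (1 / sqrt (sqnorm b))"
  have k: "(norm k)\<^sup>2 = 1 / sqnorm b" using s1 by (simp add: k_def norm_divide power_divide)
  show ?thesis
  proof (rule that[of "\<lambda>x. k * b x"])
    show "bounded_fun G (\<lambda>x. k * b x)" by (intro bounded_fun_intros bb)
    show "sqnorm (\<lambda>x. k * b x) = 1" using sqnorm_scale[OF bb, of k] k s1 by simp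
    have "(norm k)^4 = (1 / sqnorm b)\<^sup>2" using k by (metis power_even_eq numeral_Bit0 mult_2)
    then show "sqnorm (smooth r (\<lambda>x. k * b x)) > 0"
      using sqnorm_smooth_scale[OF r bb, of k] s1 s2 by simp
  qed
qed

end


context totally_bounded_norm
begin

lemma Fourier_coefficient_shift:
  assumes \<theta>: "unit_character G \<theta>" and f: "bounded_fun G f" and a: "a \<in> carrier G"
  shows "M (\<lambda>x. f (x \<otimes> a) * cnj (\<theta> x)) = \<theta> a * M (\<lambda>x. f x * cnj (\<theta> x))"
proof -
  have "bounded_fun G \<theta>" using \<theta> by (auto simp: unit_character_def bounded_fun_def intro!: exI[of _ 1])
  then have b: "bounded_fun G (\<lambda>x. f x * cnj (\<theta> x))" by (intro bounded_fun_intros f)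
  have aa: "\<theta> a * cnj (\<theta> a) = 1" using \<theta> a by (simp add: unit_character_def complex_norm_square[symmetric])
  have "M (\<lambda>x. f (x \<otimes> a) * cnj (\<theta> x)) = M (\<lambda>x. \<theta> a * (f (x \<otimes> a) * cnj (\<theta> (x \<otimes> a))))"
  proof (rule M_cong)
    show "bounded_fun G (\<lambda>x. \<theta> a * (f (x \<otimes> a) * cnj (\<theta> (x \<otimes> a))))"
      using bounded_fun_intros(4)[OF bounded_fun_intros(1) bounded_shift[OF b a]] .
    fix x assume x: "x \<in> carrier G"
    have m: "\<theta> (x \<otimes> a) = \<theta> x * \<theta> a" using \<theta> x a by (simp add: unit_character_def)
    have "\<theta> a * (f (x \<otimes> a) * cnj (\<theta> x * \<theta> a)) = f (x \<otimes> a) * cnj (\<theta> x) * (\<theta> a * cnj (\<theta> a))"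
      by (simp add: mult_ac)
    then show "f (x \<otimes> a) * cnj (\<theta> x) = \<theta> a * (f (x \<otimes> a) * cnj (\<theta> (x \<otimes> a)))"
      unfolding m aa by (simp only: mult_1_right)
  qed
  also have "\<dots> = \<theta> a * M (\<lambda>x. f x * cnj (\<theta> x))"
    using M_scale[OF bounded_shift[OF b a]] M_shift[OF b a] by simp
  finally show ?thesis .
qed

text \<open>Let \<open>S\<close> be the supremum of \<open>sqnorm (smooth r F)\<close> over all \<open>F\<close> with \<open>sqnorm F = 1\<close>, and take a
  maximizing sequence \<open>F\<^sub>n\<close>. The functions \<open>smooth r F\<^sub>n\<close> inherit the modulus of continuity of \<open>r\<close>, so they
  converge, along a filter, uniformly to some \<open>\<rho>\<close> with \<open>sqnorm \<rho> = S\<close>; let \<open>\<phi>\<close> be the pointwise limit of the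
  autocorrelations. For \<open>|c| = 1\<close> put \<open>\<tau> x = c \<rho>(x g) + cnj c \<rho>(x g\<inverse>)\<close> and \<open>s = 2 Re (c \<phi>(g))\<close>. Testing
  the supremum on \<open>F\<^sub>n \<plusminus> c F\<^sub>n(\<cdot> g)\<close>, whose squared norms tend to \<open>2 \<plusminus> s\<close>, bounds the norms of \<open>2 \<rho> + \<tau>\<close>
  and \<open>2 \<rho> - \<tau>\<close> by \<open>2 + s\<close> and \<open>2 - s\<close> times that of \<open>\<rho>\<close>. As the two functions add up to \<open>4 \<rho>\<close>, the triangle
  inequality is an equality, and strict convexity gives \<open>\<tau> = s \<rho>\<close>. The cases \<open>c = 1\<close> and \<open>c = \<i>\<close>
  together say \<open>\<rho>(x g) = \<phi>(g) \<rho>(x)\<close>, so that \<open>\<phi>\<close> is a character and \<open>\<rho>\<close> is a multiple of it. If \<open>r\<close> were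
  orthogonal to \<open>\<phi>\<close>, so would be every \<open>smooth r F\<^sub>n\<close> and hence \<open>\<rho>\<close>.\<close>
theorem ex_correlated_character:
  assumes r: "uc r" and r1: "r \<one> \<noteq> 0"
  obtains \<theta> where "unit_character G \<theta>" "uc \<theta>" "M (\<lambda>x. r x * cnj (\<theta> x)) \<noteq> 0"
proof -
  have br: "bounded_fun G r" by (rule uc_bounded[OF r])
  then obtain R where R0: "R \<ge> 0" and R: "\<And>x. x \<in> carrier G \<Longrightarrow> norm (r x) \<le> R"
    using bounded_funE by metis
  have bsm: "bounded_fun G (smooth r F)" if "bounded_fun G F" for F
    using smooth_bounded[OF r that] .
  define V where "V = {sqnorm (smooth r F) | F. bounded_fun G F \<and> sqnorm F = 1}"
  define S where "S = Sup V"
  obtain F0 where F0: "bounded_fun G F0" "sqnorm F0 = 1" "sqnorm (smooth r F0) > 0"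
    using ex_smooth_nonzero[OF r r1] by blast
  have "sqnorm (smooth r F) \<le> R\<^sup>2" if F: "bounded_fun G F" "sqnorm F = 1" for F
  proof -
    have "norm (ip (smooth r F) (smooth r F)) \<le> R * R"
      unfolding ip_def using smooth_le[OF r R F(1)] F(2) R0
      by (intro M_le) (auto simp: norm_mult intro!: mult_mono)
    then show ?thesis
      using complex_Re_le_cmod order_trans unfolding sqnorm_def power2_eq_square by blast
  qed
  then have bdd: "bdd_above V" unfolding V_def by (intro bdd_aboveI[of _ "R\<^sup>2"]) auto
  have VS: "sqnorm (smooth r F) \<le> S" if "bounded_fun G F" "sqnorm F = 1" for F
    unfolding S_def by (rule cSup_upper[OF _ bdd]) (use that in \<open>auto simp: V_def\<close>)
  have S0: "S > 0" using VS[OF F0(1,2)] F0(3) by simp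
  \<comment> \<open>The supremum bounds functions of arbitrary norm, since \<open>smooth r\<close> is homogeneous of degree 2.\<close>
  have Sbound: "sqnorm (smooth r F) \<le> S * (sqnorm F)\<^sup>2" if F: "bounded_fun G F" for F
  proof (cases "sqnorm F = 0")
    case True
    have "smooth r F x = 0" if "x \<in> carrier G" for x
      using smooth_le[OF r R F that] True by simp
    then have "ip (smooth r F) (smooth r F) = M (\<lambda>_. 0)"
      unfolding ip_def by (intro M_cong bounded_fun_intros) simp
    then show ?thesis using True by (simp add: sqnorm_def M_const)
  next
    case False
    then have p: "sqnorm F > 0" using sqnorm_nonneg[OF F] by simp
    define k where "k = complex_of_real (1 / sqrt (sqnorm F))"
    have k: "(norm k)\<^sup>2 = 1 / sqnorm F" using p by (simp add: k_def norm_divide power_divide)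
    have bk: "bounded_fun G (\<lambda>x. k * F x)" by (intro bounded_fun_intros F)
    have "(norm k)^4 = (1 / sqnorm F)\<^sup>2" using k by (metis power_even_eq numeral_Bit0 mult_2)
    then have "sqnorm (smooth r (\<lambda>x. k * F x)) = sqnorm (smooth r F) / (sqnorm F)\<^sup>2"
      using sqnorm_smooth_scale[OF r F, of k] by (simp add: power_divide)
    then have "sqnorm (smooth r F) / (sqnorm F)\<^sup>2 \<le> S"
      using VS[OF bk] sqnorm_scale[OF F, of k] k p by simp
    then show ?thesis using p by (simp add: field_simps)
  qed
  have "\<exists>F. bounded_fun G F \<and> sqnorm F = 1 \<and> sqnorm (smooth r F) > S - 1 / Suc n" for n
  proof -
    have "S - 1 / Suc n < Sup V" by (simp add: S_def)
    moreover have "V \<noteq> {}" using F0 by (auto simp: V_def)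
    ultimately obtain v where "v \<in> V" "S - 1 / Suc n < v" using less_cSup_iff[OF _ bdd] by blast
    then show ?thesis by (auto simp: V_def)
  qed
  then obtain F where F: "\<And>n. bounded_fun G (F n)" "\<And>n. sqnorm (F n) = 1"
    "\<And>n. sqnorm (smooth r (F n)) > S - 1 / Suc n" by metis
  \<comment> \<open>The sum type makes the smoothed functions and the autocorrelations converge along one filter.\<close>
  define A where "A n y = (case y of
      Inl x \<Rightarrow> if x \<in> carrier G then smooth r (F n) x else 0
    | Inr x \<Rightarrow> if x \<in> carrier G then corr (F n) x else 0)" for n and y :: "'a + 'a"
  have A_le: "norm (A n y) \<le> max R 1" for n y
    using smooth_le[OF r R F(1)] corr_le[OF F(1)] F(2) R0
    by (auto simp: A_def le_max_iff_disj split: sum.split)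
  obtain \<Psi> l where \<Psi>: "\<Psi> \<noteq> bot" "\<Psi> \<le> sequentially" "\<And>y. tendsto (\<lambda>n. A n y) (l y) \<Psi>"
    by (rule pointwise_convergent_subfilter[OF trivial_limit_sequentially, of A "\<lambda>_. max R 1"])
      (rule A_le, rule that)
  define \<rho> where "\<rho> x = l (Inl x)" for x
  define \<phi> where "\<phi> x = l (Inr x)" for x
  have lim_\<rho>: "tendsto (\<lambda>n. smooth r (F n) x) (\<rho> x) \<Psi>" if "x \<in> carrier G" for x
    using \<Psi>(3)[of "Inl x"] that by (simp add: A_def \<rho>_def)
  have lim_\<phi>: "tendsto (\<lambda>n. corr (F n) x) (\<phi> x) \<Psi>" if "x \<in> carrier G" for x
    using \<Psi>(3)[of "Inr x"] that by (simp add: A_def \<phi>_def)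
  have equi: "\<exists>d>0. \<forall>n. \<forall>x\<in>carrier G. \<forall>u\<in>carrier G. q u < d \<longrightarrow>
      norm (smooth r (F n) (x \<otimes> u) - smooth r (F n) x) \<le> e" if e: "e > 0" for e
  proof -
    obtain d where d: "d > 0" "varies_within r d e"
      using ucD[OF r e] by auto
    have "norm (smooth r (F n) (x \<otimes> u) - smooth r (F n) x) \<le> e"
      if "x \<in> carrier G" "u \<in> carrier G" "q u < d" for n x u
      using smooth_diff_le[OF r _ F(1), of u e x n] d(2) that F(2)[of n] by simp
    with d(1) show ?thesis by blast
  qed
  have uc\<rho>: "uc \<rho>" and unif: "uniform_limit (carrier G) (\<lambda>n. smooth r (F n)) \<rho> \<Psi>"
    using uc_limit[OF \<Psi>(1) equi lim_\<rho>] by blast+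
  have b\<rho>: "bounded_fun G \<rho>" by (rule uc_bounded[OF uc\<rho>])
  have "tendsto (\<lambda>n. sqnorm (smooth r (F n))) S sequentially"
  proof (rule tendsto_sandwich)
    have "tendsto (\<lambda>n. S - 1 / Suc n) (S - 0) sequentially"
      by (intro tendsto_intros LIMSEQ_Suc[OF lim_1_over_n])
    then show "tendsto (\<lambda>n. S - 1 / Suc n) S sequentially" by simp
    show "eventually (\<lambda>n. S - 1 / Suc n \<le> sqnorm (smooth r (F n))) sequentially"
      using F(3) by (simp add: less_imp_le)
    show "eventually (\<lambda>n. sqnorm (smooth r (F n)) \<le> S) sequentially"
      using VS[OF F(1,2)] by simp
  qed (rule tendsto_const)
  then have "tendsto (\<lambda>n. sqnorm (smooth r (F n))) S \<Psi>"
    using \<Psi>(2) by (rule tendsto_mono[rotated])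
  then have sq\<rho>: "sqnorm \<rho> = S"
    using sqnorm_tendsto[OF unif bsm[OF F(1)] b\<rho>] tendsto_unique[OF \<Psi>(1)] by blast
  define \<tau> where "\<tau> c g f x = c * f (x \<otimes> g) + cnj c * f (x \<otimes> inv g)" for c g and f :: "'a \<Rightarrow> complex" and x
  have b\<tau>: "bounded_fun G (\<tau> c g f)" if "bounded_fun G f" "g \<in> carrier G" for c g f
    unfolding \<tau>_def[abs_def] using that by (auto intro!: bounded_fun_intros bounded_shift)
  have ineq: "sqnorm (\<lambda>x. 2 * \<rho> x + \<tau> c g \<rho> x) \<le> S * (2 + 2 * Re (c * \<phi> g))\<^sup>2"
    if g: "g \<in> carrier G" and c: "norm c = 1" for c g
  proof -
    have bd: "bounded_fun G (\<lambda>x. 2 * f x + \<tau> c g f x)" if "bounded_fun G f" for f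
      by (intro bounded_fun_intros that b\<tau> g)
    have ul: "uniform_limit (carrier G) (\<lambda>n x. smooth r (F n) (x \<otimes> a)) (\<lambda>x. \<rho> (x \<otimes> a)) \<Psi>"
      if "a \<in> carrier G" for a
      using unif that unfolding uniform_limit_iff by (fastforce elim: eventually_mono)
    have "uniform_limit (carrier G) (\<lambda>n x. 2 * smooth r (F n) x + \<tau> c g (smooth r (F n)) x)
       (\<lambda>x. 2 * \<rho> x + \<tau> c g \<rho> x) \<Psi>"
      unfolding \<tau>_def using g
      by (intro uniform_limit_add bounded_linear.uniform_limit[OF bounded_linear_mult_right] ul unif inv_closed)
    then have "tendsto (\<lambda>n. sqnorm (\<lambda>x. 2 * smooth r (F n) x + \<tau> c g (smooth r (F n)) x))
        (sqnorm (\<lambda>x. 2 * \<rho> x + \<tau> c g \<rho> x)) \<Psi>"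
      by (rule sqnorm_tendsto) (intro bd bsm F(1) b\<rho>)+
    moreover have "tendsto (\<lambda>n. S * (2 + 2 * Re (c * corr (F n) g))\<^sup>2) (S * (2 + 2 * Re (c * \<phi> g))\<^sup>2) \<Psi>"
      using g by (intro tendsto_intros lim_\<phi>)
    moreover have "sqnorm (\<lambda>x. 2 * smooth r (F n) x + \<tau> c g (smooth r (F n)) x) \<le> S * (2 + 2 * Re (c * corr (F n) g))\<^sup>2" for n
    proof -
      have bF': "bounded_fun G (\<lambda>y. F n y + c * F n (y \<otimes> g))"
        using g F(1) by (intro bounded_fun_intros bounded_shift)
      have "complex_of_real (sqnorm (\<lambda>y. F n y + c * F n (y \<otimes> g))) =
          2 * corr (F n) \<one> + (c * corr (F n) (\<one> \<otimes> g) + cnj c * corr (F n) (\<one> \<otimes> inv g))"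
        using corr_one[OF bF'] corr_mix[OF F(1) one_closed g c] by simp
      also have "\<dots> = 2 + (c * corr (F n) g + cnj (c * corr (F n) g))"
        using g corr_one[OF F(1), of n] F(2)[of n] corr_inv[OF F(1) g, of n] by simp
      finally have "Re (complex_of_real (sqnorm (\<lambda>y. F n y + c * F n (y \<otimes> g)))) = Re (2 + (c * corr (F n) g + cnj (c * corr (F n) g)))"
        by simp
      then have sF': "sqnorm (\<lambda>y. F n y + c * F n (y \<otimes> g)) = 2 + 2 * Re (c * corr (F n) g)" by simp
      have "ip (smooth r (\<lambda>y. F n y + c * F n (y \<otimes> g))) (smooth r (\<lambda>y. F n y + c * F n (y \<otimes> g))) =
          ip (\<lambda>x. 2 * smooth r (F n) x + \<tau> c g (smooth r (F n)) x) (\<lambda>x. 2 * smooth r (F n) x + \<tau> c g (smooth r (F n)) x)"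
        unfolding ip_def
      proof (rule M_cong)
        show "bounded_fun G (\<lambda>x. (2 * smooth r (F n) x + \<tau> c g (smooth r (F n)) x) *
            cnj (2 * smooth r (F n) x + \<tau> c g (smooth r (F n)) x))"
          by (intro bounded_fun_intros(4,5) bd bsm F)
      qed (simp only: smooth_mix[OF r F(1) _ g c] \<tau>_def)
      then show ?thesis
        using Sbound[OF bF'] unfolding sF' sqnorm_def by simp
    qed
    ultimately show ?thesis
      by (intro tendsto_le[OF \<Psi>(1)]) auto
  qed
  have \<phi>le: "norm (\<phi> g) \<le> 1" if g: "g \<in> carrier G" for g
    using corr_le[OF F(1) g] F(2)
    by (intro tendsto_upperbound[OF tendsto_norm[OF lim_\<phi>[OF g]] _ \<Psi>(1)]) simp
  have eigen: "\<tau> c g \<rho> x = of_real (2 * Re (c * \<phi> g)) * \<rho> x"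
    if x: "x \<in> carrier G" and g: "g \<in> carrier G" and c: "norm c = 1" for c g x
  proof -
    define s where "s = 2 * Re (c * \<phi> g)"
    define t where "t = sqnorm (\<tau> c g \<rho>)"
    define p where "p = Re (ip \<rho> (\<tau> c g \<rho>))"
    have bt: "bounded_fun G (\<tau> c g \<rho>)" by (rule b\<tau>[OF b\<rho> g])
    have b2: "bounded_fun G (\<lambda>x. 2 * \<rho> x)" by (intro bounded_fun_intros b\<rho>)
    have n2: "sqnorm (\<lambda>x. 2 * \<rho> x) = 4 * S" using sqnorm_scale[OF b\<rho>, of 2] sq\<rho> by simp
    have p2: "Re (ip (\<lambda>x. 2 * \<rho> x) (\<tau> c g \<rho>)) = 2 * p" using ip_scale_left[OF b\<rho> bt, of 2] by (simp add: p_def)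
    have "\<bar>Re (c * \<phi> g)\<bar> \<le> norm (c * \<phi> g)" by (rule abs_Re_le_cmod)
    then have s2: "\<bar>s\<bar> \<le> 2" using \<phi>le[OF g] c by (simp add: s_def norm_mult)
    have "4 * S + 4 * p + t \<le> S * (2 + s)\<^sup>2"
      using ineq[OF g c] sqnorm_add[OF b2 bt] unfolding n2 p2 by (simp add: s_def t_def)
    then have i1: "t + 4 * p \<le> S * (4 * s + s\<^sup>2)" by (simp add: algebra_simps power2_eq_square)
    have neg_s: "2 + 2 * Re (- c * \<phi> g) = 2 - s" by (simp add: s_def)
    have "(\<lambda>x. 2 * \<rho> x + \<tau> (- c) g \<rho> x) = (\<lambda>x. 2 * \<rho> x - \<tau> c g \<rho> x)"
      by (simp add: \<tau>_def fun_eq_iff)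
    then have "4 * S - 4 * p + t \<le> S * (2 - s)\<^sup>2"
      using ineq[OF g, of "- c"] c sqnorm_diff[OF b2 bt] unfolding n2 p2 neg_s by (simp add: t_def)
    then have i2: "t - 4 * p \<le> S * (s\<^sup>2 - 4 * s)" by (simp add: algebra_simps power2_eq_square)
    \<comment> \<open>Strict convexity: the weights \<open>2 - s\<close> and \<open>2 + s\<close> make the two bounds combine to the squared
      norm of \<open>\<tau> - s \<rho>\<close>.\<close>
    have "(2 - s) * (t + 4 * p) + (2 + s) * (t - 4 * p) \<le>
        (2 - s) * (S * (4 * s + s\<^sup>2)) + (2 + s) * (S * (s\<^sup>2 - 4 * s))"
      using s2 by (intro add_mono mult_left_mono i1 i2) auto
    then have key: "t - 2 * s * p + s\<^sup>2 * S \<le> 0" by (simp add: algebra_simps power2_eq_square)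
    have bs: "bounded_fun G (\<lambda>x. of_real s * \<rho> x)" by (intro bounded_fun_intros b\<rho>)
    have "sqnorm (\<lambda>x. \<tau> c g \<rho> x - of_real s * \<rho> x) = t - 2 * s * p + s\<^sup>2 * S"
      unfolding sqnorm_diff[OF bt bs] using sqnorm_scale[OF b\<rho>, of "of_real s"] ip_scale_right[OF b\<rho> bt, of "of_real s"]
        ip_cnj[OF b\<rho> bt] by (simp add: t_def p_def sq\<rho>)
    with key have "sqnorm (\<lambda>x. \<tau> c g \<rho> x - of_real s * \<rho> x) \<le> 0" by simp
    moreover have "uc (\<lambda>x. \<tau> c g \<rho> x - of_real s * \<rho> x)"
      unfolding \<tau>_def using g by (intro uc_diff uc_add uc_scale uc_shift uc\<rho> inv_closed)
    ultimately have "\<tau> c g \<rho> x - of_real s * \<rho> x = 0" using sqnorm_zero x by blast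
    then show ?thesis by (simp add: s_def)
  qed
  have mult: "\<rho> (x \<otimes> g) = \<phi> g * \<rho> x" if x: "x \<in> carrier G" and g: "g \<in> carrier G" for x g
  proof -
    have e1: "\<rho> (x \<otimes> g) + \<rho> (x \<otimes> inv g) = of_real (2 * Re (\<phi> g)) * \<rho> x"
      using eigen[OF x g, of 1] by (simp add: \<tau>_def)
    have e2: "\<i> * \<rho> (x \<otimes> g) - \<i> * \<rho> (x \<otimes> inv g) = of_real (- 2 * Im (\<phi> g)) * \<rho> x"
      using eigen[OF x g, of \<i>] by (simp add: \<tau>_def)
    have "2 * \<rho> (x \<otimes> g) = (\<rho> (x \<otimes> g) + \<rho> (x \<otimes> inv g)) - \<i> * (\<i> * \<rho> (x \<otimes> g) - \<i> * \<rho> (x \<otimes> inv g))"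
      by (simp add: algebra_simps)
    also have "\<dots> = (of_real (2 * Re (\<phi> g)) - \<i> * of_real (- 2 * Im (\<phi> g))) * \<rho> x"
      unfolding e1 e2 by (simp add: algebra_simps)
    also have "of_real (2 * Re (\<phi> g)) - \<i> * of_real (- 2 * Im (\<phi> g)) = 2 * \<phi> g"
      by (simp add: complex_eq_iff)
    finally show ?thesis by simp
  qed
  have \<rho>1: "\<rho> \<one> \<noteq> 0"
  proof
    assume "\<rho> \<one> = 0"
    then have "\<rho> x = 0" if "x \<in> carrier G" for x
      using mult[OF one_closed that] that by simp
    then have "ip \<rho> \<rho> = M (\<lambda>_. 0)"
      unfolding ip_def by (intro M_cong bounded_fun_intros) simp
    then show False using sq\<rho> S0 by (simp add: sqnorm_def M_const)
  qed
  have \<phi>_mult: "\<phi> (x \<otimes> y) = \<phi> x * \<phi> y" if "x \<in> carrier G" "y \<in> carrier G" for x y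
    using mult[OF one_closed, of "x \<otimes> y"] mult[of x y] mult[OF one_closed, of x] that \<rho>1 by (simp add: mult.commute)
  have \<phi>_eq: "\<phi> x = (1 / \<rho> \<one>) * \<rho> x" if "x \<in> carrier G" for x
    using mult[OF one_closed that] that \<rho>1 by simp
  have \<phi>norm: "norm (\<phi> g) = 1" if g: "g \<in> carrier G" for g
  proof -
    have "\<phi> g * \<phi> (inv g) = 1" using \<phi>_mult[of g "inv g"] \<phi>_eq[OF one_closed] \<rho>1 g by simp
    then have n: "norm (\<phi> g) * norm (\<phi> (inv g)) = 1" by (metis norm_mult norm_one)
    have "norm (\<phi> g) * norm (\<phi> (inv g)) \<le> norm (\<phi> g) * 1"
      using \<phi>le[of "inv g"] g by (intro mult_left_mono) auto
    then show ?thesis using n \<phi>le[OF g] by simp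
  qed
  have char: "unit_character G \<phi>" using \<phi>norm \<phi>_mult by (auto simp: unit_character_def)
  have uc\<phi>: "uc \<phi>"
    using uc_scale[OF uc\<rho>, of "1 / \<rho> \<one>"] unfolding uc_def by (simp add: \<phi>_eq)
  have b\<phi>: "bounded_fun G \<phi>" by (rule uc_bounded[OF uc\<phi>])
  have "M (\<lambda>x. r x * cnj (\<phi> x)) \<noteq> 0"
  proof
    assume zero: "M (\<lambda>x. r x * cnj (\<phi> x)) = 0"
    have inner: "M (\<lambda>x. cnj (\<phi> x) * r (x \<otimes> z)) = 0" if z: "z \<in> carrier G" for z
      using Fourier_coefficient_shift[OF char br z] zero by (simp add: mult.commute)
    have "M (\<lambda>x. cnj (\<phi> x) * smooth r (F n) x) = 0" for n
    proof -
      have "M (\<lambda>x. cnj (\<phi> x) * smooth r (F n) x) = M (\<lambda>z. cnj (corr (F n) z) * M (\<lambda>x. cnj (\<phi> x) * r (x \<otimes> z)))"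
        unfolding smooth_def
        by (rule M_swap[OF r bounded_fun_intros(5)[OF corr_bounded[OF F(1)]] bounded_fun_intros(5)[OF b\<phi>]])
      also have "\<dots> = M (\<lambda>_. 0)"
        by (rule M_cong[OF bounded_fun_intros(1)]) (simp add: inner)
      finally show ?thesis by (simp add: M_const)
    qed
    moreover have "tendsto (\<lambda>n. M (\<lambda>x. cnj (\<phi> x) * smooth r (F n) x)) (M (\<lambda>x. cnj (\<phi> x) * \<rho> x)) \<Psi>"
      by (intro M_tendsto uniform_lim_mult uniform_limit_const unif bounded_image bounded_fun_intros b\<phi> b\<rho> bsm F(1))
    ultimately have "tendsto (\<lambda>n. 0) (M (\<lambda>x. cnj (\<phi> x) * \<rho> x)) \<Psi>" by simp
    then have "M (\<lambda>x. cnj (\<phi> x) * \<rho> x) = 0"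
      by (rule tendsto_unique[OF \<Psi>(1) _ tendsto_const])
    moreover have "M (\<lambda>x. cnj (\<phi> x) * \<rho> x) = M (\<lambda>_. \<rho> \<one>)"
    proof (rule M_cong[OF bounded_fun_intros(1)])
      fix x assume x: "x \<in> carrier G"
      have "cnj (\<phi> x) * \<rho> x = (\<phi> x * cnj (\<phi> x)) * \<rho> \<one>"
        using mult[OF one_closed x] x by simp
      then show "cnj (\<phi> x) * \<rho> x = \<rho> \<one>"
        using \<phi>norm[OF x] by (simp add: complex_norm_square[symmetric])
    qed
    ultimately show False using \<rho>1 by (simp add: M_const)
  qed
  with char uc\<phi> that show ?thesis by blast
qed

text \<open>Suppose that no finite set of characters controls \<open>q\<close> at scale \<open>e\<close>. Then there is a net \<open>b\<^sub>i\<close>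
  along which every uniformly continuous character tends to \<open>1\<close> although \<open>q (b\<^sub>i) \<ge> e\<close>. Translating the
  bump \<open>f = max 0 (e - q)\<close> by \<open>b\<^sub>i\<close> does not change its Fourier coefficients in the limit, but moves its
  value at \<open>\<one>\<close> from \<open>e\<close> to \<open>0\<close>. The difference of \<open>f\<close> and a limit of its translates is then nonzero at
  \<open>\<one>\<close> and orthogonal to all characters, which contradicts the previous theorem.\<close>
theorem norm_dominated_by_characters:
  assumes e: "e > 0"
  obtains \<Gamma> \<eta> where "finite \<Gamma>" "\<eta> > 0" "\<And>\<theta>. \<theta> \<in> \<Gamma> \<Longrightarrow> unit_character G \<theta> \<and> uc \<theta>"
    "\<And>x. x \<in> carrier G \<Longrightarrow> (\<And>\<theta>. \<theta> \<in> \<Gamma> \<Longrightarrow> norm (\<theta> x - 1) < \<eta>) \<Longrightarrow> q x < e"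
proof (rule ccontr)
  assume "\<not> thesis"
  note no = this and domination = that
  define Ch where "Ch = {\<theta>. unit_character G \<theta> \<and> uc \<theta>}"
  have "\<exists>b. b \<in> carrier G \<and> (\<forall>\<theta>\<in>\<Gamma>. norm (\<theta> b - 1) < 1 / Suc n) \<and> q b \<ge> e" if "finite \<Gamma>" "\<Gamma> \<subseteq> Ch" for \<Gamma> n
  proof (rule ccontr)
    assume "\<not> ?thesis"
    then have "q x < e" if "x \<in> carrier G" "\<And>\<theta>. \<theta> \<in> \<Gamma> \<Longrightarrow> norm (\<theta> x - 1) < 1 / Suc n" for x
      using that by (meson not_le)
    with \<open>finite \<Gamma>\<close> \<open>\<Gamma> \<subseteq> Ch\<close> have thesis
      by (intro domination[of \<Gamma> "1 / Suc n"]) (auto simp: Ch_def)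
    with no show False by blast
  qed
  then obtain b0 where b0: "\<And>\<Gamma> n. finite \<Gamma> \<Longrightarrow> \<Gamma> \<subseteq> Ch \<Longrightarrow> b0 \<Gamma> n \<in> carrier G \<and>
      (\<forall>\<theta>\<in>\<Gamma>. norm (\<theta> (b0 \<Gamma> n) - 1) < 1 / Suc n) \<and> q (b0 \<Gamma> n) \<ge> e" by metis
  define I where "I = finite_subsets_at_top Ch \<times>\<^sub>F sequentially"
  have I: "I \<noteq> bot"
    by (simp add: I_def prod_filter_eq_bot finite_subsets_at_top_neq_bot)
  obtain b1 where b1: "b1 \<in> carrier G" "q b1 \<ge> e" using b0[of "{}" 0] by auto
  \<comment> \<open>Index pairs whose first component is not a finite set of characters never matter for the filter,
    but the net has to stay in the region \<open>q \<ge> e\<close> for them, too.\<close>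
  define b where "b i = (if finite (fst i) \<and> fst i \<subseteq> Ch then b0 (fst i) (snd i) else b1)" for i
  have bc: "b i \<in> carrier G" and bq: "q (b i) \<ge> e" for i
    using b0[of "fst i" "snd i"] b1 by (auto simp: b_def)
  have blim: "tendsto (\<lambda>i. \<theta> (b i)) 1 I" if "\<theta> \<in> Ch" for \<theta>
  proof (rule tendstoI)
    fix e' :: real assume "e' > 0"
    then obtain n where n: "1 / Suc n < e'" using nat_approx_posE by blast
    have "eventually (\<lambda>S. finite S \<and> \<theta> \<in> S \<and> S \<subseteq> Ch) (finite_subsets_at_top Ch)"
      unfolding eventually_finite_subsets_at_top using that by (intro exI[of _ "{\<theta>}"]) auto
    moreover have "eventually (\<lambda>k. n \<le> k) sequentially" by (rule eventually_ge_at_top)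
    moreover have "dist (\<theta> (b (S, k))) 1 < e'" if "finite S \<and> \<theta> \<in> S \<and> S \<subseteq> Ch" "n \<le> k" for S k
    proof -
      have "norm (\<theta> (b (S, k)) - 1) < 1 / Suc k"
        using b0[of S k] that by (auto simp: b_def)
      also have "\<dots> \<le> 1 / Suc n" using that(2) by (intro divide_left_mono) auto
      finally show ?thesis using n by (simp add: dist_norm)
    qed
    ultimately show "eventually (\<lambda>i. dist (\<theta> (b i)) 1 < e') I"
      unfolding I_def eventually_prod_filter
      by (intro exI[of _ "\<lambda>S. finite S \<and> \<theta> \<in> S \<and> S \<subseteq> Ch"] exI[of _ "\<lambda>k. n \<le> k"]) blast
  qed
  define f where "f x = complex_of_real (max 0 (e - q x))" for x
  have f_lip: "norm (f (x \<otimes> u) - f x) \<le> q u" if xu: "x \<in> carrier G" "u \<in> carrier G" for x u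
  proof -
    have "\<bar>max 0 (e - q (x \<otimes> u)) - max 0 (e - q x)\<bar> \<le> q u"
      using norm_diff_le[OF xu] by linarith
    then show ?thesis unfolding f_def of_real_diff[symmetric] norm_of_real .
  qed
  have ucf: "uc f" by (rule uc_lipschitz[of 1]) (use f_lip in auto)
  have bf: "bounded_fun G f" by (rule uc_bounded[OF ucf])
  define A where "A i x = (if x \<in> carrier G then f (x \<otimes> b i) else 0)" for i x
  have A_le: "norm (A i x) \<le> e" for i x
    using e q_nonneg[OF m_closed[OF _ bc[of i]], of x] by (auto simp: A_def f_def)
  obtain \<Psi> l where \<Psi>: "\<Psi> \<noteq> bot" "\<Psi> \<le> I" "\<And>x. tendsto (\<lambda>i. A i x) (l x) \<Psi>"
    by (rule pointwise_convergent_subfilter[OF I, of A "\<lambda>_. e"]) (rule A_le, rule that)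
  have lim: "tendsto (\<lambda>i. f (x \<otimes> b i)) (l x) \<Psi>" if "x \<in> carrier G" for x
    using \<Psi>(3)[of x] that by (simp add: A_def)
  have lip: "norm (f (x \<otimes> u \<otimes> b i) - f (x \<otimes> b i)) \<le> q u" if "x \<in> carrier G" "u \<in> carrier G" for x u i
    using f_lip[of "x \<otimes> b i" u] that bc[of i] by (simp add: m_ac)
  have "\<exists>d>0. \<forall>i. varies_within (\<lambda>x. f (x \<otimes> b i)) d d'"
    if "d' > 0" for d'
    using that by (intro exI[of _ d'] conjI allI ballI impI order.trans[OF lip less_imp_le])
  then have ucl: "uc l" and unif: "uniform_limit (carrier G) (\<lambda>i x. f (x \<otimes> b i)) l \<Psi>"
    using uc_limit[OF \<Psi>(1), of "\<lambda>i x. f (x \<otimes> b i)" l] lim by blast+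
  have bl: "bounded_fun G l" by (rule uc_bounded[OF ucl])
  have "f (\<one> \<otimes> b i) = 0" for i using bq[of i] bc[of i] by (simp add: f_def)
  then have "tendsto (\<lambda>i. 0) (l \<one>) \<Psi>" using lim[OF one_closed] by simp
  then have "l \<one> = 0" by (rule tendsto_unique[OF \<Psi>(1) _ tendsto_const])
  then have "f \<one> - l \<one> \<noteq> 0" using e by (simp add: f_def q_one)
  then obtain \<theta> where \<theta>: "unit_character G \<theta>" "uc \<theta>" "M (\<lambda>x. (f x - l x) * cnj (\<theta> x)) \<noteq> 0"
    using ex_correlated_character[OF uc_diff[OF ucf ucl]] by blast
  have b\<theta>: "bounded_fun G \<theta>" by (rule uc_bounded[OF \<theta>(2)])
  have b1: "bounded_fun G (\<lambda>x. f x * cnj (\<theta> x))" "bounded_fun G (\<lambda>x. l x * cnj (\<theta> x))"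
    by (intro bounded_fun_intros bf bl b\<theta>)+
  have coef: "M (\<lambda>x. f (x \<otimes> b i) * cnj (\<theta> x)) = \<theta> (b i) * M (\<lambda>x. f x * cnj (\<theta> x))" for i
    by (rule Fourier_coefficient_shift[OF \<theta>(1) bf bc])
  have "tendsto (\<lambda>i. M (\<lambda>x. f (x \<otimes> b i) * cnj (\<theta> x))) (M (\<lambda>x. l x * cnj (\<theta> x))) \<Psi>"
    by (intro M_tendsto uniform_lim_mult uniform_limit_const unif bounded_image bounded_fun_intros
        bounded_shift b\<theta> bl bf bc)
  moreover have "tendsto (\<lambda>i. \<theta> (b i) * M (\<lambda>x. f x * cnj (\<theta> x))) (1 * M (\<lambda>x. f x * cnj (\<theta> x))) \<Psi>"
    using \<theta> by (intro tendsto_mult tendsto_const tendsto_mono[OF \<Psi>(2) blim]) (simp add: Ch_def)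
  ultimately have "M (\<lambda>x. l x * cnj (\<theta> x)) = M (\<lambda>x. f x * cnj (\<theta> x))"
    unfolding coef mult_1_left by (rule tendsto_unique[OF \<Psi>(1)])
  moreover have "M (\<lambda>x. (f x - l x) * cnj (\<theta> x)) = M (\<lambda>x. f x * cnj (\<theta> x)) - M (\<lambda>x. l x * cnj (\<theta> x))"
    unfolding left_diff_distrib by (rule M_diff[OF b1])
  ultimately show False using \<theta>(3) by simp
qed

end


section \<open>Norms from neighbourhoods of the identity\<close>

definition group_norm :: "('a, 'b) monoid_scheme \<Rightarrow> ('a \<Rightarrow> real) \<Rightarrow> bool" where
  "group_norm G q \<longleftrightarrow> (\<forall>x\<in>carrier G. 0 \<le> q x \<and> q (inv\<^bsub>G\<^esub> x) = q x) \<and> q \<one>\<^bsub>G\<^esub> = 0 \<and>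
     (\<forall>x\<in>carrier G. \<forall>y\<in>carrier G. q (x \<otimes>\<^bsub>G\<^esub> y) \<le> q x + q y)"

context comm_group
begin

text \<open>A letter \<open>(n, x)\<close> is meant to satisfy \<open>x \<in> V n\<close> and costs \<open>(1/2)^n\<close>. The norm of an element will be
  the infimum of the costs of the words representing it; subadditivity is then concatenation of words.\<close>

definition word_weight :: "(nat \<times> 'a) list \<Rightarrow> real" where
  "word_weight L = (\<Sum>p\<leftarrow>L. (1/2) ^ fst p)"

definition word_value :: "(nat \<times> 'a) list \<Rightarrow> 'a" where
  "word_value L = foldr (\<lambda>p y. snd p \<otimes> y) L \<one>"

lemma word_weight_simps [simp]:
  "word_weight [] = 0" "word_weight (p # L) = (1/2) ^ fst p + word_weight L"
  "word_weight (K @ L) = word_weight K + word_weight L"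
  by (simp_all add: word_weight_def)

lemma word_weight_nonneg: "word_weight L \<ge> 0"
  by (induction L) auto

lemma word_value_simps [simp]: "word_value [] = \<one>" "word_value (p # L) = snd p \<otimes> word_value L"
  by (simp_all add: word_value_def)

lemma word_value_closed: "snd ` set L \<subseteq> carrier G \<Longrightarrow> word_value L \<in> carrier G"
  by (induction L) auto

lemma word_value_append:
  "snd ` set K \<subseteq> carrier G \<Longrightarrow> snd ` set L \<subseteq> carrier G \<Longrightarrow> word_value (K @ L) = word_value K \<otimes> word_value L"
  by (induction K) (auto simp: m_assoc word_value_closed)

lemma word_value_inv:
  "snd ` set L \<subseteq> carrier G \<Longrightarrow> word_value (map (\<lambda>p. (fst p, inv (snd p))) L) = inv (word_value L)"
  by (induction L) (auto simp: inv_mult word_value_closed)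

lemma word_weight_split:
  assumes "L \<noteq> []" "t \<le> word_weight L" "0 \<le> t"
  shows "\<exists>K p K'. L = K @ p # K' \<and> word_weight K \<le> t \<and> t \<le> word_weight (K @ [p])"
  using assms
proof (induction L arbitrary: t)
  case (Cons p L)
  show ?case
  proof (cases "t \<le> (1/2) ^ fst p")
    case True
    then show ?thesis using Cons.prems by (intro exI[of _ "[]"] exI[of _ p] exI[of _ L]) auto
  next
    case False
    with Cons.prems have "L \<noteq> []" "t - (1/2) ^ fst p \<le> word_weight L" "0 \<le> t - (1/2) ^ fst p" by auto
    then obtain K p' K' where "L = K @ p' # K'" "word_weight K \<le> t - (1/2) ^ fst p"
      "t - (1/2) ^ fst p \<le> word_weight (K @ [p'])"
      using Cons.IH by blast
    then show ?thesis by (intro exI[of _ "p # K"] exI[of _ p'] exI[of _ K']) auto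
  qed
qed simp

text \<open>The Birkhoff--Kakutani construction. What needs proof is that a word of weight less than
  \<open>(1/2)^n\<close> has its value in \<open>V n\<close>. Cut it at the letter at which the weight passes one half of the total: the
  two outer parts weigh less than \<open>(1/2)^(n + 1)\<close> and are handled by induction, the letter itself lies
  in \<open>V (n + 1)\<close>, and a product of three elements of \<open>V (n + 1)\<close> belongs to \<open>V n\<close>. The set \<open>V 0\<close> is the whole
  group so that every element is represented by a word.\<close>
lemma norm_from_neighbourhood_chain:
  fixes V :: "nat \<Rightarrow> 'a set"
  assumes V0: "V 0 = carrier G" and sub: "\<And>n. V n \<subseteq> carrier G" and one: "\<And>n. \<one> \<in> V n"
    and sym: "\<And>n x. x \<in> V n \<Longrightarrow> inv x \<in> V n"
    and chain: "\<And>n x y z. x \<in> V (Suc n) \<Longrightarrow> y \<in> V (Suc n) \<Longrightarrow> z \<in> V (Suc n) \<Longrightarrow> x \<otimes> y \<otimes> z \<in> V n"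
  obtains q where "group_norm G q" "\<And>n x. x \<in> V n \<Longrightarrow> q x \<le> (1/2) ^ n"
    "\<And>n x. x \<in> carrier G \<Longrightarrow> q x < (1/2) ^ n \<Longrightarrow> x \<in> V n"
proof -
  define valid where "valid L \<longleftrightarrow> (\<forall>p\<in>set L. snd p \<in> V (fst p))" for L :: "(nat \<times> 'a) list"
  define q where "q x = Inf {word_weight L | L. valid L \<and> word_value L = x}" for x
  have val_c: "snd ` set L \<subseteq> carrier G" if "valid L" for L
    using that sub by (fastforce simp: valid_def)
  have "V (Suc n) \<subseteq> V n" for n
  proof
    fix x assume x: "x \<in> V (Suc n)"
    then have "x \<otimes> \<one> \<otimes> \<one> \<in> V n" using chain one by blast
    then show "x \<in> V n" using x sub by (auto simp: subset_iff)
  qed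
  then have mono: "V m \<subseteq> V n" if "n \<le> m" for m n
    using that by (metis lift_Suc_antimono_le)
  have small: "word_value L \<in> V n" if "valid L" "word_weight L < (1/2) ^ n" for L n
    using that
  proof (induction "length L" arbitrary: L n rule: less_induct)
    case less
    show ?case
    proof (cases "L = []")
      case True then show ?thesis using one by simp
    next
      case False
      define a where "a = word_weight L"
      obtain K p K' where L: "L = K @ p # K'" and K: "word_weight K \<le> a / 2" "a / 2 \<le> word_weight (K @ [p])"
        using word_weight_split[OF False, of "a / 2"] word_weight_nonneg[of L] by (auto simp: a_def)
      have K': "word_weight K' \<le> a / 2" using K(2) L by (simp add: a_def)
      have vK: "valid K" and vK': "valid K'" and vp: "snd p \<in> V (fst p)"
        using less.prems(1) L by (auto simp: valid_def)
      have a: "a < (1/2) ^ n" using less.prems(2) by (simp add: a_def)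
      have 1: "word_value K \<in> V (Suc n)" using K(1) a by (intro less.hyps vK) (auto simp: L)
      have 2: "word_value K' \<in> V (Suc n)" using K' a by (intro less.hyps vK') (auto simp: L)
      have "(1/2 :: real) ^ fst p \<le> a"
        using word_weight_nonneg[of K] word_weight_nonneg[of K'] L by (simp add: a_def)
      then have "(1/2 :: real) ^ fst p < (1/2) ^ n" using a by linarith
      then have "n < fst p" by (simp add: power_strict_decreasing_iff)
      then have 3: "snd p \<in> V (Suc n)" using vp mono[of "Suc n" "fst p"] by auto
      have "word_value L = word_value K \<otimes> snd p \<otimes> word_value K'"
        using val_c[OF vK] val_c[OF vK'] 3 sub
        by (auto simp: L word_value_append m_assoc word_value_closed subset_iff)
      then show ?thesis using chain[OF 1 3 2] by simp
    qed
  qed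
  have bdd: "bdd_below {word_weight L | L. valid L \<and> word_value L = x}" for x
    by (intro bdd_belowI[of _ 0]) (auto simp: word_weight_nonneg)
  have q_le: "q (word_value L) \<le> word_weight L" if "valid L" for L
    unfolding q_def by (rule cInf_lower[OF _ bdd]) (use that in auto)
  have ne: "{word_weight L | L. valid L \<and> word_value L = x} \<noteq> {}" if "x \<in> carrier G" for x
  proof -
    have "valid [(0, x)]" "word_value [(0, x)] = x" using that V0 by (auto simp: valid_def)
    then show ?thesis by blast
  qed
  have near: "\<exists>L. valid L \<and> word_value L = x \<and> word_weight L < t" if "x \<in> carrier G" "q x < t" for x t
    using that cInf_less_iff[OF ne[OF that(1)] bdd, of t] by (auto simp: q_def)
  have q_inv_le: "q (inv x) \<le> q x" if x: "x \<in> carrier G" for x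
  proof (rule field_le_epsilon)
    fix e :: real assume "e > 0"
    then obtain L where L: "valid L" "word_value L = x" "word_weight L < q x + e"
      using near[OF x, of "q x + e"] by auto
    define L' where "L' = map (\<lambda>p. (fst p, inv (snd p))) L"
    have "valid L'" using L(1) sym by (auto simp: valid_def L'_def)
    moreover have "word_value L' = inv x" unfolding L'_def using word_value_inv[OF val_c[OF L(1)]] L(2) by simp
    moreover have "word_weight L' = word_weight L" by (simp add: word_weight_def L'_def o_def)
    ultimately show "q (inv x) \<le> q x + e" using q_le[of L'] L(3) by simp
  qed
  have "group_norm G q"
    unfolding group_norm_def
  proof (intro conjI ballI)
    fix x assume x: "x \<in> carrier G"
    show "0 \<le> q x" unfolding q_def using ne[OF x] by (intro cInf_greatest) (auto simp: word_weight_nonneg)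
    show "q (inv x) = q x" using q_inv_le[OF x] q_inv_le[of "inv x"] x by simp
    fix y assume y: "y \<in> carrier G"
    show "q (x \<otimes> y) \<le> q x + q y"
    proof (rule field_le_epsilon)
      fix e :: real assume e: "e > 0"
      obtain L where L: "valid L" "word_value L = x" "word_weight L < q x + e/2"
        using near[OF x, of "q x + e/2"] e by auto
      obtain L' where L': "valid L'" "word_value L' = y" "word_weight L' < q y + e/2"
        using near[OF y, of "q y + e/2"] e by auto
      have "valid (L @ L')" using L L' by (auto simp: valid_def)
      moreover have "word_value (L @ L') = x \<otimes> y"
        using word_value_append[OF val_c val_c] L L' by simp
      ultimately show "q (x \<otimes> y) \<le> q x + q y + e" using q_le[of "L @ L'"] L L' by simp
    qed
  next
    have "valid []" by (simp add: valid_def)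
    then have "q \<one> \<le> 0" using q_le[of "[]"] by simp
    moreover have "q \<one> \<ge> 0" unfolding q_def using ne[OF one_closed] by (intro cInf_greatest) (auto simp: word_weight_nonneg)
    ultimately show "q \<one> = 0" by simp
  qed
  moreover have "q x \<le> (1/2) ^ n" if "x \<in> V n" for n x
  proof -
    have "valid [(n, x)]" using that by (simp add: valid_def)
    then show ?thesis using q_le[of "[(n, x)]"] that sub by (auto simp: subset_iff)
  qed
  moreover have "x \<in> V n" if "x \<in> carrier G" "q x < (1/2) ^ n" for n x
    using near[OF that] small by blast
  ultimately show ?thesis using that by blast
qed

end

section \<open>Continuous characters of precompact groups\<close>

locale topological_ab_group =
  fixes G :: "('a, 'b) monoid_scheme" (structure) and T :: "'a topology"
  assumes top: "top_ab_group G T"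

sublocale topological_ab_group \<subseteq> comm_group G
  using top by (simp add: top_ab_group_def)

context topological_ab_group
begin

lemma space: "topspace T = carrier G"
  using top by (simp add: top_ab_group_def)

lemma translation_continuous:
  assumes "a \<in> carrier G" shows "continuous_map T T (\<lambda>x. a \<otimes> x)"
proof -
  have "continuous_map T (prod_topology T T) (\<lambda>x. (a, x))"
    using assms by (intro continuous_map_pairedI) (auto simp: space)
  then have "continuous_map T T ((\<lambda>(x, y). x \<otimes> y) \<circ> (\<lambda>x. (a, x)))"
    using top unfolding top_ab_group_def by (blast intro: continuous_map_compose)
  then show ?thesis by (simp add: o_def)
qed

lemma openin_translate:
  assumes "a \<in> carrier G" "openin T U" shows "openin T {x \<in> carrier G. a \<otimes> x \<in> U}"
  using openin_continuous_map_preimage[OF translation_continuous[OF assms(1)] assms(2)] by (simp add: space)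

lemma openin_inverse:
  assumes "openin T U" shows "openin T {x \<in> carrier G. inv x \<in> U}"
proof -
  have "continuous_map T T (\<lambda>x. inv x)" using top by (simp add: top_ab_group_def)
  from openin_continuous_map_preimage[OF this assms] show ?thesis by (simp add: space)
qed

lemma open_product_neighbourhood:
  assumes "openin T U" "x \<in> carrier G" "y \<in> carrier G" "x \<otimes> y \<in> U"
  obtains A B where "openin T A" "openin T B" "x \<in> A" "y \<in> B" "\<And>a b. a \<in> A \<Longrightarrow> b \<in> B \<Longrightarrow> a \<otimes> b \<in> U"
proof -
  define S where "S = {p \<in> topspace (prod_topology T T). (case p of (x, y) \<Rightarrow> x \<otimes> y) \<in> U}"
  have "openin (prod_topology T T) S"
    unfolding S_def by (rule openin_continuous_map_preimage[OF _ assms(1)]) (use top in \<open>simp add: top_ab_group_def\<close>)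
  moreover have "(x, y) \<in> S"
    using assms by (simp add: space S_def)
  ultimately have "\<exists>A B. openin T A \<and> openin T B \<and> x \<in> A \<and> y \<in> B \<and> A \<times> B \<subseteq> S"
    using openin_prod_topology_alt[THEN iffD1, rule_format] by metis
  then obtain A B where AB: "openin T A" "openin T B" "x \<in> A" "y \<in> B" "A \<times> B \<subseteq> S" by blast
  have "a \<otimes> b \<in> U" if "a \<in> A" "b \<in> B" for a b
    using AB(5) that by (auto simp: S_def)
  with that[OF AB(1-4)] show ?thesis by blast
qed

lemma square_root_neighbourhood:
  assumes "openin T U" "\<one> \<in> U"
  obtains W where "openin T W" "\<one> \<in> W" "\<And>a b. a \<in> W \<Longrightarrow> b \<in> W \<Longrightarrow> a \<otimes> b \<in> U" "\<And>a. a \<in> W \<Longrightarrow> inv a \<in> W"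
proof -
  obtain A B where AB: "openin T A" "openin T B" "\<one> \<in> A" "\<one> \<in> B" "\<And>a b. a \<in> A \<Longrightarrow> b \<in> B \<Longrightarrow> a \<otimes> b \<in> U"
    using open_product_neighbourhood[OF assms(1), of \<one> \<one>] assms by auto
  define C where "C = A \<inter> B"
  define W where "W = C \<inter> {x \<in> carrier G. inv x \<in> C}"
  have C: "openin T C" "\<one> \<in> C" using AB by (auto simp: C_def)
  have Cc: "C \<subseteq> carrier G" using openin_subset[OF C(1)] by (simp add: space)
  show ?thesis
    by (rule that[of W]) (use C Cc openin_inverse[OF C(1)] AB in \<open>auto simp: W_def C_def\<close>)
qed

lemma cube_root_neighbourhood:
  assumes "openin T U" "\<one> \<in> U"
  obtains W where "openin T W" "\<one> \<in> W" "W \<subseteq> carrier G"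
    "\<And>a b c. a \<in> W \<Longrightarrow> b \<in> W \<Longrightarrow> c \<in> W \<Longrightarrow> a \<otimes> b \<otimes> c \<in> U" "\<And>a. a \<in> W \<Longrightarrow> inv a \<in> W"
proof -
  obtain W where W: "openin T W" "\<one> \<in> W" "\<And>a b. a \<in> W \<Longrightarrow> b \<in> W \<Longrightarrow> a \<otimes> b \<in> U" "\<And>a. a \<in> W \<Longrightarrow> inv a \<in> W"
    using square_root_neighbourhood[OF assms] by blast
  obtain W' where W': "openin T W'" "\<one> \<in> W'" "\<And>a b. a \<in> W' \<Longrightarrow> b \<in> W' \<Longrightarrow> a \<otimes> b \<in> W" "\<And>a. a \<in> W' \<Longrightarrow> inv a \<in> W'"
    using square_root_neighbourhood[OF W(1,2)] by blast
  have c: "W' \<subseteq> carrier G" using openin_subset[OF W'(1)] by (simp add: space)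
  have "c \<in> W" if "c \<in> W'" for c
    using W'(3)[OF that W'(2)] that c by auto
  then show ?thesis using that[OF W'(1,2) c _ W'(4)] W'(3) W(3) by blast
qed

lemma continuous_map_of_open_fibres:
  fixes f :: "'a \<Rightarrow> complex"
  assumes "\<And>x e. x \<in> carrier G \<Longrightarrow> e > 0 \<Longrightarrow>
    \<exists>W. openin T W \<and> \<one> \<in> W \<and> (\<forall>u\<in>W. norm (f (x \<otimes> u) - f x) < e)"
  shows "continuous_map T euclidean f"
  unfolding continuous_map_def
proof (intro conjI allI impI)
  fix U :: "complex set" assume "openin euclidean U"
  then have U: "open U" by (simp only: open_openin)
  show "openin T {x \<in> topspace T. f x \<in> U}"
  proof (subst openin_subopen, intro ballI)
    fix x assume "x \<in> {x \<in> topspace T. f x \<in> U}"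
    then have x: "x \<in> carrier G" "f x \<in> U" by (auto simp: space)
    obtain e where e: "e > 0" "ball (f x) e \<subseteq> U" using openE[OF U x(2)] by blast
    obtain W where W: "openin T W" "\<one> \<in> W" "\<And>u. u \<in> W \<Longrightarrow> norm (f (x \<otimes> u) - f x) < e"
      using assms[OF x(1) e(1)] by blast
    have "y \<in> {x \<in> topspace T. f x \<in> U}" if "y \<in> carrier G" "inv x \<otimes> y \<in> W" for y
    proof -
      have "norm (f y - f x) < e"
        using W(3)[OF that(2)] x(1) that(1) by (simp add: m_assoc[symmetric])
      then have "f y \<in> ball (f x) e" by (simp add: dist_norm norm_minus_commute)
      then show ?thesis using e(2) that(1) by (auto simp: space)
    qed
    then show "\<exists>S. openin T S \<and> x \<in> S \<and> S \<subseteq> {x \<in> topspace T. f x \<in> U}"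
      using openin_translate[OF inv_closed[OF x(1)] W(1)] x(1) W(2)
      by (intro exI[of _ "{y \<in> carrier G. inv x \<otimes> y \<in> W}"]) auto
  qed
qed auto

end

locale precompact_ab_group =
  fixes G :: "('a, 'b) monoid_scheme" (structure) and T :: "'a topology"
  assumes precompact: "precompact_group G T"

sublocale precompact_ab_group \<subseteq> topological_ab_group G T
  using precompact by unfold_locales (simp add: precompact_group_def)

context precompact_ab_group
begin

lemma finite_cover:
  assumes "openin T U" "\<one> \<in> U"
  obtains F where "finite F" "F \<subseteq> carrier G" "\<And>x. x \<in> carrier G \<Longrightarrow> \<exists>a\<in>F. x \<otimes> inv a \<in> U"
proof -
  have "nbhd_of T \<one> U"
    unfolding nbhd_of_def using openin_subset[OF assms(1)] assms by (intro conjI exI[of _ U]) auto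
  then obtain F where F: "finite F" "F \<subseteq> carrier G" "F <#> U = carrier G"
    using precompact by (auto simp: precompact_group_def)
  have Uc: "U \<subseteq> carrier G" using openin_subset[OF assms(1)] by (simp add: space)
  have "\<exists>a\<in>F. x \<otimes> inv a \<in> U" if x: "x \<in> carrier G" for x
  proof -
    have "x \<in> F <#> U" using x F(3) by simp
    then obtain a u where "a \<in> F" "u \<in> U" "x = a \<otimes> u" by (auto simp: set_mult_def)
    moreover from this have "x \<otimes> inv a = u" using F(2) Uc
      by (metis inv_solve_right m_comm subsetD m_closed)
    ultimately show ?thesis by (intro bexI[of _ a]) simp_all
  qed
  with F that show ?thesis by blast
qed

lemma ex_continuous_norm:
  assumes "openin T U" "\<one> \<in> U"
  obtains q where "group_norm G q" "\<And>e. e > 0 \<Longrightarrow> \<exists>W. openin T W \<and> \<one> \<in> W \<and> (\<forall>u\<in>W. q u < e)"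
    "\<And>x. x \<in> carrier G \<Longrightarrow> q x < 1/2 \<Longrightarrow> x \<in> U"
proof -
  define P where "P W \<longleftrightarrow> openin T W \<and> \<one> \<in> W \<and> (\<forall>a\<in>W. inv a \<in> W)" for W
  have "\<exists>W'. P W' \<and> (\<forall>a\<in>W'. \<forall>b\<in>W'. \<forall>c\<in>W'. a \<otimes> b \<otimes> c \<in> W)" if "openin T W" "\<one> \<in> W" for W
    using cube_root_neighbourhood[OF that] unfolding P_def by metis
  then obtain R where R: "\<And>W. openin T W \<Longrightarrow> \<one> \<in> W \<Longrightarrow> P (R W)"
    "\<And>W a b c. openin T W \<Longrightarrow> \<one> \<in> W \<Longrightarrow> a \<in> R W \<Longrightarrow> b \<in> R W \<Longrightarrow> c \<in> R W \<Longrightarrow> a \<otimes> b \<otimes> c \<in> W" by metis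
  define V where "V n = (case n of 0 \<Rightarrow> carrier G | Suc k \<Rightarrow> (R ^^ Suc k) U)" for n
  have V: "P (V (Suc n))" for n
    by (induction n) (use R(1) assms in \<open>auto simp: V_def P_def\<close>)
  have P0: "P (V 0)" using openin_topspace[of T] by (auto simp: P_def V_def space)
  have PV: "P (V n)" for n using V P0 by (cases n) auto
  have R_sub: "R W \<subseteq> W" if "openin T W" "\<one> \<in> W" for W
  proof
    fix x assume x: "x \<in> R W"
    have PR: "P (R W)" using R(1) that by blast
    then have "R W \<subseteq> carrier G" using openin_subset[of T "R W"] by (simp add: P_def space)
    moreover have "x \<otimes> \<one> \<otimes> \<one> \<in> W" using R(2)[OF that x] PR by (simp add: P_def)
    ultimately show "x \<in> W" using x by auto
  qed
  have sub: "V n \<subseteq> carrier G" for n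
    using PV[of n] openin_subset[of T "V n"] by (simp add: P_def space)
  have chain: "x \<otimes> y \<otimes> z \<in> V n" if "x \<in> V (Suc n)" "y \<in> V (Suc n)" "z \<in> V (Suc n)" for n x y z
  proof (cases n)
    case 0 then show ?thesis using that sub[of "Suc n"] by (auto simp: V_def[of 0])
  next
    case (Suc k)
    then have "V (Suc n) = R (V n)" by (simp add: V_def)
    then show ?thesis using R(2)[of "V n"] PV[of n] that by (auto simp: P_def)
  qed
  obtain q where q: "group_norm G q" "\<And>n x. x \<in> V n \<Longrightarrow> q x \<le> (1/2) ^ n"
    "\<And>n x. x \<in> carrier G \<Longrightarrow> q x < (1/2) ^ n \<Longrightarrow> x \<in> V n"
    by (rule norm_from_neighbourhood_chain[of V])
      (use PV sub chain in \<open>auto simp: P_def V_def[of 0]\<close>)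
  show ?thesis
  proof (rule that[OF q(1)])
    fix e :: real assume "e > 0"
    then obtain n where "(1/2) ^ n < e" using real_arch_pow_inv[of e "1/2"] by auto
    then show "\<exists>W. openin T W \<and> \<one> \<in> W \<and> (\<forall>u\<in>W. q u < e)"
      using PV[of n] q(2)[of _ n] by (intro exI[of _ "V n"]) (auto simp: P_def intro: le_less_trans)
  next
    fix x assume "x \<in> carrier G" "q x < 1/2"
    then have "x \<in> V 1" using q(3)[of x 1] by simp
    then show "x \<in> U" using R_sub[OF assms] by (auto simp: V_def)
  qed
qed

text \<open>Take a continuous norm \<open>q\<close> with \<open>{q < 1/2} \<subseteq> U\<close> and pass to the quotient norm
  \<open>p x = inf {q (x \<otimes> h) | h \<in> H}\<close>. It is again totally bounded, so it is dominated by finitely many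
  characters that are uniformly continuous for \<open>p\<close>; these are trivial on \<open>H\<close> because \<open>p\<close> vanishes there.\<close>
theorem characters_trivial_on_subgroup:
  assumes H: "subgroup H G" and U: "openin T U" "\<one> \<in> U"
  obtains \<Gamma> \<eta> where "finite \<Gamma>" "\<eta> > 0"
    "\<And>\<theta>. \<theta> \<in> \<Gamma> \<Longrightarrow> unit_character G \<theta> \<and> continuous_map T euclidean \<theta> \<and> (\<forall>h\<in>H. \<theta> h = 1)"
    "\<And>x. x \<in> carrier G \<Longrightarrow> (\<And>\<theta>. \<theta> \<in> \<Gamma> \<Longrightarrow> norm (\<theta> x - 1) < \<eta>) \<Longrightarrow> \<exists>h\<in>H. x \<otimes> h \<in> U"
proof -
  obtain q where q: "group_norm G q" "\<And>e. e > 0 \<Longrightarrow> \<exists>W. openin T W \<and> \<one> \<in> W \<and> (\<forall>u\<in>W. q u < e)"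
    "\<And>x. x \<in> carrier G \<Longrightarrow> q x < 1/2 \<Longrightarrow> x \<in> U"
    using ex_continuous_norm[OF U] by blast
  have q0: "0 \<le> q x" "q (inv x) = q x" if "x \<in> carrier G" for x
    using q(1) that by (auto simp: group_norm_def)
  have q1: "q \<one> = 0" using q(1) by (simp add: group_norm_def)
  have qm: "q (x \<otimes> y) \<le> q x + q y" if "x \<in> carrier G" "y \<in> carrier G" for x y
    using q(1) that by (auto simp: group_norm_def)
  have Hc: "h \<in> carrier G" if "h \<in> H" for h using H that by (rule subgroup.mem_carrier)
  have H1: "\<one> \<in> H" by (rule subgroup.one_closed[OF H])
  have Hi: "inv h \<in> H" if "h \<in> H" for h using subgroup.m_inv_closed[OF H that] .
  have Hm: "h \<otimes> k \<in> H" if "h \<in> H" "k \<in> H" for h k using subgroup.m_closed[OF H that] .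
  define p where "p x = (INF h\<in>H. q (x \<otimes> h))" for x
  have bdd: "bdd_below ((\<lambda>h. q (x \<otimes> h)) ` H)" if "x \<in> carrier G" for x
    by (intro bdd_belowI2[of _ 0] q0) (use that Hc in auto)
  have p_le: "p x \<le> q (x \<otimes> h)" if "x \<in> carrier G" "h \<in> H" for x h
    unfolding p_def by (rule cINF_lower[OF bdd[OF that(1)] that(2)])
  have p_near: "\<exists>h\<in>H. q (x \<otimes> h) < t" if "x \<in> carrier G" "p x < t" for x t
    using cINF_less_iff[OF _ bdd[OF that(1)], of t] that(2) H1 unfolding p_def by blast
  have p_q: "p x \<le> q x" if "x \<in> carrier G" for x using p_le[OF that H1] that by simp
  have p_nonneg: "0 \<le> p x" if "x \<in> carrier G" for x
    unfolding p_def using H1 that Hc by (intro cINF_greatest q0) auto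
  have p_H: "p h = 0" if "h \<in> H" for h
    using p_le[OF Hc[OF that] Hi[OF that]] p_nonneg[OF Hc[OF that]] Hc[OF that] q1 by simp
  have p_inv_le: "p (inv x) \<le> p x" if x: "x \<in> carrier G" for x
  proof (rule field_le_epsilon)
    fix e :: real assume "e > 0"
    then obtain h where h: "h \<in> H" "q (x \<otimes> h) < p x + e" using p_near[OF x, of "p x + e"] by auto
    have "inv (x \<otimes> h) = inv x \<otimes> inv h" using x Hc[OF h(1)] by (simp add: inv_mult)
    then have "q (inv x \<otimes> inv h) = q (x \<otimes> h)" using q0(2)[of "x \<otimes> h"] x Hc[OF h(1)] by simp
    then show "p (inv x) \<le> p x + e" using p_le[of "inv x" "inv h"] x Hi[OF h(1)] h(2) by simp
  qed
  obtain M where M: "invariant_mean G M" using ex_invariant_mean by blast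
  have "totally_bounded_norm G M p"
  proof (intro totally_bounded_norm.intro totally_bounded_norm_axioms.intro M)
    fix x assume x: "x \<in> carrier G"
    show "0 \<le> p x" by (rule p_nonneg[OF x])
    show "p (inv x) = p x" using p_inv_le[OF x] p_inv_le[of "inv x"] x by simp
    fix y assume y: "y \<in> carrier G"
    show "p (x \<otimes> y) \<le> p x + p y"
    proof (rule field_le_epsilon)
      fix e :: real assume e: "e > 0"
      obtain h where h: "h \<in> H" "q (x \<otimes> h) < p x + e/2" using p_near[OF x, of "p x + e/2"] e by auto
      obtain k where k: "k \<in> H" "q (y \<otimes> k) < p y + e/2" using p_near[OF y, of "p y + e/2"] e by auto
      have "x \<otimes> y \<otimes> (h \<otimes> k) = (x \<otimes> h) \<otimes> (y \<otimes> k)" using x y Hc[OF h(1)] Hc[OF k(1)] by (simp add: m_ac)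
      then have "p (x \<otimes> y) \<le> q ((x \<otimes> h) \<otimes> (y \<otimes> k))" using p_le[of "x \<otimes> y" "h \<otimes> k"] x y Hm[OF h(1) k(1)] by simp
      also have "\<dots> \<le> q (x \<otimes> h) + q (y \<otimes> k)" using x y Hc[OF h(1)] Hc[OF k(1)] by (intro qm) auto
      finally show "p (x \<otimes> y) \<le> p x + p y + e" using h k by simp
    qed
  next
    show "p \<one> = 0" by (rule p_H[OF H1])
    fix e :: real assume "e > 0"
    then have "\<exists>W. openin T W \<and> \<one> \<in> W \<and> (\<forall>u\<in>W. q u < e)" by (rule q(2))
    then obtain W where W: "openin T W" "\<one> \<in> W" "\<And>u. u \<in> W \<Longrightarrow> q u < e" by blast
    obtain F where F: "finite F" "F \<subseteq> carrier G" "\<And>x. x \<in> carrier G \<Longrightarrow> \<exists>a\<in>F. x \<otimes> inv a \<in> W"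
      using finite_cover[OF W(1,2)] by blast
    have "\<exists>a\<in>F. p (x \<otimes> inv a) < e" if x: "x \<in> carrier G" for x
    proof -
      obtain a where a: "a \<in> F" "x \<otimes> inv a \<in> W" using F(3)[OF x] by blast
      then have "p (x \<otimes> inv a) \<le> q (x \<otimes> inv a)" using x F(2) by (intro p_q) auto
      also have "\<dots> < e" by (rule W(3)[OF a(2)])
      finally show ?thesis using a(1) by blast
    qed
    with F show "\<exists>F. finite F \<and> F \<subseteq> carrier G \<and> (\<forall>x\<in>carrier G. \<exists>a\<in>F. p (x \<otimes> inv a) < e)" by blast
  qed
  then interpret N: totally_bounded_norm G M p .
  obtain \<Gamma> \<eta> where \<Gamma>: "finite \<Gamma>" "\<eta> > 0" "\<And>\<theta>. \<theta> \<in> \<Gamma> \<Longrightarrow> unit_character G \<theta> \<and> N.uc \<theta>"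
    "\<And>x. x \<in> carrier G \<Longrightarrow> (\<And>\<theta>. \<theta> \<in> \<Gamma> \<Longrightarrow> norm (\<theta> x - 1) < \<eta>) \<Longrightarrow> p x < 1/2"
    by (rule N.norm_dominated_by_characters[of "1/2"]) auto
  have "continuous_map T euclidean \<theta>" if \<theta>: "\<theta> \<in> \<Gamma>" for \<theta>
  proof (rule continuous_map_of_open_fibres)
    fix x and e :: real assume x: "x \<in> carrier G" and e: "e > 0"
    obtain d where d: "d > 0" "N.varies_within \<theta> d (e/2)"
      using N.ucD[of \<theta> "e/2"] \<Gamma>(3)[OF \<theta>] e by auto
    obtain W where W: "openin T W" "\<one> \<in> W" "\<And>u. u \<in> W \<Longrightarrow> q u < d" using q(2)[OF d(1)] by blast
    have "norm (\<theta> (x \<otimes> u) - \<theta> x) < e" if u: "u \<in> W" for u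
    proof -
      have uc: "u \<in> carrier G" using u openin_subset[OF W(1)] by (auto simp: space)
      then have "p u < d" using p_q W(3)[OF u] by (meson le_less_trans)
      then show ?thesis using d(2)[rule_format, OF x uc] e by simp
    qed
    with W show "\<exists>W. openin T W \<and> \<one> \<in> W \<and> (\<forall>u\<in>W. norm (\<theta> (x \<otimes> u) - \<theta> x) < e)" by blast
  qed
  moreover have "\<theta> h = 1" if \<theta>: "\<theta> \<in> \<Gamma>" and h: "h \<in> H" for \<theta> h
  proof -
    have ch: "unit_character G \<theta>" and uc: "N.uc \<theta>" using \<Gamma>(3)[OF \<theta>] by auto
    have "norm (\<theta> h - \<theta> \<one>) \<le> 0"
    proof (rule field_le_epsilon)
      fix e :: real assume "e > 0"
      then obtain d where d: "d > 0" "N.varies_within \<theta> d e"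
        using N.ucD[OF uc] by blast
      show "norm (\<theta> h - \<theta> \<one>) \<le> 0 + e"
        using d(2)[rule_format, of \<one> h] p_H[OF h] Hc[OF h] d(1) by simp
    qed
    moreover have "\<theta> \<one> = 1"
    proof -
      have "\<theta> \<one> * \<theta> \<one> = \<theta> \<one>" "norm (\<theta> \<one>) = 1" using ch unfolding unit_character_def by (metis l_one one_closed)+
      then show ?thesis by auto
    qed
    ultimately show ?thesis by simp
  qed
  moreover have "\<exists>h\<in>H. x \<otimes> h \<in> U"
    if x: "x \<in> carrier G" and near_1: "\<And>\<theta>. \<theta> \<in> \<Gamma> \<Longrightarrow> norm (\<theta> x - 1) < \<eta>" for x
  proof -
    have "p x < 1/2" using \<Gamma>(4) x near_1 by blast
    then obtain h where "h \<in> H" "q (x \<otimes> h) < 1/2" using p_near[OF x] by blast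
    then show ?thesis using q(3)[of "x \<otimes> h"] x Hc by blast
  qed
  ultimately show ?thesis using that[OF \<Gamma>(1,2)] \<Gamma>(3) by blast
qed

end


section \<open>Extending characters from subgroups\<close>

context comm_group
begin

lemma unit_character_one: "unit_character G \<theta> \<Longrightarrow> \<theta> \<one> = 1"
proof -
  assume "unit_character G \<theta>"
  then have "\<theta> \<one> * \<theta> \<one> = \<theta> \<one>" "norm (\<theta> \<one>) = 1"
    unfolding unit_character_def by (metis l_one one_closed)+
  then show ?thesis by auto
qed

lemma unit_character_inv:
  assumes "unit_character G \<theta>" "x \<in> carrier G" shows "\<theta> (inv x) = inverse (\<theta> x)"
proof -
  have "\<theta> x * \<theta> (inv x) = 1"
    using assms unit_character_one[OF assms(1)] unfolding unit_character_def by (metis inv_closed r_inv)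
  then show ?thesis by (metis inverse_unique)
qed

lemma subgroup_comm_group: "subgroup H G \<Longrightarrow> comm_group (G\<lparr>carrier := H\<rparr>)"
proof (rule group.group_comm_groupI)
  assume H: "subgroup H G"
  show "group (G\<lparr>carrier := H\<rparr>)" by (rule subgroup.subgroup_is_group[OF H]) (rule is_group)
  show "x \<otimes>\<^bsub>G\<lparr>carrier := H\<rparr>\<^esub> y = y \<otimes>\<^bsub>G\<lparr>carrier := H\<rparr>\<^esub> x"
    if "x \<in> carrier (G\<lparr>carrier := H\<rparr>)" "y \<in> carrier (G\<lparr>carrier := H\<rparr>)" for x y
    using that subgroup.mem_carrier[OF H] by (simp add: m_comm)
qed

text \<open>Divisibility of the circle, by Zorn's lemma on graphs of partial characters. A relation that
  is a subgroup of the product and relates \<open>\<one>\<close> to \<open>1\<close> only is automatically single-valued, which keeps the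
  conditions closed under unions of chains. If \<open>x\<close> is outside the domain of a maximal graph, adjoin
  \<open>(x, z)\<close>, where \<open>z\<close> is an \<open>n\<close>-th root of the value at \<open>x\<^sup>n\<close> for the least \<open>n > 0\<close> such that \<open>x\<^sup>n\<close> lies in
  the domain, and \<open>z = 1\<close> if there is none.\<close>
theorem extend_unit_character:
  assumes H: "subgroup H G" and \<psi>: "unit_character (G\<lparr>carrier := H\<rparr>) \<psi>"
  obtains \<theta> where "unit_character G \<theta>" "\<And>h. h \<in> H \<Longrightarrow> \<theta> h = \<psi> h"
proof -
  interpret K: comm_group "G\<lparr>carrier := H\<rparr>" by (rule subgroup_comm_group[OF H])
  define good where "good R \<longleftrightarrow> (\<forall>h\<in>H. (h, \<psi> h) \<in> R) \<and> (\<forall>x a. (x, a) \<in> R \<longrightarrow> x \<in> carrier G \<and> norm a = 1) \<and>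
      (\<forall>x a y b. (x, a) \<in> R \<longrightarrow> (y, b) \<in> R \<longrightarrow> (x \<otimes> y, a * b) \<in> R) \<and>
      (\<forall>x a. (x, a) \<in> R \<longrightarrow> (inv x, inverse a) \<in> R) \<and> (\<forall>a. (\<one>, a) \<in> R \<longrightarrow> a = 1)" for R :: "('a \<times> complex) set"
  have Hc: "h \<in> carrier G" if "h \<in> H" for h using subgroup.mem_carrier[OF H that] .
  have \<psi>1: "\<psi> \<one> = 1" using K.unit_character_one[OF \<psi>] by simp
  have \<psi>i: "\<psi> (inv h) = inverse (\<psi> h)" if "h \<in> H" for h
    using K.unit_character_inv[OF \<psi>, of h] that H by simp
  have "good {(h, \<psi> h) | h. h \<in> H}"
    unfolding good_def using \<psi> H \<psi>1 \<psi>i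
    by (auto simp: unit_character_def subgroup.m_closed subgroup.m_inv_closed Hc)
  moreover have "\<Union>\<C> \<in> {R. good R}" if ne: "\<C> \<noteq> {}" and ch: "subset.chain {R. good R} \<C>" for \<C>
  proof -
    have g: "good R" if "R \<in> \<C>" for R using ch that by (auto simp: subset.chain_def)
    have tot: "R \<subseteq> R' \<or> R' \<subseteq> R" if "R \<in> \<C>" "R' \<in> \<C>" for R R'
      using ch that by (auto simp: subset_chain_def)
    have "(x \<otimes> y, a * b) \<in> \<Union>\<C>" if xa: "(x, a) \<in> \<Union>\<C>" and yb: "(y, b) \<in> \<Union>\<C>" for x a y b
    proof -
      obtain R R' where R: "R \<in> \<C>" "(x, a) \<in> R" "R' \<in> \<C>" "(y, b) \<in> R'" using xa yb by blast
      then obtain S where "S \<in> \<C>" "(x, a) \<in> S" "(y, b) \<in> S" using tot[OF R(1,3)] by blast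
      then show ?thesis using g[of S] unfolding good_def by blast
    qed
    moreover have "\<forall>h\<in>H. (h, \<psi> h) \<in> \<Union>\<C>" using ne g unfolding good_def by blast
    moreover have "\<forall>x a. (x, a) \<in> \<Union>\<C> \<longrightarrow> x \<in> carrier G \<and> norm a = 1" using g unfolding good_def by blast
    moreover have "\<forall>x a. (x, a) \<in> \<Union>\<C> \<longrightarrow> (inv x, inverse a) \<in> \<Union>\<C>" using g unfolding good_def by blast
    moreover have "\<forall>a. (\<one>, a) \<in> \<Union>\<C> \<longrightarrow> a = 1" using g unfolding good_def by blast
    ultimately show ?thesis by (simp only: good_def mem_Collect_eq) blast
  qed
  ultimately have "\<exists>R\<in>{R. good R}. \<forall>S\<in>{R. good R}. R \<subseteq> S \<longrightarrow> S = R"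
    by (intro subset_Zorn_nonempty) blast+
  then obtain R where R: "good R" and max: "\<And>S. good S \<Longrightarrow> R \<subseteq> S \<Longrightarrow> S = R" by blast
  have R_H: "(h, \<psi> h) \<in> R" if "h \<in> H" for h using R that unfolding good_def by blast
  have R_c: "x \<in> carrier G" "norm a = 1" if "(x, a) \<in> R" for x a using R that unfolding good_def by blast+
  have R_m: "(x \<otimes> y, a * b) \<in> R" if "(x, a) \<in> R" "(y, b) \<in> R" for x a y b using R that unfolding good_def by blast
  have R_i: "(inv x, inverse a) \<in> R" if "(x, a) \<in> R" for x a using R that unfolding good_def by blast
  have R_1: "a = 1" if "(\<one>, a) \<in> R" for a using R that unfolding good_def by blast
  have R_one: "(\<one>, 1) \<in> R" using R_H[OF subgroup.one_closed[OF H]] \<psi>1 by simp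
  have R_fun: "a = b" if "(x, a) \<in> R" "(x, b) \<in> R" for x a b
  proof -
    have "(x \<otimes> inv x, a * inverse b) \<in> R" using R_m[OF that(1) R_i[OF that(2)]] .
    then have "a * inverse b = 1" using R_1 R_c(1)[OF that(1)] by simp
    moreover have "b \<noteq> 0" using R_c(2)[OF that(2)] by auto
    ultimately show ?thesis by (simp add: field_simps)
  qed
  have R_pow: "(x [^] n, a ^ n) \<in> R" if "(x, a) \<in> R" for x a and n :: nat
  proof (induction n)
    case (Suc n)
    then show ?case using R_m[OF Suc that] by (simp add: mult.commute)
  qed (use R_one in simp)
  have R_ipow: "(x [^] k, a powi k) \<in> R" if "(x, a) \<in> R" for x a and k :: int
  proof (cases k)
    case (nonneg n) then show ?thesis using R_pow[OF that, of n] by (simp add: int_pow_int)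
  next
    case (neg n)
    then show ?thesis
      using R_i[OF R_pow[OF that, of "Suc n"]] R_c(1)[OF that]
      by (simp add: int_pow_neg_int power_int_minus del: of_nat_Suc nat_pow_Suc power_Suc)
  qed
  have total: "\<exists>a. (x, a) \<in> R" if x: "x \<in> carrier G" for x
  proof (rule ccontr)
    assume no: "\<nexists>a. (x, a) \<in> R"
    have "\<exists>z. norm z = 1 \<and> (\<forall>(k::int) c. (x [^] k, c) \<in> R \<longrightarrow> c = z powi k)"
    proof (cases "\<exists>n>0. \<exists>a. (x [^] (n::nat), a) \<in> R")
      case True
      define n where "n = (LEAST n. n > 0 \<and> (\<exists>a. (x [^] (n::nat), a) \<in> R))"
      have n: "n > 0 \<and> (\<exists>a. (x [^] n, a) \<in> R)" unfolding n_def by (rule LeastI_ex[OF True])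
      have least: "n \<le> m" if "m > 0" "(x [^] m, a) \<in> R" for m a
        unfolding n_def by (rule Least_le) (use that in blast)
      obtain a where a: "(x [^] n, a) \<in> R" using n by blast
      define z where "z = cis (Arg a / n)"
      have "z ^ n = cis (Arg a)" unfolding z_def Complex.DeMoivre using n by simp
      also have "\<dots> = a" using R_c(2)[OF a] cis_Arg[of a] by (cases "a = 0") (auto simp: sgn_eq)
      finally have zn: "z ^ n = a" .
      have "c = z powi k" if c: "(x [^] k, c) \<in> R" for k :: int and c
      proof -
        define d where "d = k div int n"
        have an: "(x [^] int n, a) \<in> R" using a by (simp add: int_pow_int)
        have k: "k = int n * d + k mod int n" by (simp add: d_def)
        have "x [^] k \<otimes> (x [^] int n) [^] (- d) = x [^] (k mod int n)"
        proof -
          have "x [^] k \<otimes> (x [^] int n) [^] (- d) = x [^] (k + int n * (- d))"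
            using x by (simp only: int_pow_pow int_pow_mult)
          also have "k + int n * (- d) = k mod int n" using k by (simp add: algebra_simps)
          finally show ?thesis .
        qed
        then have "(x [^] (k mod int n), c * a powi (- d)) \<in> R" using R_m[OF c R_ipow[OF an]] by metis
        moreover have "k mod int n = int (nat (k mod int n))" using n by simp
        ultimately have "(x [^] nat (k mod int n), c * a powi (- d)) \<in> R" by (metis int_pow_int)
        then have "\<not> nat (k mod int n) > 0"
          using least[of "nat (k mod int n)"] n by (metis leD nat_less_iff pos_mod_bound of_nat_0_less_iff pos_mod_sign)
        moreover have "k mod int n \<ge> 0" using n by simp
        ultimately have "k mod int n = 0" by linarith
        then have kd: "k = int n * d" using k by simp
        have "(x [^] k, a powi d) \<in> R" using R_ipow[OF an, of d] x unfolding kd by (simp only: int_pow_pow)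
        then have "c = a powi d" using R_fun c by blast
        also have "\<dots> = z powi k" unfolding kd zn[symmetric] by (simp add: power_int_mult)
        finally show ?thesis .
      qed
      moreover have "norm z = 1" by (simp add: z_def)
      ultimately show ?thesis by blast
    next
      case False
      have "c = 1" if c: "(x [^] k, c) \<in> R" for k :: int and c
      proof (cases "k = 0")
        case True then show ?thesis using R_1 c by simp
      next
        case k: False
        have "\<exists>a. (x [^] nat \<bar>k\<bar>, a) \<in> R"
        proof (cases k)
          case (nonneg m) then show ?thesis using c by (auto simp: int_pow_int)
        next
          case (neg m)
          then have "x [^] nat \<bar>k\<bar> = inv (x [^] k)" using x by (simp add: int_pow_neg_int del: of_nat_Suc nat_pow_Suc)
          then show ?thesis using R_i[OF c] by metis
        qed
        then show ?thesis using False k by (metis zero_less_nat_eq zero_less_abs_iff)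
      qed
      then show ?thesis by (intro exI[of _ 1]) auto
    qed
    then obtain z where z: "norm z = 1" "\<And>(k::int) c. (x [^] k, c) \<in> R \<Longrightarrow> c = z powi k" by blast
    have z0: "z \<noteq> 0" using z(1) by auto
    define R' where "R' = {(y \<otimes> x [^] (k::int), b * z powi k) | y b k. (y, b) \<in> R}"
    have sub: "R \<subseteq> R'"
    proof
      fix p assume "p \<in> R"
      moreover obtain y b where "p = (y, b)" by fastforce
      ultimately have "(y, b) \<in> R" "p = (y \<otimes> x [^] (0::int), b * z powi 0)" using R_c(1) by auto
      then show "p \<in> R'" unfolding R'_def by blast
    qed
    have "good R'" unfolding good_def
    proof (intro conjI allI ballI impI)
      show "(h, \<psi> h) \<in> R'" if "h \<in> H" for h using R_H[OF that] sub by blast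
    next
      fix y b assume "(y, b) \<in> R'"
      then obtain y' b' k where e: "y = y' \<otimes> x [^] (k::int)" "b = b' * z powi k" "(y', b') \<in> R"
        unfolding R'_def by blast
      show "y \<in> carrier G" "norm b = 1" using e R_c[OF e(3)] x z(1) by (auto simp: norm_mult norm_power_int)
      have "inv y = inv y' \<otimes> x [^] (- k)" using e R_c[OF e(3)] x by (simp add: inv_mult int_pow_neg)
      moreover have "inverse b = inverse b' * z powi (- k)" using e by (simp add: power_int_minus)
      ultimately show "(inv y, inverse b) \<in> R'" using R_i[OF e(3)] unfolding R'_def by blast
      fix w c assume "(w, c) \<in> R'"
      then obtain w' c' l where f: "w = w' \<otimes> x [^] (l::int)" "c = c' * z powi l" "(w', c') \<in> R"
        unfolding R'_def by blast
      have "y \<otimes> w = (y' \<otimes> w') \<otimes> x [^] (k + l)"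
        using e f R_c[OF e(3)] R_c[OF f(3)] x by (simp add: int_pow_mult m_ac)
      moreover have "b * c = (b' * c') * z powi (k + l)" using e f z0 by (simp add: power_int_add)
      ultimately show "(y \<otimes> w, b * c) \<in> R'" using R_m[OF e(3) f(3)] unfolding R'_def by blast
    next
      fix b assume "(\<one>, b) \<in> R'"
      then obtain y' b' k where e: "\<one> = y' \<otimes> x [^] (k::int)" "b = b' * z powi k" "(y', b') \<in> R"
        unfolding R'_def by blast
      have y': "y' \<in> carrier G" by (rule R_c(1)[OF e(3)])
      have "x [^] k \<otimes> y' = \<one>" unfolding e(1) by (rule m_comm) (use x y' in auto)
      then have "inv y' = x [^] k" using y' x by (intro inv_equality) auto
      then have "inverse b' = z powi k" using z(2) R_i[OF e(3)] by metis
      then show "b = 1" using e(2) R_c(2)[OF e(3)] by (metis norm_zero right_inverse zero_neq_one)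
    qed
    then have "R' = R" using max sub by blast
    moreover have "(\<one> \<otimes> x [^] (1::int), 1 * z powi 1) \<in> R'" unfolding R'_def using R_one by blast
    ultimately have "(x, z) \<in> R" using x by simp
    then show False using no by blast
  qed
  then obtain \<theta> where \<theta>: "\<And>x. x \<in> carrier G \<Longrightarrow> (x, \<theta> x) \<in> R" by metis
  have "unit_character G \<theta>"
    unfolding unit_character_def using \<theta> R_c(2) R_fun[OF \<theta> R_m[OF \<theta> \<theta>]] by blast
  moreover have "\<theta> h = \<psi> h" if "h \<in> H" for h
    using R_fun[OF \<theta>[OF Hc[OF that]] R_H[OF that]] .
  ultimately show ?thesis using that by blast
qed

text \<open>Precompactness from a finite colouring: one representative of each colour suffices. It provides
  covers by elements of the group itself, which is what passing to subgroups and to finer topologies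
  requires.\<close>
lemma finite_colouring_cover:
  assumes fin: "finite (c ` carrier G)" and U: "U \<subseteq> carrier G"
    and cU: "\<And>x y. x \<in> carrier G \<Longrightarrow> y \<in> carrier G \<Longrightarrow> c x = c y \<Longrightarrow> x \<otimes> inv y \<in> U"
  shows "\<exists>F. finite F \<and> F \<subseteq> carrier G \<and> F <#> U = carrier G"
proof -
  define r where "r k = (SOME x. x \<in> carrier G \<and> c x = k)" for k
  have r: "r (c x) \<in> carrier G \<and> c (r (c x)) = c x" if "x \<in> carrier G" for x
    unfolding r_def by (rule someI[of _ x]) (use that in simp)
  define F where "F = r ` c ` carrier G"
  have Fc: "F \<subseteq> carrier G" using r by (auto simp: F_def)
  have "x \<in> F <#> U" if x: "x \<in> carrier G" for x
  proof -
    have rx: "r (c x) \<in> carrier G" "c (r (c x)) = c x" using r[OF x] by auto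
    have "x \<otimes> inv (r (c x)) \<in> U" using rx x by (intro cU) auto
    moreover have "x = r (c x) \<otimes> (x \<otimes> inv (r (c x)))"
      using x rx(1) by (metis inv_closed m_lcomm r_inv r_one)
    moreover have "r (c x) \<in> F" using x by (auto simp: F_def)
    ultimately show ?thesis unfolding set_mult_def by blast
  qed
  then have "F <#> U = carrier G" using Fc U by (auto simp: set_mult_def)
  then show ?thesis using Fc fin by (auto simp: F_def intro!: exI[of _ F])
qed

end


section \<open>Comparing, joining and restricting precompact topologies\<close>

lemma precompact_groupI:
  assumes "top_ab_group G T"
    and "\<And>U. openin T U \<Longrightarrow> \<one>\<^bsub>G\<^esub> \<in> U \<Longrightarrow> \<exists>F. finite F \<and> F \<subseteq> carrier G \<and> F <#>\<^bsub>G\<^esub> U = carrier G"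
  shows "precompact_group G T"
  unfolding precompact_group_def
proof (intro conjI allI impI assms(1))
  fix U assume "nbhd_of T \<one>\<^bsub>G\<^esub> U"
  then obtain V where V: "openin T V" "\<one>\<^bsub>G\<^esub> \<in> V" "V \<subseteq> U" and U: "U \<subseteq> carrier G"
    using assms(1) by (auto simp: nbhd_of_def top_ab_group_def)
  obtain F where F: "finite F" "F \<subseteq> carrier G" "F <#>\<^bsub>G\<^esub> V = carrier G" using assms(2)[OF V(1,2)] by blast
  interpret comm_group G using assms(1) by (simp add: top_ab_group_def)
  have "F <#>\<^bsub>G\<^esub> V \<subseteq> F <#>\<^bsub>G\<^esub> U" unfolding set_mult_def using V(3) by blast
  moreover have "F <#>\<^bsub>G\<^esub> U \<subseteq> carrier G" using F(2) U by (auto simp: set_mult_def)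
  ultimately have "F <#>\<^bsub>G\<^esub> U = carrier G" using F(3) by blast
  with F show "\<exists>F. finite F \<and> F \<subseteq> carrier G \<and> F <#>\<^bsub>G\<^esub> U = carrier G" by blast
qed

lemma (in comm_group) quotient_cancel:
  assumes "x \<in> carrier G" "y \<in> carrier G" "a \<in> carrier G"
  shows "(x \<otimes> inv a) \<otimes> inv (y \<otimes> inv a) = x \<otimes> inv y"
proof -
  have "inv (y \<otimes> inv a) = a \<otimes> inv y" using assms by (simp add: inv_mult m_comm)
  moreover have "inv a \<otimes> (a \<otimes> inv y) = inv y" using assms by (simp add: m_assoc[symmetric])
  ultimately show ?thesis using assms by (simp add: m_assoc)
qed

context topological_ab_group
begin

lemma nbhd_of_one_translate:
  assumes "openin T W" "w \<in> W"
  shows "openin T {x \<in> carrier G. w \<otimes> x \<in> W}" "\<one> \<in> {x \<in> carrier G. w \<otimes> x \<in> W}" "w \<in> carrier G"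
proof -
  show w: "w \<in> carrier G" using openin_subset[OF assms(1)] assms(2) by (auto simp: space)
  show "openin T {x \<in> carrier G. w \<otimes> x \<in> W}" by (rule openin_translate[OF w assms(1)])
  show "\<one> \<in> {x \<in> carrier G. w \<otimes> x \<in> W}" using w assms(2) by simp
qed

lemma character_ball_open:
  assumes "continuous_map T euclidean (\<theta> :: 'a \<Rightarrow> complex)"
  shows "openin T {x \<in> carrier G. norm (\<theta> x - z) < e}"
proof -
  have "openin T {x \<in> topspace T. \<theta> x \<in> ball z e}"
    by (rule openin_continuous_map_preimage[OF assms]) simp
  then show ?thesis by (simp add: space dist_norm norm_minus_commute)
qed

lemma finite_character_ball_open:
  assumes "finite \<Gamma>" "\<And>\<theta>. \<theta> \<in> \<Gamma> \<Longrightarrow> continuous_map T euclidean (\<theta> :: 'a \<Rightarrow> complex)"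
  shows "openin T {x \<in> carrier G. \<forall>\<theta>\<in>\<Gamma>. norm (\<theta> x - z \<theta>) < e}"
  using assms
proof (induction \<Gamma>)
  case empty then show ?case using openin_topspace[of T] by (simp add: space)
next
  case (insert \<theta> \<Gamma>)
  have "{x \<in> carrier G. \<forall>\<theta>\<in>insert \<theta> \<Gamma>. norm (\<theta> x - z \<theta>) < e} =
    {x \<in> carrier G. norm (\<theta> x - z \<theta>) < e} \<inter> {x \<in> carrier G. \<forall>\<theta>\<in>\<Gamma>. norm (\<theta> x - z \<theta>) < e}" by auto
  then show ?case using insert character_ball_open by (simp add: openin_Int)
qed

lemma unit_character_dist:
  assumes "unit_character G \<theta>" "x \<in> carrier G" "y \<in> carrier G"
  shows "norm (\<theta> (x \<otimes> inv y) - 1) = norm (\<theta> x - \<theta> y)"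
proof -
  have y: "norm (\<theta> y) = 1" "\<theta> y \<noteq> 0" using assms by (auto simp: unit_character_def)
  have "\<theta> (x \<otimes> inv y) = \<theta> x * \<theta> (inv y)" using assms by (simp add: unit_character_def)
  then have "\<theta> (x \<otimes> inv y) - 1 = (\<theta> x - \<theta> y) / \<theta> y"
    using unit_character_inv[OF assms(1,3)] y(2) by (simp add: field_simps)
  then show ?thesis using y(1) by (simp add: norm_divide)
qed

lemma character_continuousI:
  assumes \<theta>: "unit_character G \<theta>"
    and near: "\<And>e. e > 0 \<Longrightarrow> \<exists>W. openin T W \<and> \<one> \<in> W \<and> (\<forall>u\<in>W. norm (\<theta> u - 1) < e)"
  shows "continuous_map T euclidean \<theta>"
proof (rule continuous_map_of_open_fibres)
  fix x and e :: real assume x: "x \<in> carrier G" and "e > 0"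
  then obtain W where W: "openin T W" "\<one> \<in> W" "\<forall>u\<in>W. norm (\<theta> u - 1) < e" using near by blast
  have "norm (\<theta> (x \<otimes> u) - \<theta> x) = norm (\<theta> u - 1)" if "u \<in> W" for u
  proof -
    have u: "u \<in> carrier G" using that openin_subset[OF W(1)] by (auto simp: space)
    have "\<theta> (x \<otimes> u) - \<theta> x = \<theta> x * (\<theta> u - 1)" using \<theta> x u by (simp add: unit_character_def algebra_simps)
    then show ?thesis using \<theta> x by (simp add: unit_character_def norm_mult)
  qed
  with W show "\<exists>W. openin T W \<and> \<one> \<in> W \<and> (\<forall>u\<in>W. norm (\<theta> (x \<otimes> u) - \<theta> x) < e)" by auto
qed

text \<open>A precompact topology is generated by its continuous characters, so it suffices to compare
  these.\<close>
lemma finer_by_characters: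
  assumes T': "precompact_group G T'"
    and chars: "\<And>\<theta>. unit_character G \<theta> \<Longrightarrow> continuous_map T' euclidean \<theta> \<Longrightarrow> continuous_map T euclidean \<theta>"
    and W: "openin T' W"
  shows "openin T W"
proof (subst openin_subopen, intro ballI)
  interpret T': precompact_ab_group G T' by unfold_locales (rule T')
  fix w assume w: "w \<in> W"
  note n = T'.nbhd_of_one_translate[OF W w]
  obtain \<Gamma> \<eta> where \<Gamma>: "finite \<Gamma>" "\<eta> > 0"
    "\<And>\<theta>. \<theta> \<in> \<Gamma> \<Longrightarrow> unit_character G \<theta> \<and> continuous_map T' euclidean \<theta> \<and> (\<forall>h\<in>{\<one>}. \<theta> h = 1)"
    "\<And>x. x \<in> carrier G \<Longrightarrow> (\<And>\<theta>. \<theta> \<in> \<Gamma> \<Longrightarrow> norm (\<theta> x - 1) < \<eta>) \<Longrightarrow> \<exists>h\<in>{\<one>}. x \<otimes> h \<in> {x \<in> carrier G. w \<otimes> x \<in> W}"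
    using T'.characters_trivial_on_subgroup[OF triv_subgroup n(1,2)] by blast
  define B where "B = {x \<in> carrier G. \<forall>\<theta>\<in>\<Gamma>. norm (\<theta> x - \<theta> w) < \<eta>}"
  have "openin T B" unfolding B_def using \<Gamma>(1,3) chars by (intro finite_character_ball_open) blast+
  moreover have "w \<in> B" using n(3) \<Gamma>(2) by (simp add: B_def)
  moreover have "x \<in> W" if x: "x \<in> B" for x
  proof -
    have xc: "x \<in> carrier G" using x by (simp add: B_def)
    have "norm (\<theta> (x \<otimes> inv w) - 1) < \<eta>" if "\<theta> \<in> \<Gamma>" for \<theta>
      using unit_character_dist[of \<theta> x w] \<Gamma>(3)[OF that] x that n(3) by (simp add: B_def)
    then have "w \<otimes> (x \<otimes> inv w) \<in> W" using \<Gamma>(4)[of "x \<otimes> inv w"] xc n(3) by auto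
    moreover have "w \<otimes> (x \<otimes> inv w) = x" using xc n(3) by (metis inv_closed m_lcomm r_inv r_one)
    ultimately show ?thesis by simp
  qed
  ultimately show "\<exists>S. openin T S \<and> w \<in> S \<and> S \<subseteq> W" by blast
qed

text \<open>The coarsest refinement of \<open>T\<close> for which \<open>\<theta>\<close> is continuous.\<close>
definition join_character :: "('a \<Rightarrow> complex) \<Rightarrow> 'a topology" where
  "join_character \<theta> = pullback_topology (carrier G) (\<lambda>x. (x, \<theta> x)) (prod_topology T euclidean)"

lemma join_coarse: "openin T W \<Longrightarrow> openin (join_character \<theta>) W"
  unfolding join_character_def openin_pullback_topology
  by (intro exI[of _ "W \<times> UNIV"])
    (use openin_subset[of T W] in \<open>auto simp: openin_prod_Times_iff space\<close>)

lemma join_character_open: "open O' \<Longrightarrow> openin (join_character \<theta>) {x \<in> carrier G. \<theta> x \<in> O'}"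
  unfolding join_character_def openin_pullback_topology
  by (intro exI[of _ "carrier G \<times> O'"])
    (use openin_topspace[of T] in \<open>auto simp: openin_prod_Times_iff space\<close>)

lemma join_space: "topspace (join_character \<theta>) = carrier G"
  by (auto simp: join_character_def topspace_pullback_topology space)

lemma join_character_continuous: "continuous_map (join_character \<theta>) euclidean \<theta>"
  unfolding continuous_map_def using join_character_open by (auto simp: join_space)

lemma join_basis:
  assumes "openin (join_character \<theta>) S" "x \<in> S"
  obtains W e where "openin T W" "x \<in> W" "e > 0" "\<And>y. y \<in> W \<Longrightarrow> norm (\<theta> y - \<theta> x) < e \<Longrightarrow> y \<in> S"
proof -
  obtain Q where Q: "openin (prod_topology T euclidean) Q" "S = (\<lambda>x. (x, \<theta> x)) -` Q \<inter> carrier G"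
    using assms(1) unfolding join_character_def openin_pullback_topology by blast
  have "(x, \<theta> x) \<in> Q" using assms(2) Q(2) by simp
  then have "\<exists>W O'. openin T W \<and> openin euclidean O' \<and> x \<in> W \<and> \<theta> x \<in> O' \<and> W \<times> O' \<subseteq> Q"
    using openin_prod_topology_alt[THEN iffD1, OF Q(1)] by blast
  then obtain W O' where W: "openin T W" "openin euclidean O'" "x \<in> W" "\<theta> x \<in> O'" "W \<times> O' \<subseteq> Q" by blast
  have "open O'" using W(2) by (simp only: open_openin)
  then obtain e where e: "e > 0" "ball (\<theta> x) e \<subseteq> O'" using openE[OF _ W(4)] by blast
  have "y \<in> S" if "y \<in> W" "norm (\<theta> y - \<theta> x) < e" for y
  proof -
    have "\<theta> y \<in> O'" using e(2) that(2) by (auto simp: dist_norm norm_minus_commute)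
    then show ?thesis using W(5) that(1) Q(2) openin_subset[OF W(1)] by (auto simp: space)
  qed
  with that[OF W(1,3) e(1)] show ?thesis by blast
qed

lemma join_limit:
  assumes "limitin T u a sequentially" "tendsto (\<lambda>n. \<theta> (u n)) (\<theta> a) sequentially"
  shows "limitin (join_character \<theta>) u a sequentially"
  unfolding limitin_def
proof (intro conjI allI impI)
  show "a \<in> topspace (join_character \<theta>)" using limitin_topspace[OF assms(1)] by (simp add: join_space space)
  fix U assume "openin (join_character \<theta>) U \<and> a \<in> U"
  then obtain W e where W: "openin T W" "a \<in> W" "e > 0" "\<And>y. y \<in> W \<Longrightarrow> norm (\<theta> y - \<theta> a) < e \<Longrightarrow> y \<in> U"
    using join_basis by metis
  have "eventually (\<lambda>n. u n \<in> W) sequentially" using assms(1) W(1,2) by (auto simp: limitin_def)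
  moreover have "eventually (\<lambda>n. dist (\<theta> (u n)) (\<theta> a) < e) sequentially" using assms(2) W(3) by (rule tendstoD)
  ultimately show "eventually (\<lambda>n. u n \<in> U) sequentially"
    by eventually_elim (simp add: W(4) dist_norm)
qed

lemma join_continuousI:
  assumes "continuous_map S T f" "continuous_map S euclidean (\<lambda>x. \<theta> (f x))"
  shows "continuous_map S (join_character \<theta>) f"
  unfolding join_character_def
proof (rule continuous_map_pullback')
  show "continuous_map S (prod_topology T euclidean) ((\<lambda>x. (x, \<theta> x)) \<circ> f)"
    unfolding o_def using assms by (rule continuous_map_pairedI)
  show "topspace S \<subseteq> f -` carrier G" using assms(1) by (auto simp: continuous_map_def space)
qed

lemma top_ab_group_join:
  assumes \<theta>: "unit_character G \<theta>" shows "top_ab_group G (join_character \<theta>)"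
  unfolding top_ab_group_def
proof (intro conjI)
  let ?J = "join_character \<theta>"
  show "comm_group G" by (rule comm_group_axioms)
  show "topspace ?J = carrier G" by (rule join_space)
  have J: "continuous_map ?J euclidean \<theta>" by (rule join_character_continuous)
  have id: "continuous_map ?J T (\<lambda>x. x)"
    unfolding continuous_map_def using join_coarse openin_subset[of T]
    by (auto simp: join_space space Int_absorb1 Collect_conj_eq)
  show "continuous_map (prod_topology ?J ?J) ?J (\<lambda>(x, y). x \<otimes> y)"
  proof (rule join_continuousI)
    have "continuous_map (prod_topology ?J ?J) (prod_topology T T) (\<lambda>(x, y). (x, y))"
      unfolding continuous_map_prod_top using id by blast
    moreover have "continuous_map (prod_topology T T) T (\<lambda>(x, y). x \<otimes> y)"
      using top by (simp add: top_ab_group_def)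
    ultimately have "continuous_map (prod_topology ?J ?J) T ((\<lambda>(x, y). x \<otimes> y) \<circ> (\<lambda>(x, y). (x, y)))"
      by (rule continuous_map_compose)
    then show "continuous_map (prod_topology ?J ?J) T (\<lambda>(x, y). x \<otimes> y)" by (simp add: o_def case_prod_unfold)
    have "continuous_map (prod_topology ?J ?J) (euclidean :: (complex \<times> complex) topology) (\<lambda>p. (\<theta> (fst p), \<theta> (snd p)))"
      unfolding prod_topology_euclidean[symmetric]
      using continuous_map_compose[OF continuous_map_fst J] continuous_map_compose[OF continuous_map_snd J]
      by (intro continuous_map_pairedI) (simp_all add: o_def)
    moreover have "continuous_map euclidean euclidean (\<lambda>z. fst z * snd z :: complex)"
      by (simp add: continuous_on_mult continuous_on_fst continuous_on_snd)
    ultimately have "continuous_map (prod_topology ?J ?J) euclidean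
        ((\<lambda>z. fst z * snd z) \<circ> (\<lambda>p. (\<theta> (fst p), \<theta> (snd p))))"
      by (rule continuous_map_compose)
    then have "continuous_map (prod_topology ?J ?J) euclidean (\<lambda>p. \<theta> (fst p) * \<theta> (snd p))"
      by (simp add: o_def)
    then show "continuous_map (prod_topology ?J ?J) euclidean (\<lambda>p. \<theta> (case p of (x, y) \<Rightarrow> x \<otimes> y))"
      by (rule continuous_map_eq) (use \<theta> in \<open>auto simp: join_space unit_character_def\<close>)
  qed
  show "continuous_map ?J ?J (\<lambda>x. inv x)"
  proof (rule join_continuousI)
    show "continuous_map ?J T (\<lambda>x. inv x)"
      using continuous_map_compose[OF id, of T "\<lambda>x. inv x"] top by (simp add: top_ab_group_def o_def)
    have "continuous_map ?J euclidean (\<lambda>x. cnj (\<theta> x))"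
      using continuous_map_compose[OF J, of euclidean cnj] by (simp add: o_def continuous_on_cnj)
    moreover have "cnj (\<theta> x) = \<theta> (inv x)" if "x \<in> topspace ?J" for x
      using that \<theta> inverse_unique[of "\<theta> x" "cnj (\<theta> x)"] unit_character_inv[OF \<theta>, of x]
      by (simp add: join_space unit_character_def complex_norm_square[symmetric])
    ultimately show "continuous_map ?J euclidean (\<lambda>x. \<theta> (inv x))" by (rule continuous_map_eq)
  qed
  show "Hausdorff_space ?J"
    unfolding Hausdorff_space_def
  proof (intro allI impI)
    fix x y assume xy: "x \<in> topspace ?J \<and> y \<in> topspace ?J \<and> x \<noteq> y"
    moreover have "Hausdorff_space T" using top by (simp add: top_ab_group_def)
    ultimately obtain A B where "openin T A" "openin T B" "x \<in> A" "y \<in> B" "disjnt A B"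
      unfolding Hausdorff_space_def by (metis join_space space)
    then show "\<exists>U V. openin ?J U \<and> openin ?J V \<and> x \<in> U \<and> y \<in> V \<and> disjnt U V"
      using join_coarse by blast
  qed
qed

end

context precompact_ab_group
begin

text \<open>An element is coloured by a translate of a small \<open>T\<close>-neighbourhood containing it together with a
  small disc containing its image in the circle, which is compact.\<close>
lemma precompact_join:
  assumes \<theta>: "unit_character G \<theta>" shows "precompact_group G (join_character \<theta>)"
proof (rule precompact_groupI[OF top_ab_group_join[OF \<theta>]])
  fix U assume U: "openin (join_character \<theta>) U" "\<one> \<in> U"
  obtain W e where W: "openin T W" "\<one> \<in> W" "e > 0" "\<And>y. y \<in> W \<Longrightarrow> norm (\<theta> y - \<theta> \<one>) < e \<Longrightarrow> y \<in> U"
    using join_basis[OF U] by metis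
  obtain V where V: "openin T V" "\<one> \<in> V" "\<And>a b. a \<in> V \<Longrightarrow> b \<in> V \<Longrightarrow> a \<otimes> b \<in> W" "\<And>a. a \<in> V \<Longrightarrow> inv a \<in> V"
    using square_root_neighbourhood[OF W(1,2)] by metis
  obtain F where F: "finite F" "F \<subseteq> carrier G" "\<And>x. x \<in> carrier G \<Longrightarrow> \<exists>a\<in>F. x \<otimes> inv a \<in> V"
    using finite_cover[OF V(1,2)] by metis
  obtain N where N: "finite N" "cball (0::complex) 1 \<subseteq> (\<Union>z\<in>N. ball z (e/2))"
    using compact_eq_totally_bounded[of "cball (0::complex) 1"] W(3) by (metis compact_cball half_gt_zero)
  have "\<exists>p\<in>F \<times> N. x \<otimes> inv (fst p) \<in> V \<and> \<theta> x \<in> ball (snd p) (e/2)" if x: "x \<in> carrier G" for x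
  proof -
    have "\<theta> x \<in> cball 0 1" using \<theta> x by (simp add: unit_character_def)
    then show ?thesis using N(2) F(3)[OF x] by force
  qed
  then obtain c where c: "\<And>x. x \<in> carrier G \<Longrightarrow> c x \<in> F \<times> N"
    "\<And>x. x \<in> carrier G \<Longrightarrow> x \<otimes> inv (fst (c x)) \<in> V" "\<And>x. x \<in> carrier G \<Longrightarrow> \<theta> x \<in> ball (snd (c x)) (e/2)" by metis
  show "\<exists>F. finite F \<and> F \<subseteq> carrier G \<and> F <#> U = carrier G"
  proof (rule finite_colouring_cover)
    have "c ` carrier G \<subseteq> F \<times> N" using c(1) by blast
    then show "finite (c ` carrier G)" using F(1) N(1) by (meson finite_SigmaI finite_subset)
    show "U \<subseteq> carrier G" using openin_subset[OF U(1)] by (simp add: join_space)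
    fix x y assume x: "x \<in> carrier G" and y: "y \<in> carrier G" and eq: "c x = c y"
    define a where "a = fst (c x)"
    have a: "a \<in> carrier G" using c(1)[OF x] F(2) by (auto simp: a_def)
    have "(x \<otimes> inv a) \<otimes> inv (y \<otimes> inv a) \<in> W"
      using c(2)[OF x] c(2)[OF y] V(3,4) by (simp add: a_def eq)
    also have "(x \<otimes> inv a) \<otimes> inv (y \<otimes> inv a) = x \<otimes> inv y"
      using x y a by (rule quotient_cancel)
    finally have "x \<otimes> inv y \<in> W" .
    moreover have "norm (\<theta> x - \<theta> y) < e"
      using c(3)[OF x] c(3)[OF y] unfolding eq mem_ball dist_norm[symmetric]
      by (metis dist_commute dist_triangle_half_l)
    ultimately show "x \<otimes> inv y \<in> U"
      using W(4) unit_character_dist[OF \<theta> x y] by (simp add: unit_character_one[OF \<theta>])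
  qed
qed

lemma precompact_subgroup:
  assumes H: "subgroup H G" shows "precompact_group (G\<lparr>carrier := H\<rparr>) (subtopology T H)"
proof (rule precompact_groupI)
  interpret K: comm_group "G\<lparr>carrier := H\<rparr>" by (rule subgroup_comm_group[OF H])
  have Hc: "H \<subseteq> carrier G" by (rule subgroup.subset[OF H])
  have sp: "topspace (subtopology T H) = H" using Hc by (auto simp: space)
  show "top_ab_group (G\<lparr>carrier := H\<rparr>) (subtopology T H)"
    unfolding top_ab_group_def
  proof (intro conjI)
    show "comm_group (G\<lparr>carrier := H\<rparr>)" by (rule K.comm_group_axioms)
    show "topspace (subtopology T H) = carrier (G\<lparr>carrier := H\<rparr>)" using sp by simp
    have "continuous_map (subtopology (prod_topology T T) (H \<times> H)) T (\<lambda>(x, y). x \<otimes> y)"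
      using top by (intro continuous_map_from_subtopology) (simp add: top_ab_group_def)
    then have "continuous_map (prod_topology (subtopology T H) (subtopology T H)) (subtopology T H) (\<lambda>(x, y). x \<otimes> y)"
      unfolding subtopology_Times[symmetric] continuous_map_in_subtopology
      using subgroup.m_closed[OF H] by auto
    then show "continuous_map (prod_topology (subtopology T H) (subtopology T H)) (subtopology T H)
       (\<lambda>(x, y). x \<otimes>\<^bsub>G\<lparr>carrier := H\<rparr>\<^esub> y)" by simp
    have "continuous_map (subtopology T H) T (\<lambda>x. inv x)"
      using top by (intro continuous_map_from_subtopology) (simp add: top_ab_group_def)
    then have "continuous_map (subtopology T H) (subtopology T H) (\<lambda>x. inv x)"
      unfolding continuous_map_in_subtopology using subgroup.m_inv_closed[OF H] by auto
    then show "continuous_map (subtopology T H) (subtopology T H) (\<lambda>x. inv\<^bsub>G\<lparr>carrier := H\<rparr>\<^esub> x)"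
      by (rule continuous_map_eq) (use sp H in simp)
    show "Hausdorff_space (subtopology T H)"
      using top by (intro Hausdorff_space_subtopology) (simp add: top_ab_group_def)
  qed
  fix U assume U: "openin (subtopology T H) U" "\<one>\<^bsub>G\<lparr>carrier := H\<rparr>\<^esub> \<in> U"
  obtain W where W: "openin T W" "U = W \<inter> H" using U(1) by (auto simp: openin_subtopology)
  have W1: "\<one> \<in> W" using U(2) W(2) by simp
  obtain V where V: "openin T V" "\<one> \<in> V" "\<And>a b. a \<in> V \<Longrightarrow> b \<in> V \<Longrightarrow> a \<otimes> b \<in> W" "\<And>a. a \<in> V \<Longrightarrow> inv a \<in> V"
    using square_root_neighbourhood[OF W(1) W1] by metis
  obtain F where F: "finite F" "F \<subseteq> carrier G" "\<And>x. x \<in> carrier G \<Longrightarrow> \<exists>a\<in>F. x \<otimes> inv a \<in> V"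
    using finite_cover[OF V(1,2)] by metis
  then obtain c where c: "\<And>x. x \<in> carrier G \<Longrightarrow> c x \<in> F" "\<And>x. x \<in> carrier G \<Longrightarrow> x \<otimes> inv (c x) \<in> V" by metis
  show "\<exists>F. finite F \<and> F \<subseteq> carrier (G\<lparr>carrier := H\<rparr>) \<and> F <#>\<^bsub>G\<lparr>carrier := H\<rparr>\<^esub> U = carrier (G\<lparr>carrier := H\<rparr>)"
  proof (rule K.finite_colouring_cover)
    show "finite (c ` carrier (G\<lparr>carrier := H\<rparr>))" by (rule finite_subset[OF _ F(1)]) (use c(1) Hc in auto)
    show "U \<subseteq> carrier (G\<lparr>carrier := H\<rparr>)" using W(2) by simp
    fix x y assume "x \<in> carrier (G\<lparr>carrier := H\<rparr>)" "y \<in> carrier (G\<lparr>carrier := H\<rparr>)" and eq: "c x = c y"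
    then have xy: "x \<in> H" "y \<in> H" and x: "x \<in> carrier G" and y: "y \<in> carrier G" using Hc by auto
    define a where "a = c x"
    have a: "a \<in> carrier G" using c(1)[OF x] F(2) by (auto simp: a_def)
    have "(x \<otimes> inv a) \<otimes> inv (y \<otimes> inv a) \<in> W"
      using c(2)[OF x] c(2)[OF y] V(3,4) by (simp add: a_def eq)
    also have "(x \<otimes> inv a) \<otimes> inv (y \<otimes> inv a) = x \<otimes> inv y"
      using x y a by (rule quotient_cancel)
    finally have "x \<otimes> inv y \<in> W" .
    moreover have "x \<otimes> inv y \<in> H" using xy H by (simp add: subgroup.m_closed subgroup.m_inv_closed)
    ultimately show "x \<otimes>\<^bsub>G\<lparr>carrier := H\<rparr>\<^esub> inv\<^bsub>G\<lparr>carrier := H\<rparr>\<^esub> y \<in> U"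
      using xy H W(2) by simp
  qed
qed

end


section \<open>\<open>B\<close>-embedded subgroups and characters\<close>

definition circle_point :: "real \<Rightarrow> real set" where
  "circle_point t = \<int> #>\<^bsub>real_add_group\<^esub> t"

text \<open>The isomorphism from the group of cosets of the integers to the unit circle of the complex
  plane. It does not depend on the representative, because cis has period \<open>2 * pi\<close>.\<close>
definition circle_value :: "real set \<Rightarrow> complex" where
  "circle_value c = cis (2 * pi * (SOME t. t \<in> c))"

lemma in_circle_point_iff: "s \<in> circle_point t \<longleftrightarrow> s - t \<in> \<int>"
proof -
  have "s \<in> circle_point t \<longleftrightarrow> (\<exists>n\<in>\<int>. s = n + t)"
    by (auto simp: circle_point_def r_coset_def real_add_group_def)
  also have "\<dots> \<longleftrightarrow> s - t \<in> \<int>" by (metis add_diff_cancel diff_add_cancel)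
  finally show ?thesis .
qed

lemma cis_2pi_eq_iff: "cis (2 * pi * s) = cis (2 * pi * t) \<longleftrightarrow> s - t \<in> \<int>"
proof -
  have "cis (2 * pi * s) = cis (2 * pi * t) \<longleftrightarrow> cis (2 * pi * (s - t)) = 1"
    by (simp add: right_diff_distrib cis_divide[symmetric] divide_eq_1_iff)
  also have "\<dots> \<longleftrightarrow> cos (2 * pi * (s - t)) = 1"
    by (auto simp: complex_eq_iff) (metis cos_one_sin_zero)
  also have "\<dots> \<longleftrightarrow> (\<exists>n::int. s - t = of_int n)"
  proof -
    have "of_int n * 2 * pi = 2 * pi * of_int n" for n by simp
    then have "2 * pi * (s - t) = of_int n * 2 * pi \<longleftrightarrow> s - t = of_int n" for n
      by (simp only: mult_cancel_left) simp
    then show ?thesis unfolding cos_one_2pi_int by blast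
  qed
  also have "\<dots> \<longleftrightarrow> s - t \<in> \<int>" by (auto simp: Ints_def)
  finally show ?thesis .
qed

lemma circle_value_point [simp]: "circle_value (circle_point t) = cis (2 * pi * t)"
proof -
  have "t \<in> circle_point t" by (simp add: in_circle_point_iff)
  then have "(SOME s. s \<in> circle_point t) \<in> circle_point t" by (rule someI)
  then show ?thesis unfolding circle_value_def cis_2pi_eq_iff by (simp add: in_circle_point_iff)
qed

lemma circle_point_eqI:
  assumes "cis (2 * pi * s) = cis (2 * pi * t)" shows "circle_point s = circle_point t"
proof -
  have st: "s - t \<in> \<int>" using assms by (simp add: cis_2pi_eq_iff)
  have "r - s \<in> \<int> \<longleftrightarrow> r - t \<in> \<int>" for r
    using Ints_add[OF _ st, of "r - s"] Ints_diff[OF _ st, of "r - t"] by auto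
  then show ?thesis by (auto simp: in_circle_point_iff)
qed

lemma circle_point_Arg: "norm z = 1 \<Longrightarrow> cis (2 * pi * (Arg z / (2 * pi))) = z"
  using cis_Arg[of z] by (cases "z = 0") (auto simp: sgn_eq)

lemma carrier_circle: "carrier circle_group = range circle_point"
  by (auto simp: circle_group_def carrier_FactGroup circle_point_def real_add_group_def)

lemma circle_point_add: "circle_point s \<otimes>\<^bsub>circle_group\<^esub> circle_point t = circle_point (s + t)"
proof -
  have "circle_point s \<otimes>\<^bsub>circle_group\<^esub> circle_point t = {a + b | a b. a \<in> circle_point s \<and> b \<in> circle_point t}"
    by (auto simp: circle_group_def FactGroup_def set_mult_def real_add_group_def)
  also have "\<dots> = circle_point (s + t)"
  proof (rule Set.set_eqI, rule iffI)
    fix r assume "r \<in> {a + b | a b. a \<in> circle_point s \<and> b \<in> circle_point t}"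
    then obtain a b where "r = a + b" "a - s \<in> \<int>" "b - t \<in> \<int>" by (auto simp: in_circle_point_iff)
    moreover from this have "(a - s) + (b - t) \<in> \<int>" by simp
    ultimately show "r \<in> circle_point (s + t)" by (simp add: in_circle_point_iff algebra_simps)
  next
    fix r assume "r \<in> circle_point (s + t)"
    then have "r - t \<in> circle_point s" by (simp add: in_circle_point_iff algebra_simps)
    moreover have "t \<in> circle_point t" by (simp add: in_circle_point_iff)
    ultimately show "r \<in> {a + b | a b. a \<in> circle_point s \<and> b \<in> circle_point t}"
      by (intro CollectI exI[of _ "r - t"] exI[of _ t]) simp
  qed
  finally show ?thesis .
qed

lemma openin_circle: "openin circle_topology W \<longleftrightarrow> W \<subseteq> range circle_point \<and> open {t. circle_point t \<in> W}"
  unfolding circle_topology_def openin_quotient_topology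
  using carrier_circle by (simp add: circle_group_def circle_point_def)

lemma topspace_circle: "topspace circle_topology = range circle_point"
  unfolding circle_topology_def carrier_circle[symmetric] circle_group_def
  by (rule topspace_quotient_topology) (simp add: real_add_group_def)

context topological_ab_group
begin

text \<open>Characters of the quotient with values in the cosets of the integers correspond to complex
  characters that are trivial on \<open>H\<close>.\<close>
theorem B_embedded_iff_characters:
  assumes H: "subgroup H G"
  shows "B_embedded G T H \<longleftrightarrow>
    (\<forall>\<theta>. unit_character G \<theta> \<and> (\<forall>h\<in>H. \<theta> h = 1) \<longrightarrow> continuous_map T euclidean \<theta>)"
proof -
  have nH: "H \<lhd> G" by (rule subgroup_imp_normal[OF H])
  have Hc: "h \<in> carrier G" if "h \<in> H" for h using subgroup.mem_carrier[OF H that] .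
  have car: "carrier (G Mod H) = (\<lambda>x. H #> x) ` carrier G" by (rule carrier_FactGroup)
  have mult: "(H #> x) \<otimes>\<^bsub>G Mod H\<^esub> (H #> y) = H #> (x \<otimes> y)" if "x \<in> carrier G" "y \<in> carrier G" for x y
    using normal.rcos_sum[OF nH that] by (simp add: FactGroup_def)
  have self: "x \<in> H #> x" if "x \<in> carrier G" for x
    using that subgroup.one_closed[OF H] by (force simp: r_coset_def)
  show ?thesis
  proof (intro iffI allI impI)
    fix \<theta> assume B: "B_embedded G T H" and \<theta>: "unit_character G \<theta> \<and> (\<forall>h\<in>H. \<theta> h = 1)"
    have \<theta>n: "norm (\<theta> x) = 1" if "x \<in> carrier G" for x using \<theta> that by (simp add: unit_character_def)
    have \<theta>m: "\<theta> (x \<otimes> y) = \<theta> x * \<theta> y" if "x \<in> carrier G" "y \<in> carrier G" for x y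
      using \<theta> that by (simp add: unit_character_def)
    define \<phi> where "\<phi> C = circle_point (Arg (\<theta> (SOME x. x \<in> C)) / (2 * pi))" for C
    have \<phi>: "\<phi> (H #> x) = circle_point (Arg (\<theta> x) / (2 * pi))" if x: "x \<in> carrier G" for x
    proof -
      have "(SOME y. y \<in> H #> x) \<in> H #> x" using self[OF x] by (rule someI)
      then obtain h where "h \<in> H" "(SOME y. y \<in> H #> x) = h \<otimes> x" by (auto simp: r_coset_def)
      then show ?thesis using \<theta>m[OF Hc x] \<theta> by (simp add: \<phi>_def)
    qed
    have val: "circle_value (\<phi> (H #> x)) = \<theta> x" if x: "x \<in> carrier G" for x
      unfolding \<phi>[OF x] circle_value_point using circle_point_Arg[OF \<theta>n[OF x]] .
    have "\<phi> \<in> hom (G Mod H) circle_group"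
    proof (rule homI)
      fix C assume "C \<in> carrier (G Mod H)"
      then show "\<phi> C \<in> carrier circle_group" by (simp add: \<phi>_def carrier_circle)
      fix D assume "D \<in> carrier (G Mod H)"
      with \<open>C \<in> carrier (G Mod H)\<close> obtain x y where xy: "x \<in> carrier G" "y \<in> carrier G" "C = H #> x" "D = H #> y"
        unfolding car by blast
      have xym: "x \<otimes> y \<in> carrier G" using xy by simp
      show "\<phi> (C \<otimes>\<^bsub>G Mod H\<^esub> D) = \<phi> C \<otimes>\<^bsub>circle_group\<^esub> \<phi> D"
        unfolding xy(3,4) mult[OF xy(1,2)] \<phi>[OF xy(1)] \<phi>[OF xy(2)] \<phi>[OF xym] circle_point_add
      proof (rule circle_point_eqI)
        show "cis (2 * pi * (Arg (\<theta> (x \<otimes> y)) / (2 * pi))) = cis (2 * pi * (Arg (\<theta> x) / (2 * pi) + Arg (\<theta> y) / (2 * pi)))"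
          unfolding distrib_left cis_mult[symmetric] circle_point_Arg[OF \<theta>n[OF xy(1)]]
            circle_point_Arg[OF \<theta>n[OF xy(2)]] circle_point_Arg[OF \<theta>n[OF xym]] by (rule \<theta>m[OF xy(1,2)])
      qed
    qed
    then have cont: "continuous_map (quotient_topology G T H) circle_topology \<phi>"
      using B by (simp add: B_embedded_def)
    show "continuous_map T euclidean \<theta>" unfolding continuous_map_def
    proof (intro conjI allI impI)
      fix O' :: "complex set" assume "openin euclidean O'"
      then have O': "open O'" by (simp only: open_openin)
      define W where "W = {c \<in> range circle_point. circle_value c \<in> O'}"
      have "open ((\<lambda>t. cis (2 * pi * t)) -` O')"
        by (rule open_vimage[OF O']) (intro continuous_intros)
      then have "openin circle_topology W" by (simp add: openin_circle W_def vimage_def)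
      note W = this
      have key: "\<phi> (H #> x) \<in> W \<longleftrightarrow> \<theta> x \<in> O'" if "x \<in> carrier G" for x
        using val[OF that] by (auto simp: W_def \<phi>_def)
      from openin_continuous_map_preimage[OF cont W]
      have "openin T {x \<in> topspace T. H #> x \<in> {C \<in> topspace (quotient_topology G T H). \<phi> C \<in> W}}"
        unfolding openin_quotient_topology by blast
      also have "{x \<in> topspace T. H #> x \<in> {C \<in> topspace (quotient_topology G T H). \<phi> C \<in> W}} = {x \<in> topspace T. \<theta> x \<in> O'}"
        using key by (auto simp: topspace_quotient_topology[OF space] car space)
      finally show "openin T {x \<in> topspace T. \<theta> x \<in> O'}" .
    qed auto
  next
    assume all: "\<forall>\<theta>. unit_character G \<theta> \<and> (\<forall>h\<in>H. \<theta> h = 1) \<longrightarrow> continuous_map T euclidean \<theta>"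
    show "B_embedded G T H" unfolding B_embedded_def
    proof (intro conjI H ballI)
      fix \<phi> assume \<phi>: "\<phi> \<in> hom (G Mod H) circle_group"
      define \<theta> where "\<theta> x = circle_value (\<phi> (H #> x))" for x
      have rng: "\<phi> (H #> x) \<in> range circle_point" if "x \<in> carrier G" for x
        using hom_in_carrier[OF \<phi>, of "H #> x"] that by (auto simp: car carrier_circle)
      have \<phi>m: "\<phi> (H #> (x \<otimes> y)) = \<phi> (H #> x) \<otimes>\<^bsub>circle_group\<^esub> \<phi> (H #> y)" if "x \<in> carrier G" "y \<in> carrier G" for x y
        unfolding mult[OF that, symmetric] by (rule hom_mult[OF \<phi>]) (use that in \<open>auto simp: car\<close>)
      have ch: "unit_character G \<theta>"
        unfolding unit_character_def
      proof (intro conjI ballI)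
        fix x assume x: "x \<in> carrier G"
        obtain s where s: "\<phi> (H #> x) = circle_point s" using rng[OF x] by blast
        show "norm (\<theta> x) = 1" by (simp add: \<theta>_def s)
        fix y assume y: "y \<in> carrier G"
        obtain t where t: "\<phi> (H #> y) = circle_point t" using rng[OF y] by blast
        show "\<theta> (x \<otimes> y) = \<theta> x * \<theta> y"
          by (simp add: \<theta>_def \<phi>m[OF x y] s t circle_point_add distrib_left cis_mult)
      qed
      have "\<theta> h = 1" if h: "h \<in> H" for h
      proof -
        have "H #> h = H #> \<one>" using h H by (metis coset_join2 coset_mult_one Hc subgroup.subset)
        then show ?thesis using unit_character_one[OF ch] by (simp add: \<theta>_def)
      qed
      with all ch have cont: "continuous_map T euclidean \<theta>" by blast
      show "continuous_map (quotient_topology G T H) circle_topology \<phi>" unfolding continuous_map_def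
      proof (intro conjI allI impI)
        show "\<phi> \<in> topspace (quotient_topology G T H) \<rightarrow> topspace circle_topology"
          using rng by (auto simp: topspace_quotient_topology[OF space] topspace_circle car)
        fix W assume W: "openin circle_topology W"
        define A where "A = {t. circle_point t \<in> W}"
        have A: "open A" using W by (simp add: openin_circle A_def)
        \<comment> \<open>The map to the unit circle is open: the complement of the image of \<open>A\<close> is the image of a
          compact set of representatives.\<close>
        define K where "K = (\<lambda>t. cis (2 * pi * t)) ` ({0..1} - A)"
        have "compact ({0..1} - A)" using A by (intro compact_diff) auto
        then have "compact K" unfolding K_def by (intro compact_continuous_image continuous_intros)
        then have oK: "open (- K)" by (simp add: compact_imp_closed open_Compl)
        have key: "\<phi> (H #> x) \<in> W \<longleftrightarrow> \<theta> x \<in> - K" if x: "x \<in> carrier G" for x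
        proof -
          obtain s where s: "\<phi> (H #> x) = circle_point s" using rng[OF x] by blast
          define t where "t = frac s"
          have "s - t \<in> \<int>" by (simp add: t_def frac_def)
          then have "cis (2 * pi * s) = cis (2 * pi * t)" by (simp add: cis_2pi_eq_iff)
          then have t: "\<phi> (H #> x) = circle_point t" using s circle_point_eqI by metis
          have t01: "t \<in> {0..1}" using frac_ge_0[of s] frac_lt_1[of s] by (simp add: t_def)
          have \<theta>x: "\<theta> x = cis (2 * pi * t)" by (simp add: \<theta>_def t)
          show ?thesis
          proof
            assume "\<phi> (H #> x) \<in> W"
            then have tA: "circle_point t \<in> W" by (simp add: t)
            show "\<theta> x \<in> - K"
            proof
              assume "\<theta> x \<in> K"
              then obtain r where "r \<notin> A" "cis (2 * pi * t) = cis (2 * pi * r)" by (auto simp: K_def \<theta>x)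
              then show False using tA circle_point_eqI[of t r] by (simp add: A_def)
            qed
          next
            assume "\<theta> x \<in> - K"
            then have "t \<in> A" using t01 \<theta>x by (auto simp: K_def)
            then show "\<phi> (H #> x) \<in> W" by (simp add: t A_def)
          qed
        qed
        have "openin T {x \<in> topspace T. \<theta> x \<in> - K}"
          by (rule openin_continuous_map_preimage[OF cont]) (use oK in simp)
        also have "{x \<in> topspace T. \<theta> x \<in> - K} = {x \<in> topspace T. H #> x \<in> {C \<in> topspace (quotient_topology G T H). \<phi> C \<in> W}}"
          using key by (auto simp: topspace_quotient_topology[OF space] car space)
        finally show "openin (quotient_topology G T H) {C \<in> topspace (quotient_topology G T H). \<phi> C \<in> W}"
          unfolding openin_quotient_topology by (simp add: topspace_quotient_topology[OF space])
      qed
    qed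
  qed
qed

end

context precompact_ab_group
begin

text \<open>If \<open>\<theta> (u\<^sub>n)\<close> tends to \<open>1\<close>, then \<open>u\<close> converges to \<open>\<one>\<close> in the join of \<open>T\<close> and \<open>\<theta>\<close>, which is precompact.
  Hence the join is no finer than the finest such topology.\<close>

lemma tau_character_continuous:
  assumes tau: "is_tau G u T" and \<theta>: "unit_character G \<theta>" and lim: "tendsto (\<lambda>n. \<theta> (u n)) 1 sequentially"
  shows "continuous_map T euclidean \<theta>"
proof -
  have "limitin (join_character \<theta>) u \<one> sequentially"
    using tau lim unit_character_one[OF \<theta>] by (intro join_limit) (auto simp: is_tau_def)
  then have fin: "openin T W" if "openin (join_character \<theta>) W" for W
    using tau precompact_join[OF \<theta>] that unfolding is_tau_def by blast
  show ?thesis unfolding continuous_map_def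
    using fin[OF join_character_open] by (auto simp: space)
qed

lemma character_limit_one:
  assumes "unit_character G \<theta>" "continuous_map T euclidean \<theta>" "limitin T u \<one> sequentially"
  shows "tendsto (\<lambda>n. \<theta> (u n)) 1 sequentially"
  using continuous_map_limit[OF assms(2,3)] unit_character_one[OF assms(1)] by (simp add: o_def)

text \<open>A group topology is not strictly refined by one that induces the same topologies on a subgroup
  and on the quotient by it. For \<open>T\<close> and its join with \<open>\<theta>\<close> the quotient topologies agree if all
  characters trivial on \<open>H\<close> are \<open>T\<close>-continuous. Concretely, the characters provided for the join write a
  point \<open>x\<close> close to \<open>\<one>\<close> in \<open>T\<close> as \<open>v \<otimes> inv h\<close> with \<open>v\<close> small in the join; then \<open>h\<close> is small in \<open>T\<close>, hence also
  small in the join since \<open>h \<in> H\<close>, and so is \<open>x\<close>.\<close>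
lemma character_continuous_extension:
  assumes H: "subgroup H G" and \<theta>: "unit_character G \<theta>"
    and quot: "\<And>\<psi>. unit_character G \<psi> \<Longrightarrow> (\<And>h. h \<in> H \<Longrightarrow> \<psi> h = 1) \<Longrightarrow> continuous_map T euclidean \<psi>"
    and sub: "\<And>W. openin (subtopology (join_character \<theta>) H) W \<Longrightarrow> openin (subtopology T H) W"
  shows "continuous_map T euclidean \<theta>"
proof (rule character_continuousI[OF \<theta>])
  fix e :: real assume e: "e > 0"
  interpret J: precompact_ab_group G "join_character \<theta>" by unfold_locales (rule precompact_join[OF \<theta>])
  define U where "U = {x \<in> carrier G. norm (\<theta> x - 1) < e}"
  have U: "openin (join_character \<theta>) U" "\<one> \<in> U"
    unfolding U_def using J.character_ball_open[OF join_character_continuous] e unit_character_one[OF \<theta>] by auto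
  obtain V where V: "openin (join_character \<theta>) V" "\<one> \<in> V" "\<And>a b. a \<in> V \<Longrightarrow> b \<in> V \<Longrightarrow> a \<otimes> b \<in> U" "\<And>a. a \<in> V \<Longrightarrow> inv a \<in> V"
    using J.square_root_neighbourhood[OF U] by metis
  have "openin (subtopology T H) (V \<inter> H)" using V(1) by (intro sub) (auto simp: openin_subtopology)
  then obtain Q where Q: "openin T Q" "V \<inter> H = Q \<inter> H" by (auto simp: openin_subtopology)
  have "\<one> \<in> Q" using Q(2) V(2) subgroup.one_closed[OF H] by blast
  then obtain Q1 where Q1: "openin T Q1" "\<one> \<in> Q1" "\<And>a b. a \<in> Q1 \<Longrightarrow> b \<in> Q1 \<Longrightarrow> a \<otimes> b \<in> Q" "\<And>a. a \<in> Q1 \<Longrightarrow> inv a \<in> Q1"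
    using square_root_neighbourhood[OF Q(1)] by metis
  have V': "openin (join_character \<theta>) (V \<inter> Q1)" "\<one> \<in> V \<inter> Q1"
    using V Q1 by (auto intro: openin_Int join_coarse)
  obtain \<Gamma> \<eta> where \<Gamma>: "finite \<Gamma>" "\<eta> > 0"
    "\<And>\<psi>. \<psi> \<in> \<Gamma> \<Longrightarrow> unit_character G \<psi> \<and> continuous_map (join_character \<theta>) euclidean \<psi> \<and> (\<forall>h\<in>H. \<psi> h = 1)"
    "\<And>x. x \<in> carrier G \<Longrightarrow> (\<And>\<psi>. \<psi> \<in> \<Gamma> \<Longrightarrow> norm (\<psi> x - 1) < \<eta>) \<Longrightarrow> \<exists>h\<in>H. x \<otimes> h \<in> V \<inter> Q1"
    using J.characters_trivial_on_subgroup[OF H V'] by blast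
  define W where "W = Q1 \<inter> {x \<in> carrier G. \<forall>\<psi>\<in>\<Gamma>. norm (\<psi> x - 1) < \<eta>}"
  have "openin T W"
    unfolding W_def using \<Gamma>(1,3) quot by (intro openin_Int Q1(1) finite_character_ball_open) blast+
  moreover have "\<one> \<in> W"
  proof -
    have "norm (\<psi> \<one> - 1) < \<eta>" if "\<psi> \<in> \<Gamma>" for \<psi>
      using unit_character_one[of \<psi>] \<Gamma>(2) \<Gamma>(3)[OF that] by simp
    then show ?thesis using Q1(2) \<Gamma>(2) by (simp add: W_def)
  qed
  moreover have "norm (\<theta> x - 1) < e" if x: "x \<in> W" for x
  proof -
    have xc: "x \<in> carrier G" and xQ: "x \<in> Q1" using x by (auto simp: W_def)
    obtain h where h: "h \<in> H" "x \<otimes> h \<in> V" "x \<otimes> h \<in> Q1" using \<Gamma>(4)[OF xc] x by (auto simp: W_def)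
    have hc: "h \<in> carrier G" by (rule subgroup.mem_carrier[OF H h(1)])
    have "inv x \<otimes> (x \<otimes> h) \<in> Q" using Q1(3)[OF Q1(4)[OF xQ] h(3)] .
    then have "h \<in> Q" using xc hc by (simp add: m_assoc[symmetric])
    then have "inv h \<in> V" using Q(2) h(1) V(4) by blast
    then have "(x \<otimes> h) \<otimes> inv h \<in> U" using V(3)[OF h(2)] by blast
    then show ?thesis using xc hc by (simp add: m_assoc U_def)
  qed
  ultimately show "\<exists>W. openin T W \<and> \<one> \<in> W \<and> (\<forall>u\<in>W. norm (\<theta> u - 1) < e)" by blast
qed

end

section \<open>The characterization of ss-characterized groups\<close>

lemma (in comm_group) countable_generate:
  assumes S: "countable S" "S \<subseteq> carrier G" shows "countable (generate G S)"
proof -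
  define f where "f L = foldr (\<lambda>x y. x \<otimes> y) L \<one>" for L
  define S' where "S' = S \<union> (\<lambda>x. inv x) ` S"
  have S': "S' \<subseteq> carrier G" using S by (auto simp: S'_def)
  have fc: "f L \<in> carrier G" if "set L \<subseteq> S'" for L
    using that S' by (induction L) (auto simp: f_def)
  have fa: "f (K @ L) = f K \<otimes> f L" if "set K \<subseteq> S'" "set L \<subseteq> S'" for K L
    using that
  proof (induction K)
    case (Cons x K)
    then have "x \<in> carrier G" "f K \<in> carrier G" "f L \<in> carrier G" using fc S' by auto
    then show ?case using Cons by (simp add: f_def m_assoc)
  qed (use fc in \<open>simp add: f_def\<close>)
  have "g \<in> f ` lists S'" if "g \<in> generate G S" for g
    using that
  proof (induction rule: generate.induct)
    case one then show ?case by (intro image_eqI[of _ _ "[]"]) (auto simp: f_def)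
  next
    case (incl h) then show ?case using S by (intro image_eqI[of _ _ "[h]"]) (auto simp: f_def S'_def)
  next
    case (inv h) then show ?case using S by (intro image_eqI[of _ _ "[inv h]"]) (auto simp: f_def S'_def)
  next
    case (eng h1 h2)
    then obtain K L where KL: "K \<in> lists S'" "h1 = f K" "L \<in> lists S'" "h2 = f L" by blast
    then have "h1 \<otimes> h2 = f (K @ L)" using fa[of K L] by (simp add: in_lists_conv_set subset_iff)
    then show ?case using KL by (intro image_eqI[of _ _ "K @ L"]) auto
  qed
  moreover have "countable (f ` lists S')" using S(1) by (intro countable_image countable_lists) (simp add: S'_def)
  ultimately show ?thesis by (meson countable_subset subsetI)
qed

theorem theoremC:
  fixes G :: "('a, 'b) monoid_scheme" and T :: "'a topology"
  assumes "precompact_group G T"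
  shows "ss_characterized G T \<longleftrightarrow>
    (\<exists>H. subgroup H G \<and> countable H \<and> B_embedded G T H \<and>
         ss_characterized (G\<lparr>carrier := H\<rparr>) (subtopology T H))"
proof -
  interpret precompact_ab_group G T by unfold_locales (rule assms)
  show ?thesis
  proof
    assume "ss_characterized G T"
    then obtain u where u: "range u \<subseteq> carrier G" and tau: "is_tau G u T"
      by (auto simp: ss_characterized_def TB_sequence_def)
    have lim: "limitin T u \<one>\<^bsub>G\<^esub> sequentially" using tau by (simp add: is_tau_def)
    define H where "H = generate G (range u)"
    have H: "subgroup H G" unfolding H_def by (rule generate_is_subgroup[OF u])
    have uH: "u n \<in> H" for n unfolding H_def by (rule generate.incl) simp
    have "countable H" unfolding H_def by (rule countable_generate[OF _ u]) simp
    moreover have "B_embedded G T H"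
      unfolding B_embedded_iff_characters[OF H]
    proof (intro allI impI)
      fix \<theta> assume \<theta>: "unit_character G \<theta> \<and> (\<forall>h\<in>H. \<theta> h = 1)"
      then have "tendsto (\<lambda>n. \<theta> (u n)) 1 sequentially" using uH by simp
      with \<theta> show "continuous_map T euclidean \<theta>" using tau_character_continuous[OF tau] by blast
    qed
    moreover have "ss_characterized (G\<lparr>carrier := H\<rparr>) (subtopology T H)"
    proof -
      let ?G = "G\<lparr>carrier := H\<rparr>" and ?T = "subtopology T H"
      interpret K: precompact_ab_group ?G ?T by unfold_locales (rule precompact_subgroup[OF H])
      have limH: "limitin ?T u \<one>\<^bsub>?G\<^esub> sequentially"
        using lim uH subgroup.one_closed[OF H] by (simp add: limitin_subtopology)
      have "openin ?T W" if S: "precompact_group ?G S" "limitin S u \<one>\<^bsub>?G\<^esub> sequentially" and W: "openin S W" for S W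
      proof (rule K.finer_by_characters[OF S(1) _ W])
        interpret S: precompact_ab_group ?G S by unfold_locales (rule S(1))
        fix \<psi> assume \<psi>: "unit_character ?G \<psi>" "continuous_map S euclidean \<psi>"
        obtain \<theta> where \<theta>: "unit_character G \<theta>" "\<And>h. h \<in> H \<Longrightarrow> \<theta> h = \<psi> h"
          using extend_unit_character[OF H \<psi>(1)] by metis
        have "tendsto (\<lambda>n. \<psi> (u n)) 1 sequentially" by (rule S.character_limit_one[OF \<psi> S(2)])
        then have "continuous_map T euclidean \<theta>"
          using tau_character_continuous[OF tau \<theta>(1)] \<theta>(2)[OF uH] by simp
        then have "continuous_map ?T euclidean \<theta>" by (rule continuous_map_from_subtopology)
        then show "continuous_map ?T euclidean \<psi>" by (rule continuous_map_eq) (simp add: \<theta>(2))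
      qed
      then have "is_tau ?G u ?T" unfolding is_tau_def using K.precompact limH by blast
      moreover have "TB_sequence ?G u" unfolding TB_sequence_def using K.precompact limH uH by auto
      ultimately show ?thesis unfolding ss_characterized_def using K.precompact by blast
    qed
    ultimately show "\<exists>H. subgroup H G \<and> countable H \<and> B_embedded G T H \<and>
         ss_characterized (G\<lparr>carrier := H\<rparr>) (subtopology T H)" using H by blast
  next
    assume "\<exists>H. subgroup H G \<and> countable H \<and> B_embedded G T H \<and>
         ss_characterized (G\<lparr>carrier := H\<rparr>) (subtopology T H)"
    then obtain H u where H: "subgroup H G" and B: "B_embedded G T H" and uH: "range u \<subseteq> H"
      and tau: "is_tau (G\<lparr>carrier := H\<rparr>) u (subtopology T H)"
      by (auto simp: ss_characterized_def TB_sequence_def)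
    have u: "range u \<subseteq> carrier G" using uH subgroup.subset[OF H] by blast
    have lim: "limitin T u \<one>\<^bsub>G\<^esub> sequentially"
      using tau by (simp add: is_tau_def limitin_subtopology)
    have quot: "continuous_map T euclidean \<psi>" if "unit_character G \<psi>" "\<And>h. h \<in> H \<Longrightarrow> \<psi> h = 1" for \<psi>
      using B that unfolding B_embedded_iff_characters[OF H] by blast
    have "openin T W" if S: "precompact_group G S" "limitin S u \<one>\<^bsub>G\<^esub> sequentially" and W: "openin S W" for S W
    proof (rule finer_by_characters[OF S(1) _ W])
      interpret S: precompact_ab_group G S by unfold_locales (rule S(1))
      fix \<theta> assume \<theta>: "unit_character G \<theta>" "continuous_map S euclidean \<theta>"
      interpret J: precompact_ab_group G "join_character \<theta>" by unfold_locales (rule precompact_join[OF \<theta>(1)])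
      have "tendsto (\<lambda>n. \<theta> (u n)) 1 sequentially" by (rule S.character_limit_one[OF \<theta> S(2)])
      then have "limitin (join_character \<theta>) u \<one>\<^bsub>G\<^esub> sequentially"
        using lim unit_character_one[OF \<theta>(1)] by (intro join_limit) auto
      then have "limitin (subtopology (join_character \<theta>) H) u \<one>\<^bsub>G\<lparr>carrier := H\<rparr>\<^esub> sequentially"
        using uH subgroup.one_closed[OF H] by (simp add: limitin_subtopology range_subsetD)
      then have sub: "openin (subtopology T H) W" if "openin (subtopology (join_character \<theta>) H) W" for W
        using tau J.precompact_subgroup[OF H] that unfolding is_tau_def by blast
      show "continuous_map T euclidean \<theta>"
        by (rule character_continuous_extension[OF H \<theta>(1) quot sub])
    qed
    then have "is_tau G u T" unfolding is_tau_def using assms lim by blast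
    moreover have "TB_sequence G u" unfolding TB_sequence_def using assms lim u by blast
    ultimately show "ss_characterized G T" unfolding ss_characterized_def using assms by blast
  qed
qed

end
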